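(* Let $A[1..n]$ be an array whose entries form a permutation of $\{1,\dots,n\}$, and let $\rho$ be the number of runs of $A$. In the word RAM model with word size $w=\Omega(\lg n)$, there is a data structure (index) built from $A$ that occupies $2\rho+\lceil\lg\binom{n}{\rho}\rceil+o(n)$ bits and that, given read access to $A$, answers any range minimum query $\mathrm{RMQ}_A(i,j)$, $1\le i\le j\le n$, using one comparison between entries of $A$ and $O(1)$ operations on the index (a systematic compressed succinct index).
   Context: $\mathrm{RMQ}_A(i,j)$ denotes the position of the minimum of $A[i..j]$. A run of $A$ is a maximal block of consecutive positions on which $A$ is increasing; the number of runs is $\rho=1+|\{t : 1\le t<n,\ A[t+1]<A[t]\}|$. *)

theory Defs
  imports Complex_Main "HOL-Library.Landau_Symbols"
begin

text \<open>An array \<open>A[1..n]\<close> is a function on \<^typ>\<open>nat\<close> of which only the values on \<open>{1..n}\<close> matter.\<close>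

definition runs :: "nat \<Rightarrow> (nat \<Rightarrow> nat) \<Rightarrow> nat"
  where "runs n A = 1 + card {t. 1 \<le> t \<and> t < n \<and> A (t + 1) < A t}"

definition rmq :: "(nat \<Rightarrow> nat) \<Rightarrow> nat \<Rightarrow> nat \<Rightarrow> nat"
  where "rmq A i j = (ARG_MIN A k. k \<in> {i..j})"

lemma rmq_unique_minimum:
  assumes "inj_on A {i..j}" and "i \<le> j"
  shows "rmq A i j \<in> {i..j}" and "\<And>k. k \<in> {i..j} \<Longrightarrow> k \<noteq> rmq A i j \<Longrightarrow> A (rmq A i j) < A k"
proof -
  have mem: "rmq A i j \<in> {i..j} \<and> (\<forall>k. k \<in> {i..j} \<longrightarrow> A (rmq A i j) \<le> A k)"
    unfolding rmq_def by (rule arg_min_nat_lemma[of "\<lambda>k. k \<in> {i..j}" i]) (use assms(2) in simp)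
  then show "rmq A i j \<in> {i..j}" by blast
  fix k assume k: "k \<in> {i..j}" "k \<noteq> rmq A i j"
  then have "A k \<noteq> A (rmq A i j)" using mem assms(1) by (metis inj_onD)
  with mem k show "A (rmq A i j) < A k" by (simp add: le_neq_implies_less)
qed


text \<open>
  A word RAM with word size \<open>w\<close>. Registers hold words, that is, numbers below \<open>2 ^ w\<close>.
  Since \<open>w = \<Omega>(lg n)\<close> only guarantees that a position fits into a constant number of words,
  addresses are given by lists of registers, read as base-\<open>2 ^ w\<close> numerals with the least
  significant word first; the arithmetic and logical instructions work on single words.
\<close>

datatype binop = ADD | SUB | MUL | DIV | MOD | AND | OR | XOR | SHL | SHR | LT | EQ

fun binop_val :: "nat \<Rightarrow> binop \<Rightarrow> nat \<Rightarrow> nat \<Rightarrow> nat" where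
  "binop_val w ADD x y = take_bit w (x + y)"
| "binop_val w SUB x y = take_bit w (x + 2 ^ w - y)"
| "binop_val w MUL x y = take_bit w (x * y)"
| "binop_val w DIV x y = take_bit w (x div y)"
| "binop_val w MOD x y = take_bit w (x mod y)"
| "binop_val w AND x y = take_bit w (Bit_Operations.and x y)"
| "binop_val w OR x y = take_bit w (Bit_Operations.or x y)"
| "binop_val w XOR x y = take_bit w (Bit_Operations.xor x y)"
| "binop_val w SHL x y = take_bit w (push_bit y x)"
| "binop_val w SHR x y = take_bit w (drop_bit y x)"
| "binop_val w LT x y = take_bit w (of_bool (x < y))"
| "binop_val w EQ x y = take_bit w (of_bool (x = y))"

type_synonym reg = nat
type_synonym regs = "reg \<Rightarrow> nat"

definition number_at :: "nat \<Rightarrow> regs \<Rightarrow> reg list \<Rightarrow> nat"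
  where "number_at w s rs = horner_sum s (2 ^ w) rs"

text \<open>The \<open>w\<close> consecutive bits of \<open>B\<close> that start at bit position \<open>a\<close>, as a word; past the end of
  \<open>B\<close> only zeros are read, so the length of \<open>B\<close> carries no information.\<close>

definition read_word :: "nat \<Rightarrow> bool list \<Rightarrow> nat \<Rightarrow> nat"
  where "read_word w B a = horner_sum of_bool 2 (map (\<lambda>k. k < length B \<and> B ! k) [a..<a + w])"

datatype prog =
    Skip
  | Const reg nat
  | Move reg reg
  | Op binop reg reg reg
  | Load reg "reg list"
  | Compare reg "reg list" "reg list"
  | Seq prog prog
  | Cond reg prog prog
  | While reg prog

text \<open>
  \<open>exec w B n A P s t m s'\<close>: started with register contents \<open>s\<close>, the program \<open>P\<close> halts with
  register contents \<open>s'\<close> after \<open>t\<close> operations, of which \<open>m\<close> are comparisons between entries of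
  \<open>A\<close>. The index \<open>B\<close> is accessible through \<^const>\<open>Load\<close> only, the array \<open>A[1..n]\<close> through
  \<^const>\<open>Compare\<close> only; comparing entries outside of the array makes the machine stuck.
\<close>

inductive exec ::
  "nat \<Rightarrow> bool list \<Rightarrow> nat \<Rightarrow> (nat \<Rightarrow> nat) \<Rightarrow> prog \<Rightarrow> regs \<Rightarrow> nat \<Rightarrow> nat \<Rightarrow> regs \<Rightarrow> bool"
  for w :: nat and B :: "bool list" and n :: nat and A :: "nat \<Rightarrow> nat"
where
  Skip: "exec w B n A Skip s 0 0 s"
| Const: "exec w B n A (Const d c) s 1 0 (s(d := take_bit w c))"
| Move: "exec w B n A (Move d r) s 1 0 (s(d := s r))"
| Op: "exec w B n A (Op f d r r') s 1 0 (s(d := binop_val w f (s r) (s r')))"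
| Load: "exec w B n A (Load d rs) s 1 0 (s(d := read_word w B (number_at w s rs)))"
| Compare: "p = number_at w s rs \<Longrightarrow> q = number_at w s rs' \<Longrightarrow> p \<in> {1..n} \<Longrightarrow> q \<in> {1..n} \<Longrightarrow>
    exec w B n A (Compare d rs rs') s 1 1 (s(d := take_bit w (of_bool (A p < A q))))"
| Seq: "exec w B n A P s t m s' \<Longrightarrow> exec w B n A Q s' t' m' s'' \<Longrightarrow>
    exec w B n A (Seq P Q) s (t + t') (m + m') s''"
| CondTrue: "s r \<noteq> 0 \<Longrightarrow> exec w B n A P s t m s' \<Longrightarrow>
    exec w B n A (Cond r P Q) s (t + 1) m s'"
| CondFalse: "s r = 0 \<Longrightarrow> exec w B n A Q s t m s' \<Longrightarrow>
    exec w B n A (Cond r P Q) s (t + 1) m s'"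
| WhileFalse: "s r = 0 \<Longrightarrow> exec w B n A (While r P) s 1 0 s"
| WhileTrue: "s r \<noteq> 0 \<Longrightarrow> exec w B n A P s t m s' \<Longrightarrow> exec w B n A (While r P) s' t' m' s'' \<Longrightarrow>
    exec w B n A (While r P) s (t + t' + 1) (m + m') s''"

inductive_cases SkipE: "exec w B n A Skip s t m s'"
inductive_cases ConstE: "exec w B n A (Const d c) s t m s'"
inductive_cases MoveE: "exec w B n A (Move d r) s t m s'"
inductive_cases OpE: "exec w B n A (Op f d r r') s t m s'"
inductive_cases LoadE: "exec w B n A (Load d rs) s t m s'"
inductive_cases CompareE: "exec w B n A (Compare d rs rs') s t m s'"
inductive_cases SeqE: "exec w B n A (Seq P Q) s t m s'"
inductive_cases CondE: "exec w B n A (Cond r P Q) s t m s'"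
inductive_cases WhileE: "exec w B n A (While r P) s t m s'"

lemma exec_deterministic:
  assumes "exec w B n A P s t m s'" and "exec w B n A P s u k v"
  shows "t = u \<and> m = k \<and> s' = v"
  using assms
proof (induction arbitrary: u k v rule: exec.induct)
  case (Seq P s t m s' Q t' m' s'')
  from Seq.prems obtain t1 t2 m1 m2 s1
    where *: "exec w B n A P s t1 m1 s1" "exec w B n A Q s1 t2 m2 v"
      "u = t1 + t2" "k = m1 + m2"
    by (rule SeqE)
  from Seq.IH(1)[OF *(1)] have "t = t1 \<and> m = m1 \<and> s' = s1" .
  moreover from this Seq.IH(2)[of t2 m2 v] *(2) have "t' = t2 \<and> m' = m2 \<and> s'' = v" by blast
  ultimately show ?case using * by simp
next
  case (WhileTrue s r P t m s' t' m' s'')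
  from WhileTrue.prems WhileTrue.hyps(1) obtain t1 t2 m1 m2 s1
    where *: "exec w B n A P s t1 m1 s1" "exec w B n A (While r P) s1 t2 m2 v"
      "u = t1 + t2 + 1" "k = m1 + m2"
    by (auto elim: WhileE)
  from WhileTrue.IH(1)[OF *(1)] have "t = t1 \<and> m = m1 \<and> s' = s1" .
  moreover from this WhileTrue.IH(2)[of t2 m2 v] *(2) have "t' = t2 \<and> m' = m2 \<and> s'' = v" by blast
  ultimately show ?case using * by simp
next
  case (CondTrue s r P t m s' Q)
  from CondTrue.prems show ?case
    by (rule CondE) (use CondTrue.hyps(1) CondTrue.IH in fastforce)+
next
  case (CondFalse s r Q t m s' P)
  from CondFalse.prems show ?case
    by (rule CondE) (use CondFalse.hyps(1) CondFalse.IH in fastforce)+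
next
  case (WhileFalse s r P)
  from WhileFalse.prems show ?case
    by (rule WhileE) (use WhileFalse.hyps in simp_all)
next
  case (Compare p s rs q rs' d)
  from Compare.prems show ?case
    by (rule CompareE) (use Compare.hyps in simp)
qed (erule SkipE ConstE MoveE OpE LoadE; simp)+

text \<open>
  Inputs and outputs are numbers of \<open>K\<close> words. Register 0 initially holds the word size (which is
  below \<open>2 ^ w\<close>); the inputs follow in consecutive groups of \<open>K\<close> registers; all other registers are
  zero. The output is left in registers \<open>0, \<dots>, K - 1\<close>.
\<close>

definition to_words :: "nat \<Rightarrow> nat \<Rightarrow> nat \<Rightarrow> nat list"
  where "to_words w K x = map (\<lambda>k. x div 2 ^ (k * w) mod 2 ^ w) [0..<K]"

definition init_regs :: "nat \<Rightarrow> nat \<Rightarrow> nat list \<Rightarrow> regs"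
  where "init_regs w K xs r =
    (let ws = w # concat (map (to_words w K) xs) in if r < length ws then ws ! r else 0)"

definition result_of :: "nat \<Rightarrow> nat \<Rightarrow> regs \<Rightarrow> nat"
  where "result_of w K s = number_at w s [0..<K]"

lemma read_word_less: "read_word w B a < 2 ^ w"
  using horner_sum_of_bool_2_less[of "map (\<lambda>k. k < length B \<and> B ! k) [a..<a + w]"]
  unfolding read_word_def by simp

lemma binop_val_less: "binop_val w f x y < 2 ^ w"
  by (cases f) (simp_all only: binop_val.simps take_bit_nat_less_exp)

lemma exec_words:
  assumes "exec w B n A P s t m s'" and "\<And>r. s r < 2 ^ w"
  shows "s' r < 2 ^ w"
  using assms by (induction arbitrary: r rule: exec.induct)
    (auto simp: binop_val_less read_word_less)

lemma init_regs_words: "init_regs w K xs r < 2 ^ w"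
proof -
  have "x < 2 ^ w" if "x \<in> set (w # concat (map (to_words w K) xs))" for x
    using that by (auto simp: to_words_def)
  then show ?thesis
    unfolding init_regs_def Let_def using nth_mem by (simp del: nth_Cons_Suc length_Cons set_simps)
qed

end

theory Submission
  imports Defs "HOL-Library.Discrete_Functions" "HOL-Real_Asymp.Real_Asymp"
begin

text \<open>
  The minimum of \<open>A[i..j]\<close> is at \<open>i\<close> or at a run head in \<open>(i..j]\<close>. Scan the array and keep on a stack the
  run heads that are minimal among all entries from there on; a head pops the larger heads and is
  pushed. If \<open>d t\<close> is the stack height at \<open>t\<close>, plus one for positions that are no heads, then the
  rightmost position of minimal \<open>d\<close> in \<open>(i..j]\<close> is the minimal head there (if there is one), and a single
  comparison with \<open>A[i]\<close> answers the query. The numbers of pops take \<open>2 \<rho>\<close> bits in unary, the head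
  positions \<open>lg (n choose \<rho>)\<close> bits; both are encoded blockwise, with blocks so short that tables over
  all block types have \<open>o(n)\<close> bits. Range minima of \<open>d\<close> are found from these tables inside a block and
  from sparse tables over blocks and superblocks otherwise, and candidates are compared by their
  depths, which the index provides.
\<close>

section \<open>Constant-time computations on the word RAM\<close>

text \<open>Only one comparison with \<open>A\<close> is allowed, so candidates from different
  blocks must be ranked from the index alone. The obstacle is that a single head may pop arbitrarily
  many entries, which would make the number of block types unbounded. Codes are therefore clipped at
  a bound \<open>C\<close> above the block length. Inside a block this is harmless, since such a pop
  makes every depth from there on smaller than every depth before; but clipped codes no longer add
  up to depths. Superblocks without a clipped code keep exact depths, and the others are rare,
  because all codes together add up to at most \<open>2 * runs n A\<close>. The second obstacle is
  uniformity: one program serves all \<open>n\<close>, while \<open>w\<close> is only known to be at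
  least a multiple of lg n. Positions thus occupy a constant number \<open>K\<close> of words,
  arithmetic is done digit by digit, and parameters and table addresses are read from a header.
  Block codes may come from mere counting arguments, as they are decoded through tables.\<close>

definition dg :: "nat \<Rightarrow> nat \<Rightarrow> nat \<Rightarrow> nat"
  where "dg w k v = v div 2 ^ (k * w) mod 2 ^ w"

lemma dg_bits: "dg w k v = take_bit w (drop_bit (k * w) v)"
  by (simp add: dg_def take_bit_eq_mod drop_bit_eq_div)

lemma dg_less [simp]: "dg w k v < 2 ^ w"
  by (simp add: dg_def)

lemma mod_Suc_dg: "v mod 2 ^ (Suc k * w) = dg w k v * 2 ^ (k * w) + v mod 2 ^ (k * w)"
  using mod_mult2_eq[of v "2 ^ (k * w)" "2 ^ w"] by (simp add: dg_def power_add mult.commute add.commute)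

lemma dg_beyond:
  assumes "v < 2 ^ (K * w)" and "K \<le> k"
  shows "dg w k v = 0"
proof -
  have "(2::nat) ^ (K * w) \<le> 2 ^ (k * w)"
    using assms(2) by (intro power_increasing mult_le_mono1) auto
  with assms(1) have "v < 2 ^ (k * w)" by (rule less_le_trans)
  then show ?thesis unfolding dg_def by simp
qed

lemma sum_dg: "(\<Sum>k<K. dg w k v * (2 ^ w) ^ k) = v mod 2 ^ (K * w)"
proof (induction K)
  case (Suc K)
  have "(2 ^ w) ^ K = (2::nat) ^ (K * w)" by (metis mult.commute power_mult)
  then show ?case using Suc mod_Suc_dg[of v K w] by simp
qed simp

lemma number_at_dg:
  assumes "\<And>k. k < K \<Longrightarrow> s (r + k) = dg w k v" and "v < 2 ^ (K * w)"
  shows "number_at w s [r..<r + K] = v"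
  using assms sum_dg[of w v K] by (simp add: number_at_def horner_sum_eq_sum atLeast0LessThan)

text \<open>Lexicographic comparison from the most significant digit. As a recursion on
  \<open>k\<close> it unrolls into the program behind \<open>cb_low_less\<close>.\<close>

lemma dg_less_iff:
  "u mod 2 ^ (Suc k * w) < v mod 2 ^ (Suc k * w) \<longleftrightarrow>
    dg w k u < dg w k v \<or> dg w k u = dg w k v \<and> u mod 2 ^ (k * w) < v mod 2 ^ (k * w)"
proof -
  \<comment> \<open>A strict inequality between leading digits outweighs remainders below
    \<open>D\<close>, whatever they are.\<close>
  have *: "a * D + p < b * D + q" if "a < b" "p < D" for a b D p q :: nat
  proof -
    have "a * D + p < Suc a * D" using that by simp
    also have "\<dots> \<le> b * D" using that by (intro mult_le_mono1) simp
    finally show ?thesis by simp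
  qed
  let ?D = "2 ^ (k * w) :: nat"
  have "u mod ?D < ?D" "v mod ?D < ?D" by simp_all
  then show ?thesis
    unfolding mod_Suc_dg using *[of "dg w k u" "dg w k v" "u mod ?D" ?D "v mod ?D"] *[of "dg w k v" "dg w k u" "v mod ?D" ?D "u mod ?D"]
    by (cases "dg w k u" "dg w k v" rule: linorder_cases) auto
qed

text \<open>The schoolbook carry: what leaves digit \<open>k\<close> depends on the two digits and
  on what enters, so carries can be computed one digit at a time.\<close>

lemma carry_dg:
  "2 ^ (Suc k * w) \<le> u mod 2 ^ (Suc k * w) + v mod 2 ^ (Suc k * w) \<longleftrightarrow>
    2 ^ w \<le> dg w k u + dg w k v + of_bool (2 ^ (k * w) \<le> u mod 2 ^ (k * w) + v mod 2 ^ (k * w))"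
proof -
  let ?D = "2 ^ (k * w) :: nat"
  have *: "M * D \<le> (a * D + p) + (b * D + q) \<longleftrightarrow> M \<le> a + b + of_bool (D \<le> p + q)"
    if "p < D" "q < D" for M D a b p q :: nat
  proof -
    have "M * D \<le> (a * D + p) + (b * D + q) \<longleftrightarrow> M \<le> ((a + b) * D + (p + q)) div D"
      using that by (subst less_eq_div_iff_mult_less_eq) (auto simp: algebra_simps)
    also have "((a + b) * D + (p + q)) div D = a + b + (p + q) div D"
      using that by (subst div_mult_self3) auto
    also have "(p + q) div D = of_bool (D \<le> p + q)"
      using that by (cases "D \<le> p + q") (auto simp: div_nat_eqI)
    finally show ?thesis .
  qed
  show ?thesis
    unfolding mod_Suc_dg using *[of "u mod ?D" ?D "v mod ?D" "2 ^ w"] by (simp add: power_add)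
qed

lemma dg_add:
  "dg w k (u + v) = (dg w k u + dg w k v
     + of_bool (2 ^ (k * w) \<le> u mod 2 ^ (k * w) + v mod 2 ^ (k * w))) mod 2 ^ w"
proof -
  let ?D = "2 ^ (k * w) :: nat"
  have "(p + q) div ?D = of_bool (?D \<le> p + q)" if "p < ?D" "q < ?D" for p q
    using that by (cases "?D \<le> p + q") (auto simp: div_nat_eqI)
  from this[of "u mod ?D" "v mod ?D"]
  have *: "(u mod ?D + v mod ?D) div ?D = of_bool (?D \<le> u mod ?D + v mod ?D)" by simp
  show ?thesis
    unfolding dg_def div_add1_eq[of u v] * by (rule mod_add_cong) (simp_all add: mod_add_eq)
qed

text \<open>The right-hand side has the shape of two wrap-around \<open>SUB\<close> instructions,
  one for the digits and one for the borrow. It follows from addition: with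
  \<open>u = v + h\<close>, the digit of \<open>h\<close> is recovered from those of
  \<open>u\<close> and \<open>v\<close>.\<close>

lemma dg_diff:
  assumes "v \<le> u"
  shows "dg w k (u - v) =
    (((dg w k u + 2 ^ w - dg w k v) mod 2 ^ w) + 2 ^ w - of_bool (u mod 2 ^ (k * w) < v mod 2 ^ (k * w))) mod 2 ^ w"
proof -
  define h where "h = u - v"
  let ?D = "2 ^ (k * w) :: nat" let ?M = "2 ^ w :: nat"
  have u: "u = v + h" using assms by (simp add: h_def)
  have carry: "(D \<le> p + q) \<longleftrightarrow> (p + q) mod D < p" if "p < D" "q < D" for p q D :: nat
  proof (cases "D \<le> p + q")
    case True
    then have "(p + q) mod D = p + q - D" using that by (simp add: le_mod_geq)
    then show ?thesis using True that by simp
  qed simp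
  \<comment> \<open>The carry of \<open>v + h\<close> into digit \<open>k\<close> and the borrow of
    \<open>u - v\<close> at that digit are the same bit.\<close>
  from carry[of "v mod ?D" ?D "h mod ?D"]
  have c: "?D \<le> v mod ?D + h mod ?D \<longleftrightarrow> u mod ?D < v mod ?D"
    unfolding u by (simp add: mod_add_eq)
  have inverse: "((((y + h + c) mod M + M - y) mod M) + M - c) mod M = h"
    if "y < M" "h < M" "c \<le> 1" for y h c M :: nat
  proof -
    have "((y + h + c) mod M + M - y) mod M = ((y + h + c) mod M + (M - y)) mod M"
      using that by simp
    also have "\<dots> = ((y + h + c) + (M - y)) mod M" by (rule mod_add_left_eq)
    also have "(y + h + c) + (M - y) = (h + c) + M" using that by simp
    finally have "((y + h + c) mod M + M - y) mod M = (h + c) mod M" by simp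
    moreover have "((h + c) mod M + M - c) mod M = h"
      using that by (cases "h + c = M") (auto simp: le_Suc_eq)
    ultimately show ?thesis by simp
  qed
  have "dg w k u = (dg w k v + dg w k h + of_bool (u mod ?D < v mod ?D)) mod ?M"
    using dg_add[of w k v h] unfolding u[symmetric] c .
  then show ?thesis
    using inverse[of "dg w k v" ?M "dg w k h" "of_bool (u mod ?D < v mod ?D)"]
    by (simp add: h_def)
qed

section \<open>Shifts and bit fields digit by digit\<close>

lemma bit_dg: "bit (dg w k v) q \<longleftrightarrow> q < w \<and> bit v (k * w + q)"
  by (simp add: dg_bits bit_take_bit_iff bit_drop_bit_eq)

text \<open>After a shift by at most one word a digit is glued together from two adjacent old
  digits. For \<open>s = 0\<close> and \<open>s = w\<close> one of the two parts vanishes by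
  itself.\<close>

lemma dg_shr:
  assumes "s \<le> w"
  shows "dg w k (v div 2 ^ s) =
    Bit_Operations.or (drop_bit s (dg w k v)) (take_bit w (push_bit (w - s) (dg w (Suc k) v)))"
proof (rule bit_eqI)
  fix q
  have "k * w + (s + q) = Suc k * w + (q - (w - s))" if "w - s \<le> q" using assms that by simp
  then show "bit (dg w k (v div 2 ^ s)) q = bit (Bit_Operations.or (drop_bit s (dg w k v))
      (take_bit w (push_bit (w - s) (dg w (Suc k) v)))) q"
    using assms
    by (cases "w - s \<le> q")
      (auto simp: bit_dg bit_or_iff bit_drop_bit_eq bit_take_bit_iff bit_push_bit_iff
        drop_bit_eq_div[symmetric] add.left_commute simp del: mult_Suc)
qed

lemma dg_shl:
  assumes "s \<le> w"
  shows "dg w k (v * 2 ^ s) =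
    Bit_Operations.or (take_bit w (push_bit s (dg w k v)))
      (if k = 0 then 0 else drop_bit (w - s) (dg w (k - 1) v))"
proof (rule bit_eqI)
  fix q
  have "(k - 1) * w + (w - s + q) = k * w + q - s" if "k \<noteq> 0"
    using assms that by (cases k) auto
  moreover have "s \<le> k * w + q" if "k \<noteq> 0"
    using assms that by (cases k) auto
  moreover have "k * w + (q - s) = k * w + q - s" if "s \<le> q" using that by simp
  ultimately show "bit (dg w k (v * 2 ^ s)) q = bit (Bit_Operations.or (take_bit w (push_bit s (dg w k v)))
      (if k = 0 then 0 else drop_bit (w - s) (dg w (k - 1) v))) q"
    using assms
    by (cases "s \<le> q"; cases "k = 0")
      (auto simp: bit_dg bit_or_iff bit_drop_bit_eq bit_take_bit_iff bit_push_bit_iff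
        push_bit_eq_mult[symmetric])
qed

lemma bit_read_word: "bit (read_word l B a) q \<longleftrightarrow> q < l \<and> a + q < length B \<and> B ! (a + q)"
  by (auto simp: read_word_def bit_horner_sum_bit_iff)

text \<open>A field is loaded word by word and its last word masked; truncated subtraction turns the
  mask length into 0 for digits past the end of the field.\<close>

lemma dg_read_word:
  "dg w k (read_word l B a) = take_bit (min w (l - k * w)) (read_word w B (a + k * w))"
  by (rule bit_eqI) (auto simp: bit_dg bit_take_bit_iff bit_read_word less_diff_conv add.commute add.left_commute)


lemma masked_read_word:
  "binop_val w AND (read_word w B (a + k * w)) (binop_val w SUB (binop_val w SHL 1 (min w (l - k * w))) 1)
    = dg w k (read_word l B a)"
proof -
  define e where "e = min w (l - k * w)"
  have e: "e \<le> w" by (simp add: e_def)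
  have "binop_val w SUB (binop_val w SHL 1 e) 1 = mask e"
  \<comment> \<open>A full-word mask overflows: \<open>SHL\<close> yields 0, and subtracting 1 wraps
    around to all ones.\<close>
  proof (cases "e = w")
    case True
    then show ?thesis by (simp add: push_bit_eq_mult take_bit_eq_mod mask_eq_exp_minus_1)
  next
    case False
    then have lt: "(2::nat) ^ e < 2 ^ w" using e by simp
    then have "binop_val w SHL 1 e = 2 ^ e" by (simp add: push_bit_eq_mult take_bit_eq_mod)
    moreover have "((2::nat) ^ e + 2 ^ w - 1) mod 2 ^ w = 2 ^ e - 1"
    proof -
      have "(2::nat) ^ e + 2 ^ w - 1 = (2 ^ e - 1) + 2 ^ w" by simp
      moreover have "(2::nat) ^ e - 1 < 2 ^ w" using lt by linarith
      ultimately show ?thesis by (simp only: mod_add_self2 mod_less)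
    qed
    ultimately show ?thesis by (simp add: take_bit_eq_mod mask_eq_exp_minus_1)
  qed
  then have "binop_val w AND (read_word w B (a + k * w)) (binop_val w SUB (binop_val w SHL 1 e) 1)
      = take_bit w (take_bit e (read_word w B (a + k * w)))"
    by (simp only: binop_val.simps take_bit_eq_mask)
  also have "\<dots> = take_bit e (read_word w B (a + k * w))"
    using e by (simp add: min_def)
  finally show ?thesis by (simp only: dg_read_word e_def)
qed

text \<open>The lowest one of \<open>r\<close> is at position \<open>p\<close>, and a decrement
  flips exactly the bits up to there.\<close>

lemma xor_pred:
  fixes r :: nat
  assumes "r = 2 ^ (p + 1) * y + 2 ^ p"
  shows "Bit_Operations.xor r (r - 1) = mask (p + 1)"
proof -
  have disj: "push_bit P y + m = Bit_Operations.or (push_bit P y) m" if "m < 2 ^ P" for m P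
  proof (rule disjunctive_add_eq_or)
    have m: "take_bit P m = m" using that by (simp add: take_bit_nat_eq_self_iff)
    show "Bit_Operations.and (push_bit P y) m = 0"
    proof (rule bit_eqI)
      fix q show "bit (Bit_Operations.and (push_bit P y) m) q = bit (0::nat) q"
        by (subst m[symmetric]) (auto simp: bit_and_iff bit_push_bit_iff bit_take_bit_iff)
    qed
  qed
  have "r = push_bit (p + 1) y + 2 ^ p" using assms by (simp add: push_bit_eq_mult mult.commute)
  then have r: "r = Bit_Operations.or (push_bit (p + 1) y) (2 ^ p)"
    using disj[of "2 ^ p" "p + 1"] power_strict_increasing[of p "p + 1" "2::nat"] by simp
  have "r - 1 = push_bit (p + 1) y + mask p"
    using \<open>r = push_bit (p + 1) y + 2 ^ p\<close> by (simp only: mask_eq_exp_minus_1) simp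
  moreover have "mask p < (2::nat) ^ (p + 1)"
    by (rule less_trans[of _ "2 ^ p"]) (simp_all add: mask_eq_exp_minus_1)
  ultimately have r1: "r - 1 = Bit_Operations.or (push_bit (p + 1) y) (mask p)"
    using disj[of "mask p" "p + 1"] by simp
  show ?thesis unfolding r1 unfolding r
    by (rule bit_eqI)
      (auto simp: bit_xor_iff bit_or_iff bit_exp_iff bit_mask_iff bit_push_bit_iff simp del: push_bit_Suc)
qed

section \<open>Groups of registers\<close>

lemma number_at_cong: "(\<And>r. r \<in> set rs \<Longrightarrow> s r = s' r) \<Longrightarrow> number_at w s rs = number_at w s' rs"
  unfolding number_at_def by (induction rs) auto

lemma number_at_shift: "number_at w s [r..<r + K] = number_at w (\<lambda>q. s (r + q)) [0..<K]"
  by (simp add: number_at_def horner_sum_eq_sum)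

primrec copy :: "reg \<Rightarrow> nat \<Rightarrow> prog" where
  "copy r 0 = Skip"
| "copy r (Suc k) = Seq (copy r k) (Move k (r + k))"

text \<open>With \<open>k \<le> r\<close> the targets lie below all sources, so no source is
  overwritten before it is read.\<close>

lemma exec_copy:
  "k \<le> r \<Longrightarrow> exec w B n A (copy r k) s k 0 (\<lambda>q. if q < k then s (r + q) else s q)"
proof (induction k)
  case 0 show ?case using exec.Skip by simp
next
  case (Suc k)
  define s' where "s' = (\<lambda>q. if q < k then s (r + q) else s q)"
  have "exec w B n A (copy r k) s k 0 s'" unfolding s'_def using Suc by simp
  then have "exec w B n A (copy r (Suc k)) s (k + 1) (0 + 0) (s'(k := s' (r + k)))"
    unfolding copy.simps by (rule exec.Seq[OF _ exec.Move])
  moreover have "s'(k := s' (r + k)) = (\<lambda>q. if q < Suc k then s (r + q) else s q)"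
    using Suc.prems by (auto simp: fun_eq_iff s'_def)
  ultimately show ?case by simp
qed

text \<open>An element of \<open>V\<close> is a whole instance: array, index and query. Quantities
  are functions on \<open>V\<close>, which expresses that one program and one time bound serve all
  instances. \<open>R\<close> counts the input registers and \<open>K\<close> the words of a
  number.\<close>

locale ram =
  fixes V :: "'x set" and w n :: "'x \<Rightarrow> nat" and B :: "'x \<Rightarrow> bool list"
    and A :: "'x \<Rightarrow> nat \<Rightarrow> nat" and inp :: "'x \<Rightarrow> regs" and R K :: nat
  assumes w_pos: "x \<in> V \<Longrightarrow> 1 \<le> w x"
    and inp_word: "x \<in> V \<Longrightarrow> inp x r < 2 ^ w x"
    and K_pos: "1 \<le> K"
begin

text \<open>Values that some program computes in constant time from the inputs, without comparing array
  entries. Only existence of a program matters, so common subexpressions may be recomputed and no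
  register allocation is needed: each word is produced in any prescribed register above the inputs.\<close>

definition cw :: "('x \<Rightarrow> nat) \<Rightarrow> bool" where
  "cw f \<longleftrightarrow> (\<forall>x\<in>V. f x < 2 ^ w x) \<and>
    (\<forall>r\<ge>R. \<exists>P T. \<forall>x\<in>V. \<forall>s. (\<forall>q<R. s q = inp x q) \<longrightarrow>
      (\<exists>t s'. exec (w x) (B x) (n x) (A x) P s t 0 s' \<and> t \<le> T \<and> (\<forall>q<r. s' q = s q) \<and> s' r = f x))"

lemma cw_less: "cw f \<Longrightarrow> x \<in> V \<Longrightarrow> f x < 2 ^ w x"
  by (simp add: cw_def)

lemma cw_run:
  assumes "cw f" and "R \<le> r"
  shows "\<exists>P T. \<forall>x s. x \<in> V \<longrightarrow> (\<forall>q<R. s q = inp x q) \<longrightarrow>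
    (\<exists>t s'. exec (w x) (B x) (n x) (A x) P s t 0 s' \<and> t \<le> T \<and> (\<forall>q<r. s' q = s q) \<and> s' r = f x)"
  using assms unfolding cw_def by blast

lemma cw_cong:
  assumes "\<And>x. x \<in> V \<Longrightarrow> f x = g x" and "cw f"
  shows "cw g"
  using assms unfolding cw_def by simp

lemma cwI1:
  assumes "\<And>x. x \<in> V \<Longrightarrow> f x < 2 ^ w x"
    and "\<And>r. \<exists>P. \<forall>x\<in>V. \<forall>s. (\<forall>q<R. s q = inp x q) \<longrightarrow> exec (w x) (B x) (n x) (A x) P s 1 0 (s(r := f x))"
  shows "cw f"
  unfolding cw_def
proof (intro conjI ballI allI impI)
  fix r
  obtain P where "\<forall>x\<in>V. \<forall>s. (\<forall>q<R. s q = inp x q) \<longrightarrow> exec (w x) (B x) (n x) (A x) P s 1 0 (s(r := f x))"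
    using assms(2) by blast
  then show "\<exists>P T. \<forall>x\<in>V. \<forall>s. (\<forall>q<R. s q = inp x q) \<longrightarrow>
      (\<exists>t s'. exec (w x) (B x) (n x) (A x) P s t 0 s' \<and> t \<le> T \<and> (\<forall>q<r. s' q = s q) \<and> s' r = f x)"
    by (intro exI[of _ P] exI[of _ 1] ballI allI impI, intro exI[of _ 1] exI[of _ "_(r := _)"] conjI) auto
qed (use assms(1) in auto)

lemma cw_inp: "q < R \<Longrightarrow> cw (\<lambda>x. inp x q)"
proof (rule cwI1)
  fix r assume "q < R"
  then show "\<exists>P. \<forall>x\<in>V. \<forall>s. (\<forall>q<R. s q = inp x q) \<longrightarrow> exec (w x) (B x) (n x) (A x) P s 1 0 (s(r := inp x q))"
    by (intro exI[of _ "Move r q"]) (metis exec.Move)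
qed (rule inp_word)

lemma cw_const: "cw (\<lambda>x. take_bit (w x) c)"
proof (rule cwI1)
  fix r show "\<exists>P. \<forall>x\<in>V. \<forall>s. (\<forall>q<R. s q = inp x q) \<longrightarrow> exec (w x) (B x) (n x) (A x) P s 1 0 (s(r := take_bit (w x) c))"
    by (intro exI[of _ "Const r c"]) (metis exec.Const)
qed simp

lemma cw_0: "cw (\<lambda>x. 0)"
  using cw_const[of 0] by simp

lemma cw_1: "cw (\<lambda>x. 1)"
  by (rule cw_cong[OF _ cw_const[of 1]]) (use w_pos in \<open>force simp: take_bit_eq_mod\<close>)

text \<open>Programs can be chained because each leaves the registers below its target alone: the
  inputs and all values computed earlier survive.\<close>

lemma cw_list:
  assumes "\<And>f. f \<in> set fs \<Longrightarrow> cw f" and "R \<le> r"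
  shows "\<exists>P T. \<forall>x\<in>V. \<forall>s. (\<forall>q<R. s q = inp x q) \<longrightarrow>
      (\<exists>t s'. exec (w x) (B x) (n x) (A x) P s t 0 s' \<and> t \<le> T \<and> (\<forall>q<r. s' q = s q) \<and>
        (\<forall>k<length fs. s' (r + k) = (fs ! k) x))"
  using assms
proof (induction fs arbitrary: r)
  case Nil
  have "\<exists>t s'. exec (w x) (B x) (n x) (A x) Skip s t 0 s' \<and> t \<le> 0 \<and> (\<forall>q<r. s' q = s q)" for x s
    using exec.Skip by blast
  then show ?case by (metis less_zeroE list.size(3))
next
  case (Cons f fs)
  obtain P T where P: "\<forall>x s. x \<in> V \<longrightarrow> (\<forall>q<R. s q = inp x q) \<longrightarrow>
    (\<exists>t s'. exec (w x) (B x) (n x) (A x) P s t 0 s' \<and> t \<le> T \<and> (\<forall>q<r. s' q = s q) \<and> s' r = f x)"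
    using cw_run[OF Cons.prems(1)[OF list.set_intros(1)] \<open>R \<le> r\<close>] by blast
  obtain P' T' where P': "\<forall>x s. x \<in> V \<longrightarrow> (\<forall>q<R. s q = inp x q) \<longrightarrow>
    (\<exists>t s'. exec (w x) (B x) (n x) (A x) P' s t 0 s' \<and> t \<le> T' \<and> (\<forall>q<Suc r. s' q = s q) \<and>
        (\<forall>k<length fs. s' (Suc r + k) = (fs ! k) x))"
    using Cons.IH[OF Cons.prems(1)[OF list.set_intros(2)], of "Suc r"] \<open>R \<le> r\<close> le_SucI by blast
  show ?case
  proof (rule exI[of _ "Seq P P'"], rule exI[of _ "T + T'"], intro ballI allI impI)
    fix x s assume x: "x \<in> V" and s: "\<forall>q<R. s q = inp x q"
    obtain t s' where 1: "exec (w x) (B x) (n x) (A x) P s t 0 s'" "t \<le> T" "\<forall>q<r. s' q = s q" "s' r = f x"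
      using P x s by blast
    obtain t' s'' where 2: "exec (w x) (B x) (n x) (A x) P' s' t' 0 s''" "t' \<le> T'" "\<forall>q<Suc r. s'' q = s' q"
      "\<forall>k<length fs. s'' (Suc r + k) = (fs ! k) x"
      using P'[rule_format, OF x, of s'] s 1(3) \<open>R \<le> r\<close> by auto
    have "exec (w x) (B x) (n x) (A x) (Seq P P') s (t + t') 0 s''"
      using exec.Seq[OF 1(1) 2(1)] by simp
    moreover have "\<forall>k<length (f # fs). s'' (r + k) = ((f # fs) ! k) x"
      using 1(4) 2(3,4) by (auto simp: nth_Cons split: nat.splits)
    ultimately show "\<exists>t s'. exec (w x) (B x) (n x) (A x) (Seq P P') s t 0 s' \<and> t \<le> T + T' \<and>
        (\<forall>q<r. s' q = s q) \<and> (\<forall>k<length (f # fs). s' (r + k) = ((f # fs) ! k) x)"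
      using 1 2 by (intro exI[of _ "t + t'"] exI[of _ s'']) auto
  qed
qed

lemma cw_instr:
  assumes "\<And>f. f \<in> set fs \<Longrightarrow> cw f" and "\<And>x. x \<in> V \<Longrightarrow> h x < 2 ^ w x"
    and "\<And>r x s. x \<in> V \<Longrightarrow> (\<And>k. k < length fs \<Longrightarrow> s (r + k) = (fs ! k) x) \<Longrightarrow>
      exec (w x) (B x) (n x) (A x) (I r) s 1 0 (s(r := h x))"
  shows "cw h"
  unfolding cw_def
proof (intro conjI ballI allI impI)
  fix r assume r: "R \<le> r"
  obtain P T where P: "\<forall>x\<in>V. \<forall>s. (\<forall>q<R. s q = inp x q) \<longrightarrow>
      (\<exists>t s'. exec (w x) (B x) (n x) (A x) P s t 0 s' \<and> t \<le> T \<and> (\<forall>q<r. s' q = s q) \<and>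
        (\<forall>k<length fs. s' (r + k) = (fs ! k) x))"
    using cw_list[OF assms(1) r] by blast
  show "\<exists>P T. \<forall>x\<in>V. \<forall>s. (\<forall>q<R. s q = inp x q) \<longrightarrow>
      (\<exists>t s'. exec (w x) (B x) (n x) (A x) P s t 0 s' \<and> t \<le> T \<and> (\<forall>q<r. s' q = s q) \<and> s' r = h x)"
  proof (rule exI[of _ "Seq P (I r)"], rule exI[of _ "T + 1"], intro ballI allI impI)
    fix x s assume x: "x \<in> V" and s: "\<forall>q<R. s q = inp x q"
    obtain t s' where 1: "exec (w x) (B x) (n x) (A x) P s t 0 s'" "t \<le> T" "\<forall>q<r. s' q = s q"
        "\<forall>k<length fs. s' (r + k) = (fs ! k) x"
      using P x s by blast
    have "exec (w x) (B x) (n x) (A x) (Seq P (I r)) s (t + 1) 0 (s'(r := h x))"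
      using exec.Seq[OF 1(1) assms(3)[OF x]] 1(4) by fastforce
    then show "\<exists>t s'. exec (w x) (B x) (n x) (A x) (Seq P (I r)) s t 0 s' \<and> t \<le> T + 1 \<and>
        (\<forall>q<r. s' q = s q) \<and> s' r = h x"
      using 1 by (intro exI[of _ "t + 1"] exI[of _ "s'(r := h x)"]) auto
  qed
qed (use assms(2) in auto)

lemma cw_op:
  assumes "cw f" and "cw g"
  shows "cw (\<lambda>x. binop_val (w x) b (f x) (g x))"
proof (rule cw_instr[of "[f, g]" _ "\<lambda>r. Op b r r (r + 1)"])
  fix r x s assume "\<And>k. k < length [f, g] \<Longrightarrow> s (r + k) = ([f, g] ! k) x"
  from this[of 0] this[of 1] show "exec (w x) (B x) (n x) (A x) (Op b r r (r + 1)) s 1 0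
      (s(r := binop_val (w x) b (f x) (g x)))"
    using exec.Op[of "w x" "B x" "n x" "A x" b r r "r + 1" s] by simp
qed (use assms binop_val_less in auto)

lemma cw_if:
  assumes c: "cw c" and f: "cw f" and g: "cw g"
  shows "cw (\<lambda>x. if c x \<noteq> 0 then f x else g x)"
  unfolding cw_def
proof (intro conjI ballI allI impI)
  fix r assume r: "R \<le> r"
  obtain P T where P: "\<forall>x s. x \<in> V \<longrightarrow> (\<forall>q<R. s q = inp x q) \<longrightarrow>
    (\<exists>t s'. exec (w x) (B x) (n x) (A x) P s t 0 s' \<and> t \<le> T \<and> (\<forall>q<r. s' q = s q) \<and> s' r = c x)"
    using cw_run[OF c r] by blast
  obtain P1 T1 where P1: "\<forall>x s. x \<in> V \<longrightarrow> (\<forall>q<R. s q = inp x q) \<longrightarrow>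
    (\<exists>t s'. exec (w x) (B x) (n x) (A x) P1 s t 0 s' \<and> t \<le> T1 \<and> (\<forall>q<r. s' q = s q) \<and> s' r = f x)"
    using cw_run[OF f r] by blast
  obtain P2 T2 where P2: "\<forall>x s. x \<in> V \<longrightarrow> (\<forall>q<R. s q = inp x q) \<longrightarrow>
    (\<exists>t s'. exec (w x) (B x) (n x) (A x) P2 s t 0 s' \<and> t \<le> T2 \<and> (\<forall>q<r. s' q = s q) \<and> s' r = g x)"
    using cw_run[OF g r] by blast
  let ?P = "Seq P (Cond r P1 P2)"
  show "\<exists>P T. \<forall>x\<in>V. \<forall>s. (\<forall>q<R. s q = inp x q) \<longrightarrow>
      (\<exists>t s'. exec (w x) (B x) (n x) (A x) P s t 0 s' \<and> t \<le> T \<and> (\<forall>q<r. s' q = s q) \<and>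
        s' r = (if c x \<noteq> 0 then f x else g x))"
  proof (rule exI[of _ ?P], rule exI[of _ "T + (T1 + T2 + 1)"], intro ballI allI impI)
    fix x s assume x: "x \<in> V" and s: "\<forall>q<R. s q = inp x q"
    obtain t s' where 1: "exec (w x) (B x) (n x) (A x) P s t 0 s'" "t \<le> T" "\<forall>q<r. s' q = s q" "s' r = c x"
      using P x s by blast
    have s': "\<forall>q<R. s' q = inp x q" using s 1 r by auto
    obtain t' s'' where 2: "exec (w x) (B x) (n x) (A x) (Cond r P1 P2) s' (t' + 1) 0 s''" "t' \<le> T1 + T2"
      "\<forall>q<r. s'' q = s' q" "s'' r = (if c x \<noteq> 0 then f x else g x)"
    proof (cases "c x \<noteq> 0")
      case True
      obtain t' s'' where "exec (w x) (B x) (n x) (A x) P1 s' t' 0 s'' \<and> t' \<le> T1 \<and> (\<forall>q<r. s'' q = s' q) \<and> s'' r = f x"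
        using P1 x s' by blast
      then show ?thesis
        using that[of t' s''] True exec.CondTrue[of s' r "w x" "B x" "n x" "A x" P1 t' 0 s'' P2] 1(4) by auto
    next
      case False
      obtain t' s'' where "exec (w x) (B x) (n x) (A x) P2 s' t' 0 s'' \<and> t' \<le> T2 \<and> (\<forall>q<r. s'' q = s' q) \<and> s'' r = g x"
        using P2 x s' by blast
      then show ?thesis
        using that[of t' s''] False exec.CondFalse[of s' r "w x" "B x" "n x" "A x" P2 t' 0 s'' P1] 1(4) by auto
    qed
    show "\<exists>t s'. exec (w x) (B x) (n x) (A x) ?P s t 0 s' \<and> t \<le> T + (T1 + T2 + 1) \<and> (\<forall>q<r. s' q = s q) \<and>
        s' r = (if c x \<noteq> 0 then f x else g x)"
      using exec.Seq[OF 1(1) 2(1)] 1 2 by (intro exI[of _ "t + (t' + 1)"] exI[of _ s'']) auto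
  qed
qed (use cw_less[OF f] cw_less[OF g] in auto)

section \<open>Computable conditions and multi-word numbers\<close>

abbreviation cb :: "('x \<Rightarrow> bool) \<Rightarrow> bool" where "cb p \<equiv> cw (\<lambda>x. of_bool (p x))"

lemma cw_cond:
  assumes "cb p" "cw f" "cw g"
  shows "cw (\<lambda>x. if p x then f x else g x)"
  by (rule cw_cong[OF _ cw_if[OF assms]]) auto

lemma cb_conj: "cb p \<Longrightarrow> cb q \<Longrightarrow> cb (\<lambda>x. p x \<and> q x)"
  by (rule cw_cong[OF _ cw_cond[OF _ _ cw_0, of p "\<lambda>x. of_bool (q x)"]]) auto

lemma cb_disj: "cb p \<Longrightarrow> cb q \<Longrightarrow> cb (\<lambda>x. p x \<or> q x)"
  by (rule cw_cong[OF _ cw_cond[OF _ cw_1, of p "\<lambda>x. of_bool (q x)"]]) auto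

lemma cb_not: "cb p \<Longrightarrow> cb (\<lambda>x. \<not> p x)"
  by (rule cw_cong[OF _ cw_cond[OF _ cw_0 cw_1, of p]]) auto

lemma take_bit_of_bool: "x \<in> V \<Longrightarrow> take_bit (w x) (of_bool b :: nat) = of_bool b"
  using w_pos[of x] by (cases "w x") auto

lemma cb_less: "cw f \<Longrightarrow> cw g \<Longrightarrow> cb (\<lambda>x. f x < g x)"
  by (rule cw_cong[OF _ cw_op[of f g binop.LT]]) (auto simp: take_bit_of_bool simp del: take_bit_of_1 of_bool_eq)

lemma cb_eq: "cw f \<Longrightarrow> cw g \<Longrightarrow> cb (\<lambda>x. f x = g x)"
  by (rule cw_cong[OF _ cw_op[of f g binop.EQ]]) (auto simp: take_bit_of_bool simp del: take_bit_of_1 of_bool_eq)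

text \<open>A number of \<open>K\<close> words is represented by programs for its digits. Since
  \<open>k\<close> is a number outside of the program, loops over digits unroll into loop-free code.
  Digits with \<open>k \<ge> K\<close> are included so that a shift may refer to the next digit
  without a case distinction.\<close>

definition big :: "('x \<Rightarrow> nat) \<Rightarrow> bool" where
  "big f \<longleftrightarrow> (\<forall>x\<in>V. f x < 2 ^ (K * w x)) \<and> (\<forall>k. cw (\<lambda>x. dg (w x) k (f x)))"

lemma bigI:
  assumes "\<And>x. x \<in> V \<Longrightarrow> f x < 2 ^ (K * w x)" and "\<And>k. k < K \<Longrightarrow> cw (\<lambda>x. dg (w x) k (f x))"
  shows "big f"
  unfolding big_def
proof (intro conjI ballI allI)
  fix k
  show "cw (\<lambda>x. dg (w x) k (f x))"
  proof (cases "k < K")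
    case False
    have "0 = dg (w x) k (f x)" if "x \<in> V" for x
      using dg_beyond[OF assms(1)[OF that]] False by simp
    then show ?thesis by (rule cw_cong[OF _ cw_0])
  qed (rule assms(2))
qed (rule assms(1))

lemma big_less_bound: "big f \<Longrightarrow> x \<in> V \<Longrightarrow> f x < 2 ^ (K * w x)"
  by (simp add: big_def)

lemma big_dg: "big f \<Longrightarrow> cw (\<lambda>x. dg (w x) k (f x))"
  by (simp add: big_def)

lemma big_cong:
  assumes "\<And>x. x \<in> V \<Longrightarrow> f x = g x" and "big f"
  shows "big g"
  using assms cw_cong[of "\<lambda>x. dg (w x) _ (f x)" "\<lambda>x. dg (w x) _ (g x)"] unfolding big_def by simp

lemma word_less_big: "(x::nat) < 2 ^ w y \<Longrightarrow> x < 2 ^ (K * w y)"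
  using power_increasing[of "w y" "K * w y" "2::nat"] K_pos by (simp add: less_le_trans)

lemma big_word: 
  assumes "cw f" shows "big f"
proof (rule bigI)
  fix k
  show "cw (\<lambda>x. dg (w x) k (f x))"
  proof (cases k)
    case 0
    have "f x = dg (w x) k (f x)" if "x \<in> V" for x
      using cw_less[OF assms that] by (simp add: dg_def 0)
    then show ?thesis by (rule cw_cong[OF _ assms])
  next
    case (Suc k')
    have "0 = dg (w x) k (f x)" if "x \<in> V" for x
      using dg_beyond[of "f x" 1 "w x" k] cw_less[OF assms that] Suc by simp
    then show ?thesis by (rule cw_cong[OF _ cw_0])
  qed
qed (use cw_less[OF assms] word_less_big in auto)

lemma cw_big:
  assumes "big f" and "\<And>x. x \<in> V \<Longrightarrow> f x < 2 ^ w x" shows "cw f"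
  by (rule cw_cong[OF _ big_dg[OF assms(1), of 0]]) (simp add: assms(2) dg_def)

lemma big_cond:
  assumes "cb p" "big f" "big g"
  shows "big (\<lambda>x. if p x then f x else g x)"
proof (rule bigI)
  fix k
  show "cw (\<lambda>x. dg (w x) k (if p x then f x else g x))"
    by (rule cw_cong[OF _ cw_cond[OF assms(1) big_dg[OF assms(2), of k] big_dg[OF assms(3), of k]]]) auto
qed (use assms big_less_bound in auto)

lemma cb_low_less:
  assumes "big f" "big g"
  shows "cb (\<lambda>x. f x mod 2 ^ (k * w x) < g x mod 2 ^ (k * w x))"
proof (induction k)
  case 0 show ?case using cw_0 by simp
next
  case (Suc k)
  show ?case
    by (rule cw_cong[OF _ cb_disj[OF cb_less[OF big_dg[OF assms(1), of k] big_dg[OF assms(2), of k]]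
        cb_conj[OF cb_eq[OF big_dg[OF assms(1), of k] big_dg[OF assms(2), of k]] Suc]]])
      (simp only: dg_less_iff)
qed

lemma cb_big_less:
  assumes "big f" "big g"
  shows "cb (\<lambda>x. f x < g x)"
  by (rule cw_cong[OF _ cb_low_less[OF assms, of K]]) (simp add: big_less_bound[OF assms(1)] big_less_bound[OF assms(2)])

lemma cb_big_le: "big f \<Longrightarrow> big g \<Longrightarrow> cb (\<lambda>x. f x \<le> g x)"
  using cb_not[OF cb_big_less[of g f]] by (simp add: not_less)

lemma cb_big_eq: "big f \<Longrightarrow> big g \<Longrightarrow> cb (\<lambda>x. f x = g x)"
  by (rule cw_cong[OF _ cb_conj[OF cb_big_le[of f g] cb_big_le[of g f]]]) auto

lemma cw_add: "cw f \<Longrightarrow> cw g \<Longrightarrow> cw (\<lambda>x. (f x + g x) mod 2 ^ w x)"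
  using cw_op[of f g ADD] by (simp add: take_bit_eq_mod)

lemma cw_sub: "cw f \<Longrightarrow> cw g \<Longrightarrow> cw (\<lambda>x. (f x + 2 ^ w x - g x) mod 2 ^ w x)"
  using cw_op[of f g SUB] by (simp add: take_bit_eq_mod)

lemma cb_carry:
  assumes f: "big f" and g: "big g"
  shows "cb (\<lambda>x. 2 ^ (k * w x) \<le> f x mod 2 ^ (k * w x) + g x mod 2 ^ (k * w x))"
proof (induction k)
  case 0 show ?case using cw_0 by simp
next
  case (Suc k)
  let ?c = "\<lambda>x. 2 ^ (k * w x) \<le> f x mod 2 ^ (k * w x) + g x mod 2 ^ (k * w x)"
  let ?f = "\<lambda>x. dg (w x) k (f x)" and ?g = "\<lambda>x. dg (w x) k (g x)"
  let ?s = "\<lambda>x. (?f x + ?g x) mod 2 ^ w x"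
  have s: "cw ?s" by (intro cw_add big_dg f g)
  \<comment> \<open>How a carry shows after the wrap-around: either the digit sum has become smaller
    than a summand, or it is \<open>M - 1\<close> and a carry comes in.\<close>
  have *: "M \<le> a + b + of_bool c \<longleftrightarrow> (a + b) mod M < a \<or> c \<and> ((a + b) mod M + 1) mod M = 0"
    if "a < M" "b < M" for a b M :: nat and c
  proof (cases "M \<le> a + b")
    case True
    then have "(a + b) mod M = a + b - M" using that by (simp add: le_mod_geq)
    then show ?thesis using True that by auto
  next
    case False
    then have "(a + b + 1) mod M = 0 \<longleftrightarrow> M \<le> a + b + 1"
      by (cases "a + b + 1 = M") auto
    then show ?thesis using False by auto
  qed
  have "cb (\<lambda>x. ?s x < ?f x \<or> ?c x \<and> (?s x + 1) mod 2 ^ w x = 0)"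
    by (intro cb_disj cb_conj cb_less cb_eq s big_dg f cw_0 Suc cw_add cw_1)
  then show ?case
    by (rule cw_cong[rotated]) (simp only: carry_dg *[OF dg_less dg_less])
qed

lemma big_add:
  assumes f: "big f" and g: "big g" and le: "\<And>x. x \<in> V \<Longrightarrow> f x + g x < 2 ^ (K * w x)"
  shows "big (\<lambda>x. f x + g x)"
proof (rule bigI)
  fix k
  show "cw (\<lambda>x. dg (w x) k (f x + g x))"
    by (rule cw_cong[OF _ cw_add[OF cw_add[OF big_dg[OF f, of k] big_dg[OF g, of k]] cb_carry[OF f g, of k]]])
      (simp only: dg_add mod_add_left_eq)
qed (rule le)

lemma big_sub:
  assumes f: "big f" and g: "big g" and le: "\<And>x. x \<in> V \<Longrightarrow> g x \<le> f x"
  shows "big (\<lambda>x. f x - g x)"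
proof (rule bigI)
  fix k
  show "cw (\<lambda>x. dg (w x) k (f x - g x))"
    by (rule cw_cong[OF _ cw_sub[OF cw_sub[OF big_dg[OF f, of k] big_dg[OF g, of k]] cb_low_less[OF f g, of k]]])
      (simp only: dg_diff[OF le])
qed (use big_less_bound[OF f] less_imp_diff_less in blast)

text \<open>Raising \<open>f\<close> to the maximum of \<open>f\<close> and \<open>g\<close> makes
  exact subtraction applicable and gives 0 where natural subtraction truncates.\<close>

lemma big_tsub:
  assumes f: "big f" and g: "big g"
  shows "big (\<lambda>x. f x - g x)"
proof -
  have "big (\<lambda>x. if f x < g x then g x else f x)"
    by (intro big_cond cb_big_less f g)
  then have "big (\<lambda>x. (if f x < g x then g x else f x) - g x)"
    by (rule big_sub) (use g in auto)
  then show ?thesis by (rule big_cong[rotated]) auto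
qed

lemma big_0: "big (\<lambda>x. 0)" and big_1: "big (\<lambda>x. 1)"
  by (intro big_word cw_0, intro big_word cw_1)

text \<open>Repeated addition suffices: \<open>c\<close> is the same for all instances, so the
  number of additions is constant.\<close>

lemma big_mult_const: "big f \<Longrightarrow> (\<And>x. x \<in> V \<Longrightarrow> c * f x < 2 ^ (K * w x)) \<Longrightarrow> big (\<lambda>x. c * f x)"
proof (induction c)
  case 0 show ?case using big_0 by simp
next
  case (Suc c)
  have "c * f x < 2 ^ (K * w x)" if "x \<in> V" for x
    using Suc.prems(2)[OF that] by simp
  then have "big (\<lambda>x. f x + c * f x)"
    using Suc.prems by (intro big_add Suc.IH) simp_all
  then show ?case by simp
qed

lemma cw_word_size_minus:
  assumes "cw w" and "cw s" and "\<And>x. x \<in> V \<Longrightarrow> s x \<le> w x"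
  shows "cw (\<lambda>x. w x - s x)"
proof (rule cw_cong[OF _ cw_sub[OF assms(1,2)]])
  fix x assume "x \<in> V"
  then have "w x + 2 ^ w x - s x = (w x - s x) + 2 ^ w x" using assms(3) by simp
  moreover have "w x - s x < 2 ^ w x" using less_exp[of "w x"] by linarith
  ultimately show "(w x + 2 ^ w x - s x) mod 2 ^ w x = w x - s x"
    by (simp only: mod_add_self2 mod_less)
qed

lemma big_shr_word:
  assumes f: "big f" and s: "cw s" and sw: "\<And>x. x \<in> V \<Longrightarrow> s x \<le> w x" and w: "cw w"
  shows "big (\<lambda>x. f x div 2 ^ s x)"
proof (rule bigI)
  fix k
  note ws = cw_word_size_minus[OF w s sw]
  have "cw (\<lambda>x. binop_val (w x) OR (binop_val (w x) SHR (dg (w x) k (f x)) (s x))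
      (binop_val (w x) SHL (dg (w x) (Suc k) (f x)) (w x - s x)))"
    by (intro cw_op big_dg f s ws)
  then show "cw (\<lambda>x. dg (w x) k (f x div 2 ^ s x))"
  proof (rule cw_cong[rotated])
    fix x assume "x \<in> V"
    have "take_bit (w x) (drop_bit (s x) (dg (w x) k (f x))) = drop_bit (s x) (dg (w x) k (f x))"
      by (rule bit_eqI) (auto simp: bit_simps bit_dg)
    moreover have "take_bit (w x) (Bit_Operations.or (drop_bit (s x) (dg (w x) k (f x)))
        (take_bit (w x) (push_bit (w x - s x) (dg (w x) (Suc k) (f x))))) =
       Bit_Operations.or (drop_bit (s x) (dg (w x) k (f x)))
        (take_bit (w x) (push_bit (w x - s x) (dg (w x) (Suc k) (f x))))"
      by (rule bit_eqI) (auto simp: bit_simps bit_dg)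
    ultimately show "binop_val (w x) OR (binop_val (w x) SHR (dg (w x) k (f x)) (s x))
      (binop_val (w x) SHL (dg (w x) (Suc k) (f x)) (w x - s x)) = dg (w x) k (f x div 2 ^ s x)"
      using dg_shr[OF sw[OF \<open>x \<in> V\<close>], of k "f x"] by simp
  qed
qed (use big_less_bound[OF f] div_le_dividend le_less_trans in blast)

lemma big_shl_word:
  assumes f: "big f" and s: "cw s" and sw: "\<And>x. x \<in> V \<Longrightarrow> s x \<le> w x" and w: "cw w"
    and le: "\<And>x. x \<in> V \<Longrightarrow> f x * 2 ^ s x < 2 ^ (K * w x)"
  shows "big (\<lambda>x. f x * 2 ^ s x)"
proof (rule bigI)
  fix k
  note ws = cw_word_size_minus[OF w s sw]
  have "cw (\<lambda>x. if k = 0 then 0 else dg (w x) (k - 1) (f x))"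
    using cw_0 big_dg[OF f] by (cases "k = 0") auto
  then have "cw (\<lambda>x. binop_val (w x) OR (binop_val (w x) SHL (dg (w x) k (f x)) (s x))
      (binop_val (w x) SHR (if k = 0 then 0 else dg (w x) (k - 1) (f x)) (w x - s x)))"
    by (intro cw_op big_dg f s ws)
  then show "cw (\<lambda>x. dg (w x) k (f x * 2 ^ s x))"
  proof (rule cw_cong[rotated])
    fix x assume "x \<in> V"
    show "binop_val (w x) OR (binop_val (w x) SHL (dg (w x) k (f x)) (s x))
      (binop_val (w x) SHR (if k = 0 then 0 else dg (w x) (k - 1) (f x)) (w x - s x)) = dg (w x) k (f x * 2 ^ s x)"
      unfolding dg_shl[OF sw[OF \<open>x \<in> V\<close>], of k "f x"]
      by (rule bit_eqI) (auto simp: bit_simps bit_dg)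
  qed
qed (rule le)

text \<open>Shift amounts range up to \<open>K * w x\<close>, while \<open>big_shr_word\<close>
  handles at most one word. \<open>K\<close> rounds, each shifting by the minimum of the word size
  and the rest, are enough; the induction is over the number \<open>m\<close> of rounds.\<close>

lemma big_shr:
  assumes w: "cw w" and f: "big f" and g: "big g" and le: "\<And>x. x \<in> V \<Longrightarrow> g x \<le> K * w x"
  shows "big (\<lambda>x. f x div 2 ^ g x)"
proof -
  have "big f \<Longrightarrow> big g \<Longrightarrow> (\<And>x. x \<in> V \<Longrightarrow> g x \<le> m * w x) \<Longrightarrow> big (\<lambda>x. f x div 2 ^ g x)" for m f g
  proof (induction m arbitrary: f g)
    case 0
    show ?case by (rule big_cong[OF _ "0.prems"(1)]) (use "0.prems"(3) in auto)
  next
    case (Suc m)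
    let ?s = "\<lambda>x. if g x \<le> w x then g x else w x"
    have s: "cw ?s"
    proof (rule cw_big)
      show "big ?s" by (intro big_cond cb_big_le Suc.prems big_word w)
      show "?s x < 2 ^ w x" for x using less_exp[of "w x"] by (auto intro: le_less_trans)
    qed
    have "big (\<lambda>x. (f x div 2 ^ ?s x) div 2 ^ (g x - w x))"
      by (rule Suc.IH, rule big_shr_word[OF _ s _ w])
        (use Suc.prems big_tsub[OF _ big_word[OF w], of g] in \<open>auto simp: le_diff_conv add.commute\<close>)
    then show ?case
    proof (rule big_cong[rotated])
      fix x assume "x \<in> V"
      show "(f x div 2 ^ ?s x) div 2 ^ (g x - w x) = f x div 2 ^ g x"
        by (simp add: div_mult2_eq[symmetric] power_add[symmetric])
    qed
  qed
  from this[OF f g le] show ?thesis .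
qed

lemma big_shl:
  assumes w: "cw w" and f: "big f" and g: "big g" and le: "\<And>x. x \<in> V \<Longrightarrow> g x \<le> K * w x"
    and b: "\<And>x. x \<in> V \<Longrightarrow> f x * 2 ^ g x < 2 ^ (K * w x)"
  shows "big (\<lambda>x. f x * 2 ^ g x)"
proof -
  have "big f \<Longrightarrow> big g \<Longrightarrow> (\<And>x. x \<in> V \<Longrightarrow> g x \<le> m * w x) \<Longrightarrow> (\<And>x. x \<in> V \<Longrightarrow> f x * 2 ^ g x < 2 ^ (K * w x))
      \<Longrightarrow> big (\<lambda>x. f x * 2 ^ g x)" for m f g
  proof (induction m arbitrary: f g)
    case 0
    show ?case by (rule big_cong[OF _ "0.prems"(1)]) (use "0.prems"(3) in auto)
  next
    case (Suc m)
    let ?s = "\<lambda>x. if g x \<le> w x then g x else w x"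
    have s: "cw ?s"
    proof (rule cw_big)
      show "big ?s" by (intro big_cond cb_big_le Suc.prems big_word w)
      show "?s x < 2 ^ w x" for x using less_exp[of "w x"] by (auto intro: le_less_trans)
    qed
    have eq: "(f x * 2 ^ ?s x) * 2 ^ (g x - w x) = f x * 2 ^ g x" for x
      by (simp add: mult.assoc power_add[symmetric])
    \<comment> \<open>Intermediate results cannot overflow, being at most the final one.\<close>
    have sle: "f x * 2 ^ ?s x < 2 ^ (K * w x)" if "x \<in> V" for x
    proof -
      have "f x * 2 ^ ?s x \<le> f x * 2 ^ g x" by (intro mult_le_mono2 power_increasing) auto
      then show ?thesis using Suc.prems(4)[OF that] by linarith
    qed
    have "big (\<lambda>x. (f x * 2 ^ ?s x) * 2 ^ (g x - w x))"
    proof (rule Suc.IH)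
      show "big (\<lambda>x. f x * 2 ^ ?s x)"
        by (rule big_shl_word[OF Suc.prems(1) s _ w sle]) auto
      show "big (\<lambda>x. g x - w x)" by (intro big_tsub big_word w Suc.prems)
      show "g x - w x \<le> m * w x" if "x \<in> V" for x using Suc.prems(3)[OF that] by simp
      show "(f x * 2 ^ ?s x) * 2 ^ (g x - w x) < 2 ^ (K * w x)" if "x \<in> V" for x
        unfolding eq by (rule Suc.prems(4)[OF that])
    qed
    then show ?case by (rule big_cong[rotated]) (rule eq)
  qed
  from this[OF f g le b] show ?thesis .
qed

lemma cw_load:
  assumes "big f"
  shows "cw (\<lambda>x. read_word (w x) (B x) (f x))"
proof (rule cw_instr[of "map (\<lambda>k x. dg (w x) k (f x)) [0..<K]" _ "\<lambda>r. Load r [r..<r + K]"])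
  fix r x s assume x: "x \<in> V" and s: "\<And>k. k < length (map (\<lambda>k x. dg (w x) k (f x)) [0..<K]) \<Longrightarrow>
    s (r + k) = (map (\<lambda>k x. dg (w x) k (f x)) [0..<K] ! k) x"
  have "number_at (w x) s [r..<r + K] = f x"
    by (rule number_at_dg) (use s big_less_bound[OF assms x] in auto)
  then show "exec (w x) (B x) (n x) (A x) (Load r [r..<r + K]) s 1 0 (s(r := read_word (w x) (B x) (f x)))"
    by (metis exec.Load)
qed (use big_dg[OF assms] read_word_less in auto)

text \<open>The slack \<open>K * w x\<close> in the last assumption keeps the addresses of all
  \<open>K\<close> loads representable, also of those past the end of the field.\<close>

lemma big_field:
  assumes w: "cw w" and f: "big f" and l: "big l" and le: "\<And>x. x \<in> V \<Longrightarrow> l x \<le> K * w x"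
    and b: "\<And>x. x \<in> V \<Longrightarrow> f x + K * w x < 2 ^ (K * w x)"
  shows "big (\<lambda>x. read_word (l x) (B x) (f x))"
proof (rule bigI)
  fix x assume "x \<in> V"
  have "read_word (l x) (B x) (f x) < 2 ^ l x" by (rule read_word_less)
  also have "\<dots> \<le> 2 ^ (K * w x)" using le[OF \<open>x \<in> V\<close>] by simp
  finally show "read_word (l x) (B x) (f x) < 2 ^ (K * w x)" .
next
  fix k assume k: "k < K"
  have kw: "f x + k * w x < 2 ^ (K * w x)" if "x \<in> V" for x
    using b[OF that] mult_le_mono1[of k K "w x"] k by linarith
  have bw: "big (\<lambda>x. k * w x)"
    by (rule big_mult_const[OF big_word[OF w]]) (use kw add_lessD1 add.commute in metis)
  have a: "big (\<lambda>x. f x + k * w x)" by (rule big_add[OF f bw kw])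
  have "big (\<lambda>x. if w x < l x - k * w x then w x else l x - k * w x)"
    by (intro big_cond cb_big_less big_tsub l bw big_word w)
  then have "big (\<lambda>x. min (w x) (l x - k * w x))" by (rule big_cong[rotated]) auto
  then have "cw (\<lambda>x. min (w x) (l x - k * w x))"
    by (rule cw_big) (rule le_less_trans[OF min.cobounded1 less_exp])
  then have "cw (\<lambda>x. binop_val (w x) AND (read_word (w x) (B x) (f x + k * w x))
      (binop_val (w x) SUB (binop_val (w x) SHL 1 (min (w x) (l x - k * w x))) 1))"
    by (intro cw_op cw_load a cw_1)
  then show "cw (\<lambda>x. dg (w x) k (read_word (l x) (B x) (f x)))"
    by (rule cw_cong[rotated]) (rule masked_read_word)
qed

text \<open>The width of the header fields cannot be computed from \<open>n\<close>, so the index has to reveal it.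
  It starts with \<open>p\<close> zeros followed by a one; the first word \<open>r\<close> then satisfies
  \<open>(r XOR (r - 1)) + 1 = 2 ^ (p + 1)\<close>, whatever follows. For \<open>p = 0\<close> the width is \<open>K * w\<close>.\<close>

lemma big_field_width:
  assumes w: "cw w"
    and p: "\<And>x. x \<in> V \<Longrightarrow> p x < w x \<and> p x < length (B x) \<and> B x ! p x \<and> (\<forall>q<p x. \<not> B x ! q)"
    and F: "\<And>x. x \<in> V \<Longrightarrow> 1 \<le> p x \<and> p x + 1 < w x \<and> F x = 2 ^ (p x + 1) \<or> p x = 0 \<and> F x = K * w x"
  shows "big F"
proof -
  let ?r = "\<lambda>x. read_word (w x) (B x) 0"
  let ?u = "\<lambda>x. binop_val (w x) ADD (binop_val (w x) XOR (?r x) (binop_val (w x) SUB (?r x) 1)) 1"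
  have u: "cw ?u" by (intro cw_op cw_load big_0 cw_1)
  have ux: "?u x = 2 ^ (p x + 1) mod 2 ^ w x" if x: "x \<in> V" for x
  proof -
    have "take_bit (p x + 1) (?r x) = 2 ^ p x"
    proof (rule bit_eqI)
      fix q show "bit (take_bit (p x + 1) (?r x)) q \<longleftrightarrow> bit (2 ^ p x :: nat) q"
        using p[OF x] by (cases "p x" q rule: linorder_cases) (auto simp: bit_take_bit_iff bit_read_word bit_exp_iff)
    qed
    then have r: "?r x = 2 ^ (p x + 1) * (?r x div 2 ^ (p x + 1)) + 2 ^ p x"
      using mult_div_mod_eq[of "2 ^ (p x + 1)" "?r x"] by (simp only: take_bit_eq_mod)
    then have pos: "1 \<le> ?r x" by (metis Suc_leI add_gr_0 one_eq_numeral_iff One_nat_def zero_less_numeral zero_less_power)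
    have lt: "?r x < 2 ^ w x" by (rule read_word_less)
    have "?r x + 2 ^ w x - 1 = (?r x - 1) + 2 ^ w x" using pos by simp
    then have "(?r x + 2 ^ w x - 1) mod 2 ^ w x = ?r x - 1"
      using lt by (simp only: mod_add_self2) simp
    then have "binop_val (w x) SUB (?r x) 1 = ?r x - 1" by (simp add: take_bit_eq_mod)
    moreover have "Bit_Operations.xor (?r x) (?r x - 1) = mask (p x + 1)"
      by (rule xor_pred[OF r])
    ultimately have "?u x = take_bit (w x) (take_bit (w x) (mask (p x + 1)) + 1)" by simp
    also have "take_bit (w x) (mask (p x + 1) :: nat) = mask (p x + 1)"
      using p[OF x] by (simp add: take_bit_of_mask min_absorb2 Suc_leI)
    also have "mask (p x + 1) + 1 = (2 ^ (p x + 1) :: nat)" by (simp add: mask_eq_exp_minus_1)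
    finally show ?thesis by (simp add: take_bit_eq_mod)
  qed
  have Kw: "big (\<lambda>x. K * w x)"
    by (rule big_mult_const[OF big_word[OF w]]) (rule less_exp)
  \<comment> \<open>The computed power is at least 4 for \<open>1 \<le> p x\<close>, while for
    \<open>p x = 0\<close> it is \<open>2 mod 2 ^ w x\<close>, that is, 2 or (for one-bit words) 0.
    The truncated difference in the test separates these cases.\<close>
  have "big (\<lambda>x. if 1 < ?u x - 1 then ?u x else K * w x)"
    by (intro big_cond[OF _ big_word[OF u] Kw] cb_big_less big_tsub big_1 big_word[OF u])
  then show ?thesis
  proof (rule big_cong[rotated])
    fix x assume x: "x \<in> V"
    from F[OF x] show "(if 1 < ?u x - 1 then ?u x else K * w x) = F x"
    proof
      assume *: "1 \<le> p x \<and> p x + 1 < w x \<and> F x = 2 ^ (p x + 1)"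
      then have "(2::nat) ^ (p x + 1) < 2 ^ w x" by (intro power_strict_increasing) auto
      then have eq: "?u x = 2 ^ (p x + 1)" unfolding ux[OF x] by (rule mod_less)
      have "4 \<le> (2::nat) ^ (p x + 1)" using power_increasing[of 2 "p x + 1" "2::nat"] * by simp
      then have "1 < ?u x - 1" unfolding eq by linarith
      then show ?thesis using eq * by (simp only: if_True)
    next
      assume *: "p x = 0 \<and> F x = K * w x"
      then have "?u x = 2 mod 2 ^ w x" unfolding ux[OF x] by simp
      then have "\<not> 1 < ?u x - 1" using mod_less_eq_dividend[of 2 "2 ^ w x"] by linarith
      then show ?thesis using * by (simp only: if_False)
    qed
  qed
qed

text \<open>The candidate is computed without touching \<open>A\<close>, so the comparison spent
  here is the only one. Word size and \<open>n\<close> come first among the inputs, which puts the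
  left end of the query at register \<open>K + 1\<close>.\<close>

lemma minimum_query:
  assumes c: "big c" and cn: "\<And>x. x \<in> V \<Longrightarrow> c x \<in> {1..n x}"
    and i: "\<And>x. x \<in> V \<Longrightarrow> number_at (w x) (inp x) [K + 1..<K + 1 + K] = i x"
    and i_n: "\<And>x. x \<in> V \<Longrightarrow> i x \<in> {1..n x}" and R: "2 * K + 1 \<le> R"
  shows "\<exists>P T. \<forall>x\<in>V. \<exists>t m s. exec (w x) (B x) (n x) (A x) P (inp x) t m s \<and> t \<le> T \<and> m \<le> 1 \<and>
    result_of (w x) K s = (if A x (i x) < A x (c x) then i x else c x)"
proof -
  let ?fs = "map (\<lambda>k x. dg (w x) k (c x)) [0..<K]"
  have fs: "cw f" if "f \<in> set ?fs" for f using that big_dg[OF c] by auto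
  obtain P T where P: "\<forall>x\<in>V. \<forall>s. (\<forall>q<R. s q = inp x q) \<longrightarrow>
      (\<exists>t s'. exec (w x) (B x) (n x) (A x) P s t 0 s' \<and> t \<le> T \<and> (\<forall>q<R. s' q = s q) \<and>
        (\<forall>k<length ?fs. s' (R + k) = (?fs ! k) x))"
    using cw_list[OF fs le_refl] by blast
  let ?Q = "Cond (R + K) (copy (K + 1) K) (copy R K)"
  let ?C = "Compare (R + K) [K + 1..<K + 1 + K] [R..<R + K]"
  show ?thesis
  proof (rule exI[of _ "Seq P (Seq ?C ?Q)"], rule exI[of _ "T + (1 + (K + 1))"], intro ballI)
    fix x assume x: "x \<in> V"
    obtain t s where s: "exec (w x) (B x) (n x) (A x) P (inp x) t 0 s" "t \<le> T"
        "\<forall>q<R. s q = inp x q" "\<forall>k<length ?fs. s (R + k) = (?fs ! k) x"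
      using P x by blast
    have ci: "number_at (w x) s' [K + 1..<K + 1 + K] = i x" if "\<And>q. q < R \<Longrightarrow> s' q = inp x q" for s'
    proof -
      have "number_at (w x) s' [K + 1..<K + 1 + K] = number_at (w x) (inp x) [K + 1..<K + 1 + K]"
        by (rule number_at_cong) (use that R in auto)
      then show ?thesis using i[OF x] by simp
    qed
    have cc: "number_at (w x) s [R..<R + K] = c x"
      by (rule number_at_dg) (use s(4) big_less_bound[OF c x] in auto)
    let ?b = "A x (i x) < A x (c x)"
    define s1 where "s1 = s(R + K := take_bit (w x) (of_bool ?b))"
    have C: "exec (w x) (B x) (n x) (A x) ?C s 1 1 s1"
      unfolding s1_def by (rule exec.Compare) (use ci[of s] s(3) cc cn[OF x] i_n[OF x] in auto)
    have nz: "s1 (R + K) \<noteq> 0 \<longleftrightarrow> ?b" using take_bit_of_bool[OF x, of ?b] by (simp add: s1_def)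
    define r where "r = (if ?b then K + 1 else R)"
    have "exec (w x) (B x) (n x) (A x) (copy r K) s1 K 0 (\<lambda>q. if q < K then s1 (r + q) else s1 q)"
      by (rule exec_copy) (use R in \<open>auto simp: r_def\<close>)
    note cp = this
    have "exec (w x) (B x) (n x) (A x) ?Q s1 (K + 1) 0 (\<lambda>q. if q < K then s1 (r + q) else s1 q)"
    proof (cases ?b)
      case True
      show ?thesis by (rule exec.CondTrue) (use True nz cp in \<open>simp_all only: r_def if_True\<close>)
    next
      case False
      show ?thesis by (rule exec.CondFalse) (use False nz cp in \<open>simp_all only: r_def if_False, blast\<close>)
    qed
    then have "exec (w x) (B x) (n x) (A x) (Seq P (Seq ?C ?Q)) (inp x) (t + (1 + (K + 1))) (0 + (1 + 0))
        (\<lambda>q. if q < K then s1 (r + q) else s1 q)"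
      by (intro exec.Seq[OF s(1)] exec.Seq[OF C])
    moreover have "result_of (w x) K (\<lambda>q. if q < K then s1 (r + q) else s1 q) = number_at (w x) s1 [r..<r + K]"
      unfolding result_of_def number_at_shift[of _ _ r] by (rule number_at_cong) simp
    moreover have "number_at (w x) s1 [r..<r + K] = (if ?b then i x else c x)"
    proof (cases ?b)
      case True
      then show ?thesis using ci[of s1] s(3) R by (simp add: r_def s1_def)
    next
      case False
      have "number_at (w x) s1 [R..<R + K] = number_at (w x) s [R..<R + K]"
        by (rule number_at_cong) (simp add: s1_def)
      then show ?thesis using False cc by (simp add: r_def)
    qed
    ultimately show "\<exists>t m s. exec (w x) (B x) (n x) (A x) (Seq P (Seq ?C ?Q)) (inp x) t m s \<and>
        t \<le> T + (1 + (K + 1)) \<and> m \<le> 1 \<and> result_of (w x) K s = (if ?b then i x else c x)"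
      using s(2) by (intro exI[of _ "t + (1 + (K + 1))"] exI[of _ "0 + (1 + 0)"] exI) auto
  qed
qed

end

section \<open>Range minima and stack depths\<close>

text \<open>Ties go to the right because of \<open>rmq_by_depth\<close>: left of the sought head a
  position can have the same depth, right of it depths are strictly larger.\<close>

definition rightmost_argmin :: "(nat \<Rightarrow> int) \<Rightarrow> nat \<Rightarrow> nat \<Rightarrow> nat \<Rightarrow> bool" where
  "rightmost_argmin d x y c \<longleftrightarrow> c \<in> {x..y} \<and> (\<forall>t\<in>{x..y}. d c \<le> d t \<and> (c < t \<longrightarrow> d c < d t))"

lemma rightmost_argmin_unique:
  "rightmost_argmin d x y c \<Longrightarrow> rightmost_argmin d x y c' \<Longrightarrow> c = c'"
  unfolding rightmost_argmin_def by (metis leD linorder_neqE_nat)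

lemma rightmost_argmin_exists:
  assumes "x \<le> y"
  shows "\<exists>c. rightmost_argmin d x y c"
proof -
  define M where "M = {t \<in> {x..y}. \<forall>u\<in>{x..y}. d t \<le> d u}"
  have "Min (d ` {x..y}) \<in> d ` {x..y}" using assms by (intro Min_in) auto
  then obtain t where "t \<in> {x..y}" "d t = Min (d ` {x..y})" by auto
  then have "t \<in> M" unfolding M_def by auto
  moreover have "finite M" unfolding M_def by auto
  ultimately have Mx: "Max M \<in> M" "\<And>u. u \<in> M \<Longrightarrow> u \<le> Max M" by (auto intro: Max_in)
  have "d (Max M) < d u" if "u \<in> {x..y}" "Max M < u" for u
  proof (rule ccontr)
    assume "\<not> d (Max M) < d u"
    then have "u \<in> M" using Mx(1) that(1) unfolding M_def by force
    then show False using Mx(2) that(2) by force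
  qed
  then show ?thesis using Mx(1) unfolding rightmost_argmin_def M_def by blast
qed

text \<open>The intervals may overlap or merely touch. On a tie \<open>c'\<close> wins, as it comes
  from the interval that reaches at least as far to the right.\<close>

lemma rightmost_argmin_merge:
  assumes "rightmost_argmin d x y c" and "rightmost_argmin d x' y' c'"
    and "x \<le> x'" "y \<le> y'" "x' \<le> Suc y"
  shows "rightmost_argmin d x y' (if d c' \<le> d c then c' else c)"
proof -
  have cover: "t \<in> {x..y'} \<Longrightarrow> t \<in> {x..y} \<or> t \<in> {x'..y'}" for t using assms(3-5) by auto
  have beyond: "t \<in> {x..y'} \<Longrightarrow> t \<notin> {x'..y'} \<Longrightarrow> t < x'" for t using assms by auto
  show ?thesis
  proof (cases "d c' \<le> d c")
    case True
    have "d c' \<le> d t \<and> (c' < t \<longrightarrow> d c' < d t)" if t: "t \<in> {x..y'}" for t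
    proof (cases "t \<in> {x'..y'}")
      case False
      then have "t < x'" "t \<in> {x..y}" using beyond cover t by auto
      then show ?thesis using assms(1,2) True unfolding rightmost_argmin_def by fastforce
    qed (use assms(2) in \<open>auto simp: rightmost_argmin_def\<close>)
    then show ?thesis using True assms unfolding rightmost_argmin_def by auto
  next
    case False
    have "d c \<le> d t \<and> (c < t \<longrightarrow> d c < d t)" if t: "t \<in> {x..y'}" for t
    proof (cases "t \<in> {x..y}")
      case False
      then have "t \<in> {x'..y'}" using cover t by auto
      then have "d c' \<le> d t" using assms(2) unfolding rightmost_argmin_def by blast
      then show ?thesis using \<open>\<not> d c' \<le> d c\<close> by simp
    qed (use assms(1) in \<open>auto simp: rightmost_argmin_def\<close>)
    then show ?thesis using False assms unfolding rightmost_argmin_def by auto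
  qed
qed

text \<open>Only the order of the depths matters, which lets clipped codes stand in for the true
  ones.\<close>

lemma rightmost_argmin_mono:
  assumes "\<And>s t. s \<in> {x..y} \<Longrightarrow> t \<in> {x..y} \<Longrightarrow> s < t \<Longrightarrow> sgn (e t - e s) = sgn (d t - d s)"
    and "rightmost_argmin d x y c"
  shows "rightmost_argmin e x y c"
proof -
  have "e c \<le> e t \<and> (c < t \<longrightarrow> e c < e t)" if t: "t \<in> {x..y}" for t
  proof (cases c t rule: linorder_cases)
    case less
    then have "0 < d t - d c" using assms(2) t unfolding rightmost_argmin_def by auto
    moreover have "sgn (e t - e c) = sgn (d t - d c)" using assms less t unfolding rightmost_argmin_def by blast
    ultimately have "0 < e t - e c" by (metis sgn_1_pos)
    then show ?thesis by simp
  next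
    case greater
    then have "0 \<le> d t - d c" using assms(2) t unfolding rightmost_argmin_def by auto
    moreover have "sgn (e c - e t) = sgn (d c - d t)" using assms greater t unfolding rightmost_argmin_def by blast
    ultimately show ?thesis using greater by (auto simp: sgn_if split: if_splits)
  qed auto
  then show ?thesis using assms(2) unfolding rightmost_argmin_def by blast
qed

text \<open>A step code \<open>0\<close> leaves the stack alone; a step code \<open>Suc p\<close> pops \<open>p\<close> entries and pushes one.\<close>

definition step :: "nat \<Rightarrow> int" where
  "step a = (if a = 0 then 0 else 2 - int a)"

definition height :: "(nat \<Rightarrow> nat) \<Rightarrow> nat \<Rightarrow> int" where
  "height a t = (\<Sum>u<t. step (a u))"

text \<open>A non-head does not change the stack. The extra 1 keeps its depth from tying with that
  of the head on top of the stack, where the rightmost minimum would choose wrongly.\<close>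

definition depth :: "(nat \<Rightarrow> nat) \<Rightarrow> nat \<Rightarrow> int" where
  "depth a t = height a (Suc t) + of_bool (a t = 0)"

lemma height_Suc: "height a (Suc t) = height a t + step (a t)"
  by (simp add: height_def)

section \<open>The stack of run heads and its step codes\<close>

definition head :: "nat \<Rightarrow> (nat \<Rightarrow> nat) \<Rightarrow> nat \<Rightarrow> bool" where
  "head n A t \<longleftrightarrow> 1 \<le> t \<and> t \<le> n \<and> (t = 1 \<or> A t < A (t - 1))"

definition stack :: "nat \<Rightarrow> (nat \<Rightarrow> nat) \<Rightarrow> nat \<Rightarrow> nat set" where
  "stack n A t = {h. h \<le> t \<and> head n A h \<and> (\<forall>k\<in>{h..t}. A h \<le> A k)}"

text \<open>If \<open>p\<close> entries are popped, the new height is the old one plus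
  \<open>1 - p\<close>, so the value is \<open>p + 1\<close>, the length of the pop count in unary
  with a terminator. By \<open>stack_head\<close> it is positive at every head, so 0 is free to mark
  non-heads.\<close>

definition code :: "nat \<Rightarrow> (nat \<Rightarrow> nat) \<Rightarrow> nat \<Rightarrow> nat" where
  "code n A t = (if head n A t then card (stack n A (t - 1)) + 2 - card (stack n A t) else 0)"

lemma finite_stack: "finite (stack n A t)"
  by (rule finite_subset[of _ "{..t}"]) (auto simp: stack_def)

lemma stack_0: "stack n A 0 = {}"
  by (auto simp: stack_def head_def)

lemma head_in_stack: "head n A t \<Longrightarrow> t \<in> stack n A t"
  by (auto simp: stack_def)

lemma card_stack_le: "card (stack n A t) \<le> t"
proof -
  have "card (stack n A t) \<le> card {1..t}"
    by (rule card_mono) (auto simp: stack_def head_def)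
  then show ?thesis by simp
qed

lemma stack_head: 
  assumes "head n A t"
  shows "card (stack n A t) \<le> card (stack n A (t - 1)) + 1"
proof -
  have "stack n A t \<subseteq> insert t (stack n A (t - 1))"
    by (auto simp: stack_def)
  then have "card (stack n A t) \<le> card (insert t (stack n A (t - 1)))"
    by (intro card_mono) (auto simp: finite_stack)
  then show ?thesis using finite_stack by (simp add: card_insert_if split: if_splits)
qed

text \<open>An entry no smaller than its predecessor pops nothing, as all stack entries have values
  at most \<open>A (t - 1)\<close>.\<close>

lemma stack_nonhead:
  assumes "\<not> head n A t" "1 \<le> t" "t \<le> n"
  shows "stack n A t = stack n A (t - 1)"
proof -
  have t: "t \<noteq> 1" "A (t - 1) \<le> A t" using assms by (auto simp: head_def)
  have sub: "stack n A (t - 1) \<subseteq> stack n A t"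
  proof
    fix h assume "h \<in> stack n A (t - 1)"
    then have h: "h \<le> t - 1" "head n A h" "\<forall>k\<in>{h..t - 1}. A h \<le> A k" by (auto simp: stack_def)
    have "A h \<le> A k" if "k \<in> {h..t}" for k
    proof (cases "k = t")
      case True
      have "A h \<le> A (t - 1)" using h by simp
      then show ?thesis using True t by simp
    next
      case False
      then have "k \<in> {h..t - 1}" using that by auto
      then show ?thesis using h by blast
    qed
    then show "h \<in> stack n A t" using h by (simp add: stack_def)
  qed
  have "stack n A t \<subseteq> stack n A (t - 1)"
  proof
    fix h assume h: "h \<in> stack n A t"
    then have "h \<noteq> t" using assms(1) by (auto simp: stack_def)
    then show "h \<in> stack n A (t - 1)" using h by (auto simp: stack_def)
  qed
  with sub show ?thesis by blast
qed

lemma code_eq_0_iff: "code n A t = 0 \<longleftrightarrow> \<not> head n A t"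
  using stack_head[of n A t] by (auto simp: code_def)

lemma height_code:
  "t \<le> n \<Longrightarrow> height (code n A) (Suc t) = int (card (stack n A t))"
proof (induction t)
  case 0
  have "\<not> head n A 0" by (simp add: head_def)
  then show ?case by (simp add: height_def step_def code_def stack_0)
next
  case (Suc t)
  show ?case
  proof (cases "head n A (Suc t)")
    case True
    then have "step (code n A (Suc t)) = int (card (stack n A (Suc t))) - int (card (stack n A t))"
      using stack_head[OF True] by (auto simp: step_def code_def)
    then show ?thesis using Suc by (subst height_Suc) simp
  next
    case False
    then show ?thesis using Suc stack_nonhead[OF False] by (subst height_Suc) (simp add: step_def code_eq_0_iff[THEN iffD2, OF False])
  qed
qed

lemma card_heads: 
  assumes "1 \<le> n" shows "card {t. head n A t} = runs n A"
proof -
  have "{t. head n A t} = insert 1 (Suc ` {t. 1 \<le> t \<and> t < n \<and> A (t + 1) < A t})" (is "_ = insert 1 (Suc ` ?S)")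
  proof (intro set_eqI iffI)
    fix t assume "t \<in> {t. head n A t}"
    then show "t \<in> insert 1 (Suc ` ?S)" by (cases t) (auto simp: head_def)
  qed (use assms in \<open>auto simp: head_def\<close>)
  moreover have "1 \<notin> Suc ` ?S" "finite ?S" by auto
  ultimately show ?thesis by (simp add: runs_def card_image)
qed

text \<open>Each head is pushed once and popped at most once. Formally, the final height is
  \<open>2 * runs n A\<close> minus the sum of the codes, and it is not negative.\<close>

lemma sum_code_le:
  assumes "1 \<le> n" shows "(\<Sum>t\<le>n. code n A t) \<le> 2 * runs n A"
proof -
  have sub: "{t. head n A t} \<subseteq> {..n}" by (auto simp: head_def)
  have "0 \<le> height (code n A) (Suc n)" by (simp add: height_code)
  also have "height (code n A) (Suc n) = (\<Sum>t\<le>n. (if head n A t then 2 else 0) - int (code n A t))"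
    unfolding height_def lessThan_Suc_atMost
    by (rule sum.cong) (auto simp: step_def code_eq_0_iff)
  also have "\<dots> = 2 * int (card {t. head n A t}) - int (\<Sum>t\<le>n. code n A t)"
    using sub by (simp add: sum_subtractf sum.If_cases Int_absorb1)
  finally have "int (\<Sum>t\<le>n. code n A t) \<le> int (2 * runs n A)"
    using card_heads[OF assms, of A] by simp
  then show ?thesis by (simp only: of_nat_le_iff)
qed

lemma depth_code: "t \<le> n \<Longrightarrow> depth (code n A) t = int (card (stack n A t)) + of_bool (\<not> head n A t)"
  by (simp add: depth_def height_code code_eq_0_iff)

text \<open>If the minimum \<open>m\<close> is not at \<open>i\<close>, it is a head. To the right
  of \<open>m\<close> the stack retains \<open>m\<close> and everything below it; to the left, as
  far as \<open>i\<close>, the stack already contains everything below \<open>m\<close>. If the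
  minimum is at \<open>i\<close>, the comparison with \<open>A i\<close> settles the query whatever
  \<open>c\<close> is.\<close>

lemma rmq_by_depth:
  assumes inj: "inj_on A {1..n}" and ij: "1 \<le> i" "i < j" "j \<le> n"
    and c: "rightmost_argmin (depth (code n A)) (Suc i) j c"
  shows "rmq A i j = (if A i < A c then i else c)"
proof -
  define m where "m = rmq A i j"
  have injij: "inj_on A {i..j}" by (rule inj_on_subset[OF inj]) (use ij in auto)
  have m: "m \<in> {i..j}" and less: "\<And>k. k \<in> {i..j} \<Longrightarrow> k \<noteq> m \<Longrightarrow> A m < A k"
    using rmq_unique_minimum[OF injij] ij by (auto simp: m_def)
  have cij: "c \<in> {Suc i..j}" using c by (simp add: rightmost_argmin_def)
  show ?thesis
  proof (cases "m = i")
    case True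
    then show ?thesis using less[of c] cij by (auto simp: m_def)
  next
    case False
    then have im: "i < m" "m \<le> j" using m by auto
    have le: "A m \<le> A k" if "k \<in> {i..j}" for k using less[OF that] by (cases "k = m") auto
    have hm: "head n A m" using less[of "m - 1"] im ij by (cases m) (auto simp: head_def)
    have dm: "depth (code n A) m = int (card (stack n A m))" using hm im ij by (simp add: depth_code)
    have "rightmost_argmin (depth (code n A)) (Suc i) j m"
      unfolding rightmost_argmin_def
    proof (intro conjI ballI)
      show "m \<in> {Suc i..j}" using im by simp
      fix k assume k: "k \<in> {Suc i..j}"
      have dk: "depth (code n A) k = int (card (stack n A k)) + of_bool (\<not> head n A k)"
        using k ij by (simp add: depth_code)
      have gt: "depth (code n A) m < depth (code n A) k" if "m < k"
      proof -
        have sub: "stack n A m \<subseteq> stack n A k"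
        proof
          fix h assume h: "h \<in> stack n A m"
          have "A h \<le> A q" if q: "q \<in> {h..k}" for q
          proof (cases "q \<le> m")
            case False
            have "A h \<le> A m" using h by (auto simp: stack_def)
            also have "A m \<le> A q" using False q k im by (intro le) auto
            finally show ?thesis .
          qed (use h q in \<open>auto simp: stack_def\<close>)
          then show "h \<in> stack n A k" using h \<open>m < k\<close> by (auto simp: stack_def)
        qed
        show ?thesis
        proof (cases "head n A k")
          case True
          have "k \<in> stack n A k" "k \<notin> stack n A m" using True \<open>m < k\<close> by (auto simp: stack_def)
          then have "stack n A m \<subset> stack n A k" using sub by blast
          then have "card (stack n A m) < card (stack n A k)" by (intro psubset_card_mono finite_stack)
          then show ?thesis using dm dk by simp
        next
          case False
          then show ?thesis using card_mono[OF finite_stack sub] dm dk by simp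
        qed
      qed
      have "depth (code n A) m \<le> depth (code n A) k" if "k < m"
      proof -
        \<comment> \<open>An entry below \<open>m\<close> on the stack has a value of at most
          \<open>A m\<close> and hence lies before \<open>i\<close>, as \<open>A m\<close> is the
          strict minimum from \<open>i\<close> to \<open>j\<close>.\<close>
        have sub: "stack n A m - {m} \<subseteq> stack n A k - {k}"
        proof
          fix h assume "h \<in> stack n A m - {m}"
          then have h: "h < m" "head n A h" "\<forall>q\<in>{h..m}. A h \<le> A q" by (auto simp: stack_def)
          then have "A h \<le> A m" by simp
          then have "h < i" using less[of h] h(1) im by force
          then show "h \<in> stack n A k - {k}" using h k that by (auto simp: stack_def)
        qed
        have 1: "card (stack n A m - {m}) \<le> card (stack n A k - {k})"
          by (rule card_mono[OF _ sub]) (simp add: finite_stack)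
        have 2: "card (stack n A m) = Suc (card (stack n A m - {m}))"
          using card.remove[OF finite_stack head_in_stack[OF hm]] .
        show ?thesis
        \<comment> \<open>Both cases supply the unit that \<open>m\<close> contributes to its own
          depth: \<open>k\<close> itself as a stack entry, or the extra 1 of a non-head.\<close>
        proof (cases "head n A k")
          case True
          then have "card (stack n A k) = Suc (card (stack n A k - {k}))"
            using card.remove[OF finite_stack head_in_stack] by blast
          then show ?thesis using 1 2 dm dk by simp
        next
          case False
          have "card (stack n A k - {k}) \<le> card (stack n A k)" by (intro card_mono finite_stack) auto
          then show ?thesis using 1 2 False dm dk by simp
        qed
      qed
      then show "depth (code n A) m \<le> depth (code n A) k" using gt by (cases m k rule: linorder_cases) auto
      show "m < k \<longrightarrow> depth (code n A) m < depth (code n A) k" using gt by blast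
    qed
    then have "c = m" using c rightmost_argmin_unique by blast
    moreover have "\<not> A i < A m" using less[of i] im by auto
    ultimately show ?thesis by (simp add: m_def)
  qed
qed

lemma height_code_bounds:
  assumes "t \<le> Suc n" shows "0 \<le> height (code n A) t" and "height (code n A) t \<le> int n"
  using assms height_code[of "t - 1" n A] card_stack_le[of n A "t - 1"]
  by (cases t; force simp: height_def)+

lemma depth_code_bounds:
  assumes "t \<le> n" shows "0 \<le> depth (code n A) t" and "depth (code n A) t \<le> int n + 1"
  using assms height_code_bounds[of "Suc t" n A] by (auto simp: depth_def)

section \<open>Encoding blocks of step codes\<close>

text \<open>A block of step codes costs \<open>lg (b choose k)\<close> bits for the positions of its \<open>k\<close> nonzero codes
  and one bit per unit of their sum. By Vandermonde's identity the first part adds up to at most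
  \<open>lg (n choose r)\<close> over all blocks.\<close>

definition types :: "nat \<Rightarrow> nat \<Rightarrow> nat list set" where
  "types C b = {\<tau>. set \<tau> \<subseteq> {..C} \<and> length \<tau> = b}"

definition nonzeros :: "nat list \<Rightarrow> nat" where
  "nonzeros \<tau> = length (filter (\<lambda>v. v \<noteq> 0) \<tau>)"

definition clg :: "nat \<Rightarrow> nat" where
  "clg m = nat \<lceil>log 2 (real m)\<rceil>"

definition cost :: "nat list \<Rightarrow> nat" where
  "cost \<tau> = clg (length \<tau> choose nonzeros \<tau>) + sum_list \<tau>"

lemma le_exp_clg: "1 \<le> m \<Longrightarrow> m \<le> 2 ^ clg m"
proof -
  assume m: "1 \<le> m"
  have "real m = 2 powr log 2 (real m)" using m by simp
  also have "\<dots> \<le> 2 powr real (clg m)"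
    unfolding clg_def by (intro powr_mono) (auto simp: le_of_int_ceiling real_nat_ceiling_ge)
  also have "\<dots> = real (2 ^ clg m)" by (simp add: powr_realpow)
  finally show ?thesis by (simp only: of_nat_le_iff)
qed

lemma clg_less: "1 \<le> m \<Longrightarrow> real (clg m) < log 2 (real m) + 1"
  unfolding clg_def by (simp add: le_log_iff) linarith

lemma clg_le: "1 \<le> m \<Longrightarrow> m \<le> 2 ^ b \<Longrightarrow> clg m \<le> b"
proof -
  assume m: "1 \<le> m" "m \<le> 2 ^ b"
  then have "real m \<le> 2 ^ b" by (metis of_nat_le_iff of_nat_numeral of_nat_power)
  then have "log 2 (real m) \<le> real b" using m by (simp add: log_le_iff powr_realpow)
  then show ?thesis unfolding clg_def by (simp add: ceiling_le_iff)
qed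

lemma finite_types: "finite (types C b)"
  unfolding types_def by (rule finite_lists_length_eq) simp

lemma card_types: "card (types C b) = (C + 1) ^ b"
  unfolding types_def by (subst card_lists_length_eq) auto

lemma finite_sum_lists: "finite {\<tau> :: nat list. length \<tau> = b \<and> sum_list \<tau> = s}"
  by (rule finite_subset[of _ "types s b"])
    (auto simp: types_def finite_types[unfolded types_def] intro: member_le_sum_list finite_types)

text \<open>A block is fixed by the positions of its nonzero codes and by the codes there, a
  composition of \<open>s\<close> into \<open>k\<close> parts, of which there are at most
  \<open>2 ^ s\<close>. The induction splits off the first code.\<close>

lemma card_nonzeros_sum_le:
  "card {\<tau>. length \<tau> = b \<and> nonzeros \<tau> = k \<and> sum_list \<tau> = s} \<le> (b choose k) * 2 ^ s"
proof (induction b arbitrary: k s)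
  case 0
  have "{\<tau>. length \<tau> = 0 \<and> nonzeros \<tau> = k \<and> sum_list \<tau> = s} \<subseteq> (if k = 0 then {[]} else {})"
    by (auto simp: nonzeros_def)
  then have "card {\<tau>. length \<tau> = 0 \<and> nonzeros \<tau> = k \<and> sum_list \<tau> = s} \<le> card (if k = 0 then {[]::nat list} else {})"
    by (intro card_mono) auto
  also have "\<dots> \<le> (0 choose k) * 2 ^ s" by auto
  finally show ?case .
next
  case (Suc b)
  let ?L = "\<lambda>b k s. {\<tau> :: nat list. length \<tau> = b \<and> nonzeros \<tau> = k \<and> sum_list \<tau> = s}"
  have fin: "finite (?L b k s)" for b k s
    by (rule finite_subset[OF _ finite_sum_lists[of b s]]) auto
  have sub: "?L (Suc b) k s \<subseteq> (#) 0 ` ?L b k s \<union>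
      (if k = 0 then {} else (\<Union>p\<in>{1..s}. (#) p ` ?L b (k - 1) (s - p)))"
  proof
    fix \<tau> assume \<tau>: "\<tau> \<in> ?L (Suc b) k s"
    then obtain v \<tau>' where v: "\<tau> = v # \<tau>'" by (cases \<tau>) auto
    show "\<tau> \<in> (#) 0 ` ?L b k s \<union> (if k = 0 then {} else (\<Union>p\<in>{1..s}. (#) p ` ?L b (k - 1) (s - p)))"
    proof (cases "v = 0")
      case True
      then show ?thesis using \<tau> v by (auto simp: nonzeros_def)
    next
      case False
      then have "k \<noteq> 0" "v \<in> {1..s}" "\<tau>' \<in> ?L b (k - 1) (s - v)"
        using \<tau> v by (auto simp: nonzeros_def)
      then show ?thesis using v by auto
    qed
  qed
  have 1: "card ((#) 0 ` ?L b k s) \<le> (b choose k) * 2 ^ s"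
    using card_image_le[OF fin] Suc.IH le_trans by blast
  show ?case
  proof (cases k)
    case 0
    have "card (?L (Suc b) k s) \<le> card ((#) 0 ` ?L b k s)"
      using sub 0 fin by (intro card_mono) auto
    then show ?thesis using 1 0 by simp
  next
    case (Suc k')
    \<comment> \<open>Kraft's inequality for unary lengths: a first code \<open>p\<close> leaves
      \<open>s - p\<close> bits, and these choices together account for at most
      \<open>2 ^ s\<close>.\<close>
    have geom: "(\<Sum>p = 1..s. (2::nat) ^ (s - p)) \<le> 2 ^ s"
    proof -
      have "(\<Sum>p = 1..s. (2::nat) ^ (s - p)) = (\<Sum>q<s. 2 ^ q)"
        by (rule sum.reindex_bij_witness[of _ "\<lambda>q. s - q" "\<lambda>p. s - p"]) auto
      also have "\<dots> < 2 ^ s" using sum_power2[of s] by (simp add: atLeast0LessThan)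
      finally show ?thesis by simp
    qed
    have "card (\<Union>p\<in>{1..s}. (#) p ` ?L b k' (s - p)) \<le> (\<Sum>p = 1..s. card ((#) p ` ?L b k' (s - p)))"
      by (rule card_UN_le) simp
    also have "\<dots> \<le> (\<Sum>p = 1..s. (b choose k') * 2 ^ (s - p))"
      by (intro sum_mono) (use card_image_le[OF fin] Suc.IH le_trans in blast)
    also have "\<dots> \<le> (b choose k') * 2 ^ s"
      using geom by (simp add: sum_distrib_left[symmetric])
    finally have 2: "card (\<Union>p\<in>{1..s}. (#) p ` ?L b k' (s - p)) \<le> (b choose k') * 2 ^ s" .
    have "card (?L (Suc b) k s) \<le> card ((#) 0 ` ?L b k s \<union> (\<Union>p\<in>{1..s}. (#) p ` ?L b k' (s - p)))"
      using sub Suc fin by (intro card_mono) auto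
    also have "\<dots> \<le> card ((#) 0 ` ?L b k s) + card (\<Union>p\<in>{1..s}. (#) p ` ?L b k' (s - p))"
      by (rule card_Un_le)
    also have "\<dots> \<le> (b choose k) * 2 ^ s + (b choose k') * 2 ^ s" using 1 2 by simp
    also have "\<dots> = (Suc b choose k) * 2 ^ s" using Suc by (simp add: algebra_simps)
    finally show ?thesis .
  qed
qed

lemma nonzeros_le: "nonzeros \<tau> \<le> length \<tau>"
  by (simp add: nonzeros_def)

lemma finite_cost: "finite {\<tau>. length \<tau> = b \<and> cost \<tau> = c}"
proof (rule finite_subset)
  show "{\<tau>. length \<tau> = b \<and> cost \<tau> = c} \<subseteq> (\<Union>s\<le>c. {\<tau>. length \<tau> = b \<and> sum_list \<tau> = s})"
    by (auto simp: cost_def)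
qed (auto intro: finite_sum_lists)

text \<open>For each number \<open>k\<close> of nonzero codes the cost fixes their sum, which leaves
  at most \<open>2 ^ c\<close> blocks; the factor \<open>b + 1\<close> counts the values of
  \<open>k\<close>.\<close>

lemma card_cost_le: "card {\<tau>. length \<tau> = b \<and> cost \<tau> = c} \<le> (b + 1) * 2 ^ c"
proof -
  let ?L = "\<lambda>k. {\<tau>. length \<tau> = b \<and> nonzeros \<tau> = k \<and> sum_list \<tau> = c - clg (b choose k)}"
  let ?M = "\<lambda>k. if clg (b choose k) \<le> c then ?L k else {}"
  have fin: "finite (?M k)" for k
    by (auto intro: finite_subset[OF _ finite_sum_lists[of b "c - clg (b choose k)"]])
  have "card {\<tau>. length \<tau> = b \<and> cost \<tau> = c} \<le> card (\<Union>k\<le>b. ?M k)"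
  proof (rule card_mono)
    show "{\<tau>. length \<tau> = b \<and> cost \<tau> = c} \<subseteq> (\<Union>k\<le>b. ?M k)"
      using nonzeros_le by (fastforce simp: cost_def)
  qed (use fin in blast)
  also have "\<dots> \<le> (\<Sum>k\<le>b. card (?M k))" by (rule card_UN_le) simp
  also have "\<dots> \<le> (\<Sum>k\<le>b. 2 ^ c)"
  proof (rule sum_mono)
    fix k assume k: "k \<in> {..b}"
    show "card (?M k) \<le> 2 ^ c"
    proof (cases "clg (b choose k) \<le> c")
      case True
      have "card (?L k) \<le> (b choose k) * 2 ^ (c - clg (b choose k))" by (rule card_nonzeros_sum_le)
      also have "\<dots> \<le> 2 ^ clg (b choose k) * 2 ^ (c - clg (b choose k))"
        using k by (intro mult_le_mono1 le_exp_clg) (simp add: Suc_leI)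
      also have "\<dots> = 2 ^ c" using True by (simp flip: power_add)
      finally show ?thesis using True by simp
    qed simp
  qed
  finally show ?thesis by simp
qed

text \<open>A leading one bit makes both length and content readable from one number. Such numbers
  serve as indices into the tables over block types.\<close>

lemma leading_bit_inject:
  fixes e e' :: nat
  assumes "2 ^ l + e = 2 ^ l' + e'" "e < 2 ^ l" "e' < 2 ^ l'"
  shows "l = l' \<and> e = e'"
proof -
  have "\<not> l < l'" if "2 ^ l + e = 2 ^ l' + e'" "e < 2 ^ l" for l l' e e' :: nat
  proof
    assume "l < l'"
    then have "(2::nat) ^ Suc l \<le> 2 ^ l'" by (intro power_increasing) auto
    then show False using that by simp
  qed
  from this[OF assms(1,2)] this[OF assms(1)[symmetric] assms(3)] have "l = l'" by simp
  then show ?thesis using assms(1) by simp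
qed

text \<open>Blocks of each cost are numbered separately with \<open>cost \<tau> + g\<close> bits,
  where \<open>g\<close> pays for the factor \<open>b + 1\<close> of \<open>card_cost_le\<close>.
  Where this is not below \<open>W\<close>, a numbering of all types with \<open>W\<close> bits
  takes over; the cap bounds the tables over types. Lengths are stored apart, so the codes may fail
  to be prefix-free.\<close>

lemma block_encoding:
  assumes b: "b + 1 \<le> 2 ^ g" and W: "(C + 1) ^ b \<le> 2 ^ W"
  shows "\<exists>(len :: nat list \<Rightarrow> nat) (enc :: nat list \<Rightarrow> nat).
    (\<forall>\<tau>\<in>types C b. len \<tau> \<le> cost \<tau> + g \<and> len \<tau> \<le> W \<and> enc \<tau> < 2 ^ len \<tau>) \<and>
    inj_on (\<lambda>\<tau>. 2 ^ len \<tau> + enc \<tau>) (types C b)"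
proof -
  have "\<exists>f. f ` types C b \<subseteq> {..<2 ^ W :: nat} \<and> inj_on f (types C b)"
    by (rule card_le_inj) (use W in \<open>simp_all add: finite_types card_types\<close>)
  then obtain f where f: "f ` types C b \<subseteq> {..<2 ^ W :: nat}" "inj_on f (types C b)" by blast
  have ex: "\<exists>h. h ` {\<tau>. length \<tau> = b \<and> cost \<tau> = c} \<subseteq> {..<2 ^ (c + g) :: nat} \<and>
      inj_on h {\<tau>. length \<tau> = b \<and> cost \<tau> = c}" for c
  proof (rule card_le_inj)
    have "card {\<tau>. length \<tau> = b \<and> cost \<tau> = c} \<le> (b + 1) * 2 ^ c" by (rule card_cost_le)
    also have "\<dots> \<le> 2 ^ g * 2 ^ c" using b by (intro mult_le_mono1)
    finally show "card {\<tau>. length \<tau> = b \<and> cost \<tau> = c} \<le> card {..<2 ^ (c + g) :: nat}"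
      by (simp add: power_add mult.commute)
  qed (use finite_cost in auto)
  define h where "h c = (SOME h. h ` {\<tau>. length \<tau> = b \<and> cost \<tau> = c} \<subseteq> {..<2 ^ (c + g) :: nat} \<and>
      inj_on h {\<tau>. length \<tau> = b \<and> cost \<tau> = c})" for c
  have h: "h c ` {\<tau>. length \<tau> = b \<and> cost \<tau> = c} \<subseteq> {..<2 ^ (c + g) :: nat}"
    "inj_on (h c) {\<tau>. length \<tau> = b \<and> cost \<tau> = c}" for c
    unfolding h_def using someI_ex[OF ex[of c]] by blast+
  define len where "len \<tau> = min (cost \<tau> + g) W" for \<tau>
  define enc where "enc \<tau> = (if cost \<tau> + g < W then h (cost \<tau>) \<tau> else f \<tau>)" for \<tau>
  have lt: "enc \<tau> < 2 ^ len \<tau>" if "\<tau> \<in> types C b" for \<tau>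
  proof (cases "cost \<tau> + g < W")
    case True
    have "h (cost \<tau>) \<tau> < 2 ^ (cost \<tau> + g)" using h(1)[of "cost \<tau>"] that by (auto simp: types_def)
    then show ?thesis using True by (simp add: len_def enc_def)
  next
    case False
    have "f \<tau> < 2 ^ W" using f(1) that by auto
    then show ?thesis using False by (simp add: len_def enc_def)
  qed
  have "inj_on (\<lambda>\<tau>. 2 ^ len \<tau> + enc \<tau>) (types C b)"
  proof (rule inj_onI)
    fix \<tau> \<tau>' assume T: "\<tau> \<in> types C b" "\<tau>' \<in> types C b" and "2 ^ len \<tau> + enc \<tau> = 2 ^ len \<tau>' + enc \<tau>'"
    then have eq: "len \<tau> = len \<tau>'" "enc \<tau> = enc \<tau>'"
      using leading_bit_inject[OF _ lt lt] by blast+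
    \<comment> \<open>A length below \<open>W\<close> reveals the cost and with it the numbering;
      length \<open>W\<close> stands for the common one.\<close>
    show "\<tau> = \<tau>'"
    proof (cases "cost \<tau> + g < W")
      case True
      then have c: "cost \<tau> = cost \<tau>'" using eq(1) by (auto simp: len_def)
      then have "h (cost \<tau>) \<tau> = h (cost \<tau>) \<tau>'" using eq(2) True by (simp add: enc_def)
      then show ?thesis using h(2)[of "cost \<tau>"] T c unfolding inj_on_def by (auto simp: types_def)
    next
      case False
      then have "\<not> cost \<tau>' + g < W" using eq(1) by (auto simp: len_def)
      then have "f \<tau> = f \<tau>'" using eq(2) False by (simp add: enc_def)
      then show ?thesis using f(2) T by (simp add: inj_on_def)
    qed
  qed
  then show ?thesis using lt by (intro exI[of _ len] exI[of _ enc]) (auto simp: len_def)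
qed

section \<open>Total cost of the blocks of an array\<close>

lemma choose_mult_le: "(a choose x) * (b choose y) \<le> (a + b) choose (x + y)"
proof -
  have "(a choose x) * (b choose (x + y - x)) \<le> (\<Sum>k\<le>x + y. (a choose k) * (b choose (x + y - k)))"
    by (rule member_le_sum) auto
  then show ?thesis by (simp only: vandermonde add_diff_cancel_left')
qed

lemma prod_choose_le:
  "finite S \<Longrightarrow> (\<Prod>l\<in>S. c l choose k l) \<le> (\<Sum>l\<in>S. c l) choose (\<Sum>l\<in>S. k l)"
proof (induction S rule: finite_induct)
  case (insert l S)
  have "(\<Prod>l\<in>insert l S. c l choose k l) = (c l choose k l) * (\<Prod>l\<in>S. c l choose k l)"
    using insert by simp
  also have "\<dots> \<le> (c l choose k l) * ((\<Sum>l\<in>S. c l) choose (\<Sum>l\<in>S. k l))"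
    using insert by (intro mult_le_mono2)
  also have "\<dots> \<le> (c l + (\<Sum>l\<in>S. c l)) choose (k l + (\<Sum>l\<in>S. k l))" by (rule choose_mult_le)
  finally show ?case using insert by simp
qed simp

text \<open>For \<open>a = code n A\<close>, position 0 and all positions beyond \<open>n\<close>
  carry code 0, so blocks can be counted from 0 and all have length \<open>b\<close>.\<close>

definition block :: "nat \<Rightarrow> nat \<Rightarrow> (nat \<Rightarrow> nat) \<Rightarrow> nat \<Rightarrow> nat list" where
  "block C b a l = map (\<lambda>t. min (a t) C) [l * b..<l * b + b]"

lemma block_in_types: "block C b a l \<in> types C b"
  by (auto simp: block_def types_def)

lemma sum_blocks:
  fixes f :: "nat \<Rightarrow> nat"
  assumes "1 \<le> b" and "\<And>t. n < t \<Longrightarrow> f t = 0"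
  shows "(\<Sum>l\<le>n div b. \<Sum>t=l * b..<l * b + b. f t) = (\<Sum>t\<le>n. f t)"
proof -
  have "(\<Sum>l\<le>n div b. \<Sum>t=l * b..<l * b + b. f t) = (\<Sum>t<Suc (n div b) * b. f t)"
    unfolding lessThan_Suc_atMost[symmetric] by (rule sum.nat_group)
  also have "\<dots> = (\<Sum>t\<le>n. f t)"
  proof (rule sum.mono_neutral_right)
    have "n < Suc (n div b) * b" using assms(1) dividend_less_div_times[of b n] by simp
    then show "{..n} \<subseteq> {..<Suc (n div b) * b}" by auto
  qed (use assms(2) in auto)
  finally show ?thesis .
qed

text \<open>With \<open>c l\<close> positions of \<open>{1..n}\<close> in block \<open>l\<close>,
  the binomials \<open>c l choose k l\<close> multiply to at most \<open>n choose r\<close>, because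
  the \<open>c l\<close> add up to exactly \<open>n\<close>. Interior blocks have
  \<open>c l = b\<close>; the first and the last can be shorter and are charged \<open>b\<close>
  bits each, hence the term \<open>2 * real b\<close>. Rounding costs one bit per block.\<close>

lemma sum_cost_le:
  assumes b: "1 \<le> b" and C: "1 \<le> C" and n: "1 \<le> n"
    and supp: "\<And>t. a t \<noteq> 0 \<Longrightarrow> t \<in> {1..n}"
    and card: "card {t. a t \<noteq> 0} = r"
  shows "real (\<Sum>l\<le>n div b. cost (block C b a l))
    \<le> real_of_int \<lceil>log 2 (real (n choose r))\<rceil> + real (\<Sum>t\<le>n. a t) + real (n div b + 1) + 2 * real b"
proof -
  define k where "k l = nonzeros (block C b a l)" for l
  define c where "c l = (\<Sum>t=l * b..<l * b + b. of_bool (t \<in> {1..n}) :: nat)" for l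
  \<comment> \<open>As \<open>1 \<le> C\<close>, clipping preserves which codes are nonzero.\<close>
  have k: "k l = (\<Sum>t=l * b..<l * b + b. of_bool (a t \<noteq> 0))" for l
    unfolding k_def nonzeros_def block_def using C
    by (simp add: filter_map comp_def sum_of_bool_eq Int_def interv_sum_list_conv_sum_set_nat
        flip: distinct_card[OF distinct_filter])
  have kc: "k l \<le> c l" for l unfolding k c_def using supp by (intro sum_mono) auto
  have sk: "(\<Sum>l\<le>n div b. k l) = r"
  proof -
    have "(\<Sum>l\<le>n div b. k l) = (\<Sum>t\<le>n. of_bool (a t \<noteq> 0))"
      unfolding k using supp by (intro sum_blocks b) force
    also have "\<dots> = card ({..n} \<inter> {t. a t \<noteq> 0})" by (simp add: sum_of_bool_eq)
    also have "{..n} \<inter> {t. a t \<noteq> 0} = {t. a t \<noteq> 0}" using supp by force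
    finally show ?thesis using card by simp
  qed
  have sc: "(\<Sum>l\<le>n div b. c l) = n"
  proof -
    have "(\<Sum>l\<le>n div b. c l) = (\<Sum>t\<le>n. of_bool (t \<in> {1..n}))"
      unfolding c_def by (intro sum_blocks b) auto
    also have "\<dots> = (\<Sum>t\<in>{1..n}. 1)" by (rule sum.mono_neutral_cong_right) auto
    finally show ?thesis by simp
  qed
  have full: "c l = b" if "l \<noteq> 0" "l < n div b" for l
  proof -
    have "t \<in> {1..n}" if "t \<in> {l * b..<l * b + b}" for t
    proof -
      have "Suc l * b \<le> n div b * b" using \<open>l < n div b\<close> by (intro mult_le_mono1) simp
      also have "\<dots> \<le> n" by (rule div_times_less_eq_dividend)
      finally have "l * b + b \<le> n" by simp
      moreover have "0 < l * b" using \<open>l \<noteq> 0\<close> b by simp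
      ultimately show ?thesis using that by (simp only: atLeastLessThan_iff atLeastAtMost_iff) linarith
    qed
    then have "c l = (\<Sum>t=l * b..<l * b + b. 1)" unfolding c_def by (intro sum.cong) auto
    then show ?thesis by simp
  qed
  have pos: "1 \<le> c l choose k l" for l using kc[of l] by (simp add: Suc_leI)
  have kb: "k l \<le> b" for l using nonzeros_le[of "block C b a l"] by (simp add: k_def block_def)
  have cl: "real (clg (b choose k l)) \<le> log 2 (real (c l choose k l)) + 1 + real b * of_bool (l = 0 \<or> l = n div b)"
    if "l \<le> n div b" for l
  proof (cases "l = 0 \<or> l = n div b")
    case True
    have "clg (b choose k l) \<le> b"
      by (rule clg_le) (use kb[of l] binomial_le_pow2 in \<open>auto simp: Suc_leI\<close>)
    moreover have "0 \<le> log 2 (real (c l choose k l))"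
      using pos[of l] by (subst zero_le_log_cancel_iff) linarith+
    ultimately show ?thesis using True by simp
  next
    case False
    then show ?thesis using full[of l] that clg_less[of "b choose k l"] kb[of l] by (simp add: Suc_leI)
  qed
  have "real (\<Sum>l\<le>n div b. clg (b choose k l))
      \<le> (\<Sum>l\<le>n div b. log 2 (real (c l choose k l)) + 1 + real b * of_bool (l = 0 \<or> l = n div b))"
    unfolding of_nat_sum by (rule sum_mono) (use cl in auto)
  also have "\<dots> = (\<Sum>l\<le>n div b. log 2 (real (c l choose k l))) + real (n div b + 1)
      + real b * (\<Sum>l\<le>n div b. of_bool (l = 0 \<or> l = n div b))"
    by (simp add: sum.distrib sum_distrib_left)
  also have "(\<Sum>l\<le>n div b. of_bool (l = 0 \<or> l = n div b) :: real) \<le> 2"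
  proof -
    have "(\<Sum>l\<le>n div b. of_bool (l = 0 \<or> l = n div b) :: real)
        \<le> (\<Sum>l\<le>n div b. (if l = 0 then 1 else 0) + (if l = n div b then 1 else 0))"
      by (rule sum_mono) auto
    also have "\<dots> = 2" by (simp add: sum.distrib)
    finally show ?thesis .
  qed
  also have "(\<Sum>l\<le>n div b. log 2 (real (c l choose k l))) = log 2 (real (\<Prod>l\<le>n div b. c l choose k l))"
  proof -
    have "ln (\<Prod>l\<in>S. real (c l choose k l)) = (\<Sum>l\<in>S. ln (real (c l choose k l)))" if "finite S" for S
      using that by (subst ln_prod) (simp_all add: kc not_less)
    then show ?thesis by (simp add: log_def sum_divide_distrib)
  qed
  also have "\<dots> \<le> log 2 (real (n choose r))"
  proof -
    have "(\<Prod>l\<le>n div b. c l choose k l) \<le> n choose r"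
      using prod_choose_le[of "{..n div b}" c k] sk sc by simp
    moreover have "1 \<le> (\<Prod>l\<le>n div b. c l choose k l)" by (rule prod_ge_1) (use pos in auto)
    ultimately show ?thesis by (subst log_le_cancel_iff) linarith+
  qed
  finally have 1: "real (\<Sum>l\<le>n div b. clg (b choose k l)) \<le> log 2 (real (n choose r)) + real (n div b + 1) + real b * 2"
    by (simp add: mult_left_mono)
  have "(\<Sum>l\<le>n div b. sum_list (block C b a l)) \<le> (\<Sum>l\<le>n div b. \<Sum>t=l * b..<l * b + b. a t)"
    unfolding block_def by (intro sum_mono) (simp add: interv_sum_list_conv_sum_set_nat sum_mono)
  also have "\<dots> = (\<Sum>t\<le>n. a t)" using supp by (intro sum_blocks b) force
  finally have 2: "(\<Sum>l\<le>n div b. sum_list (block C b a l)) \<le> (\<Sum>t\<le>n. a t)" .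
  have "(\<Sum>l\<le>n div b. cost (block C b a l)) = (\<Sum>l\<le>n div b. clg (b choose k l)) + (\<Sum>l\<le>n div b. sum_list (block C b a l))"
    unfolding cost_def by (simp add: sum.distrib k_def block_def)
  then show ?thesis using 1 2 le_of_int_ceiling[of "log 2 (real (n choose r))"] by linarith
qed

section \<open>Tables in the index\<close>

lemma read_word_append1: "a + l \<le> length xs \<Longrightarrow> read_word l (xs @ ys) a = read_word l xs a"
  by (rule bit_eqI) (auto simp: bit_read_word nth_append)

lemma read_word_append2: "read_word l (xs @ ys) (length xs + a) = read_word l ys a"
  by (rule bit_eqI) (auto simp: bit_read_word nth_append)

definition table :: "nat \<Rightarrow> nat \<Rightarrow> (nat \<Rightarrow> nat) \<Rightarrow> bool list" where
  "table d N f = map (\<lambda>p. bit (f (p div d)) (p mod d)) [0..<N * d]"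

lemma length_table [simp]: "length (table d N f) = N * d"
  by (simp add: table_def)

lemma read_table:
  assumes "i < N"
  shows "read_word d (table d N f) (i * d) = take_bit d (f i)"
proof (rule bit_eqI)
  fix q
  have "i * d + q < N * d" if "q < d"
  proof -
    have "i * d + q < Suc i * d" using that by simp
    also have "\<dots> \<le> N * d" using assms by (intro mult_le_mono1) simp
    finally show ?thesis .
  qed
  then show "bit (read_word d (table d N f) (i * d)) q = bit (take_bit d (f i)) q"
    by (auto simp: bit_read_word bit_take_bit_iff table_def)
qed

definition stream :: "(nat \<Rightarrow> nat) \<Rightarrow> (nat \<Rightarrow> nat) \<Rightarrow> nat \<Rightarrow> bool list" where
  "stream len enc m = concat (map (\<lambda>l. map (bit (enc l)) [0..<len l]) [0..<m])"

lemma length_stream: "length (stream len enc m) = (\<Sum>l<m. len l)"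
  by (induction m) (simp_all add: stream_def)

lemma read_stream:
  assumes "l < m"
  shows "read_word (len l) (stream len enc m) (\<Sum>k<l. len k) = take_bit (len l) (enc l)"
  using assms
proof (induction m)
  case (Suc m)
  have eq: "stream len enc (Suc m) = stream len enc m @ map (bit (enc m)) [0..<len m]"
    by (simp add: stream_def)
  show ?case
  proof (cases "l = m")
    case True
    have "read_word (len m) (map (bit (enc m)) [0..<len m]) 0 = take_bit (len m) (enc m)"
      by (rule bit_eqI) (auto simp: bit_read_word bit_take_bit_iff)
    then show ?thesis
      using True read_word_append2[of "len m" "stream len enc m" "map (bit (enc m)) [0..<len m]" 0]
      by (simp add: eq length_stream)
  next
    case False
    then have "l < m" using Suc.prems by simp
    then have "(\<Sum>k<l. len k) + len l \<le> (\<Sum>k<m. len k)"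
      using sum_mono2[of "{..<m}" "{..<Suc l}" len] by simp
    then show ?thesis using Suc.IH[OF \<open>l < m\<close>] unfolding eq
      by (subst read_word_append1) (simp_all add: length_stream)
  qed
qed simp

definition region_base :: "nat list \<Rightarrow> nat \<Rightarrow> nat" where
  "region_base ls k = sum_list (take k ls)"

lemma read_region:
  assumes "k < length Rs" and "p + l \<le> length (Rs ! k)"
  shows "read_word l (concat Rs) (region_base (map length Rs) k + p) = read_word l (Rs ! k) p"
proof -
  have "concat Rs = concat (take k Rs) @ Rs ! k @ concat (drop (Suc k) Rs)"
    using id_take_nth_drop[OF assms(1)] by (metis concat.simps(2) concat_append)
  moreover have "region_base (map length Rs) k = length (concat (take k Rs))"
    by (simp add: region_base_def length_concat take_map)
  ultimately show ?thesis
    using assms(2) by (simp add: read_word_append2 read_word_append1)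
qed

lemma region_within:
  assumes "k < length Rs"
  shows "region_base (map length Rs) k + length (Rs ! k) \<le> length (concat Rs)"
proof -
  have "concat Rs = concat (take k Rs) @ Rs ! k @ concat (drop (Suc k) Rs)"
    using id_take_nth_drop[OF assms(1)] by (metis concat.simps(2) concat_append)
  moreover have "region_base (map length Rs) k = length (concat (take k Rs))"
    by (simp add: region_base_def length_concat take_map)
  ultimately show ?thesis by simp
qed

context ram
begin

text \<open>Cell widths are powers of two, so that addressing takes a shift and an addition instead
  of a multi-word product. Contents are promised for indices in \<open>I x\<close> only; the bound
  on \<open>base x\<close> alone serves guarded reads, whose index defaults to 0.\<close>

definition stored :: "('x \<Rightarrow> nat set) \<Rightarrow> ('x \<Rightarrow> nat \<Rightarrow> nat) \<Rightarrow> bool" where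
  "stored I f \<longleftrightarrow> (\<exists>base s. big base \<and> big s \<and> (\<forall>x\<in>V. s x \<le> K * w x \<and> 2 ^ s x \<le> K * w x \<and>
    base x \<le> length (B x) \<and>
    (\<forall>i\<in>I x. base x + i * 2 ^ s x \<le> length (B x) \<and> read_word (2 ^ s x) (B x) (base x + i * 2 ^ s x) = f x i)))"

lemma stored_read_if:
  assumes w: "cw w" and len: "\<And>x. x \<in> V \<Longrightarrow> length (B x) + K * w x < 2 ^ (K * w x)"
    and st: "stored I f" and p: "cb p" and i: "big i" and iI: "\<And>x. x \<in> V \<Longrightarrow> p x \<Longrightarrow> i x \<in> I x"
  shows "big (\<lambda>x. if p x then f x (i x) else 0)"
proof -
  obtain base s where bs: "big base" "big s" and *: "\<And>x. x \<in> V \<Longrightarrow> s x \<le> K * w x \<and> 2 ^ s x \<le> K * w x \<and>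
    base x \<le> length (B x) \<and>
    (\<forall>i\<in>I x. base x + i * 2 ^ s x \<le> length (B x) \<and> read_word (2 ^ s x) (B x) (base x + i * 2 ^ s x) = f x i)"
    using st unfolding stored_def by blast
  \<comment> \<open>Where the guard fails the index is 0, so that the address is representable on
    all of \<open>V\<close>.\<close>
  define j where "j x = (if p x then i x else 0)" for x
  have j: "big j" unfolding j_def by (intro big_cond p i big_0)
  have bd: "base x + j x * 2 ^ s x + K * w x < 2 ^ (K * w x)" if "x \<in> V" for x
    using len[OF that] *[OF that] iI[OF that] by (cases "p x") (auto simp: j_def intro: le_less_trans)
  have sh: "big (\<lambda>x. j x * 2 ^ s x)"
  proof (rule big_shl[OF w j bs(2)])
    show "j x * 2 ^ s x < 2 ^ (K * w x)" if "x \<in> V" for x using bd[OF that] by linarith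
  qed (use * in blast)
  have addr: "big (\<lambda>x. base x + j x * 2 ^ s x)"
  proof (rule big_add[OF bs(1) sh])
    show "base x + j x * 2 ^ s x < 2 ^ (K * w x)" if "x \<in> V" for x using bd[OF that] by linarith
  qed
  have "big (\<lambda>x. 1 * 2 ^ s x)"
  proof (rule big_shl[OF w big_1 bs(2)])
    show "(1::nat) * 2 ^ s x < 2 ^ (K * w x)" if "x \<in> V" for x
      using *[OF that] less_exp[of "K * w x"] by linarith
  qed (use * in blast)
  then have wd: "big (\<lambda>x. 2 ^ s x)" by simp
  have "big (\<lambda>x. read_word (2 ^ s x) (B x) (base x + j x * 2 ^ s x))"
    by (rule big_field[OF w addr wd _ bd]) (use * in auto)
  then have "big (\<lambda>x. if p x then read_word (2 ^ s x) (B x) (base x + j x * 2 ^ s x) else 0)"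
    by (intro big_cond p big_0)
  then show ?thesis by (rule big_cong[rotated]) (use * iI in \<open>auto simp: j_def\<close>)
qed

lemma stored_read:
  assumes w: "cw w" and len: "\<And>x. x \<in> V \<Longrightarrow> length (B x) + K * w x < 2 ^ (K * w x)"
    and st: "stored I f" and i: "big i" and iI: "\<And>x. x \<in> V \<Longrightarrow> i x \<in> I x"
  shows "big (\<lambda>x. f x (i x))"
  using stored_read_if[OF w len st _ i iI, of "\<lambda>_. True"] cw_1 by simp

end

section \<open>Decomposing range minima\<close>

definition argmin :: "(nat \<Rightarrow> int) \<Rightarrow> nat \<Rightarrow> nat \<Rightarrow> nat" where
  "argmin d x y = (SOME c. rightmost_argmin d x y c)"

lemma argmin: "x \<le> y \<Longrightarrow> rightmost_argmin d x y (argmin d x y)"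
  unfolding argmin_def by (rule someI_ex[OF rightmost_argmin_exists])

lemma argmin_eqI: "rightmost_argmin d x y c \<Longrightarrow> argmin d x y = c"
  unfolding argmin_def by (rule some_equality) (auto intro: rightmost_argmin_unique)

lemma argmin_in: "x \<le> y \<Longrightarrow> argmin d x y \<in> {x..y}"
  using argmin[of x y d] by (simp add: rightmost_argmin_def)

lemma argmin_merge:
  assumes "x \<le> y" "x' \<le> y'" "x \<le> x'" "y \<le> y'" "x' \<le> Suc y"
  shows "argmin d x y' = (if d (argmin d x' y') \<le> d (argmin d x y) then argmin d x' y' else argmin d x y)"
  by (rule argmin_eqI, rule rightmost_argmin_merge[OF argmin argmin]) (use assms in auto)

lemma rightmost_argmin_shift:
  assumes "rightmost_argmin (\<lambda>t. e (p + t)) x y c"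
  shows "rightmost_argmin e (p + x) (p + y) (p + c)"
proof -
  have "e (p + c) \<le> e t \<and> (p + c < t \<longrightarrow> e (p + c) < e t)" if "t \<in> {p + x..p + y}" for t
  proof -
    have "t - p \<in> {x..y}" "t = p + (t - p)" using that by auto
    then show ?thesis using assms unfolding rightmost_argmin_def by (metis add_less_cancel_left)
  qed
  then show ?thesis using assms unfolding rightmost_argmin_def by auto
qed

section \<open>Height differences and clipped codes\<close>

lemma height_diff: "s \<le> t \<Longrightarrow> height a t - height a s = (\<Sum>u=s..<t. step (a u))"
  unfolding height_def using sum.atLeastLessThan_concat[of 0 s t "\<lambda>u. step (a u)"]
  by (simp add: atLeast0LessThan)

lemma step_le_1: "step v \<le> 1"
  by (simp add: step_def)

lemma height_diff_le: "s \<le> t \<Longrightarrow> height a t - height a s \<le> int (t - s)"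
  using sum_mono[of "{s..<t}" "\<lambda>u. step (a u)" "\<lambda>_. 1"] by (simp add: height_diff step_le_1)

lemma height_diff_ge:
  assumes "s \<le> t" and "\<And>u. u \<in> {s..<t} \<Longrightarrow> a u \<le> C"
  shows "- int ((t - s) * C) \<le> height a t - height a s"
proof -
  have "(\<Sum>u=s..<t. - int C) \<le> (\<Sum>u=s..<t. step (a u))"
    using assms(2) by (intro sum_mono) (force simp: step_def)
  then show ?thesis using height_diff[OF assms(1)] assms(1) by simp
qed

text \<open>Every other step raises the height by at most 1, so one code of at least
  \<open>C\<close> forces a drop as soon as \<open>C\<close> is larger than the window length plus
  1.\<close>

lemma height_drop:
  assumes "u \<in> {s..<t}" and "C \<le> a u" and "1 \<le> C"
  shows "height a t - height a s \<le> int (t - s) + 1 - int C"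
proof -
  have "(\<Sum>v=s..<t. step (a v)) = step (a u) + (\<Sum>v\<in>{s..<t} - {u}. step (a v))"
    using assms(1) by (subst sum.remove[of _ u]) auto
  also have "\<dots> \<le> (2 - int C) + (\<Sum>v\<in>{s..<t} - {u}. 1)"
    using assms by (intro add_mono sum_mono step_le_1) (auto simp: step_def)
  also have "\<dots> = int (t - s) + 1 - int C" using assms(1) by (simp add: of_nat_diff)
  finally show ?thesis using assms(1) by (subst height_diff) auto
qed

text \<open>Once a step code exceeds the length of a window, its exact value does not affect any
  comparison of depths inside the window.\<close>

lemma depth_clip_sgn:
  assumes "s < t" and "t - s + 2 < C"
  shows "sgn (depth (\<lambda>u. min (a u) C) t - depth (\<lambda>u. min (a u) C) s) = sgn (depth a t - depth a s)"
proof -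
  define a' where "a' u = min (a u) C" for u
  have a': "(\<lambda>u. min (a u) C) = a'" by (simp add: a'_def fun_eq_iff)
  have z: "a' u = 0 \<longleftrightarrow> a u = 0" for u using assms(2) by (auto simp: a'_def)
  have d: "depth f t - depth f s = height f (Suc t) - height f (Suc s) + of_bool (f t = 0) - of_bool (f s = 0)"
    for f by (simp add: depth_def)
  show ?thesis
  proof (cases "\<exists>u\<in>{Suc s..<Suc t}. C \<le> a u")
    case True
    then obtain u where u: "u \<in> {Suc s..<Suc t}" "C \<le> a u" "C \<le> a' u" by (auto simp: a'_def)
    \<comment> \<open>Of the two extra units in \<open>t - s + 2 < C\<close>, one absorbs the 1 in
      this bound and the other a possible 1 of a non-head at \<open>t\<close>.\<close>
    have "height f (Suc t) - height f (Suc s) \<le> int (t - s) + 1 - int C" if "C \<le> f u" for f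
      using height_drop[of u "Suc s" "Suc t" C f, OF u(1) that] assms(2) by simp
    from this[of a, OF u(2)] this[of a', OF u(3)]
    have "depth a t - depth a s < 0" "depth a' t - depth a' s < 0"
      using assms(2) unfolding d by (auto simp: of_bool_def)
    then show ?thesis unfolding a' by simp
  next
    case False
    then have "a' u = a u" if "u \<in> {Suc s..<Suc t}" for u
      using that unfolding a'_def by (metis min.absorb1 nle_le)
    then have "height a' (Suc t) - height a' (Suc s) = height a (Suc t) - height a (Suc s)"
      using assms(1) by (subst (1 2) height_diff) auto
    then have "depth a' t - depth a' s = depth a t - depth a s" unfolding d by (simp add: z)
    then show ?thesis unfolding a' by simp
  qed
qed

lemma height_map:
  assumes "x \<le> m"
  shows "height ((!) (map f [p..<p + m])) x = height f (p + x) - height f p"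
proof -
  have "height ((!) (map f [p..<p + m])) x = (\<Sum>u<x. step (f (p + u)))"
    unfolding height_def using assms by (intro sum.cong) auto
  also have "\<dots> = (\<Sum>u=p..<p + x. step (f u))"
    by (rule sum.reindex_bij_witness[of _ "\<lambda>u. u - p" "\<lambda>u. p + u"]) auto
  finally show ?thesis by (simp add: height_diff)
qed

lemma depth_map:
  "x < m \<Longrightarrow> depth ((!) (map f [p..<p + m])) x = depth f (p + x) - height f p"
  using height_map[of "Suc x" m f p] by (simp add: depth_def)

text \<open>The signs of depth differences inside a block survive clipping, so the answer depends
  only on the block type and the two offsets. Hence one table over types serves all blocks.\<close>

lemma argmin_block:
  assumes "x \<le> y" "y < b" "b + 2 < C"
  shows "argmin (depth a) (l * b + x) (l * b + y) = l * b + argmin (depth ((!) (block C b a l))) x y"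
proof (rule argmin_eqI, rule rightmost_argmin_shift,
    rule rightmost_argmin_mono[OF _ argmin[OF assms(1), of "depth ((!) (block C b a l))"]])
  fix s t assume st: "s \<in> {x..y}" "t \<in> {x..y}" "s < t"
  have "sgn (depth (\<lambda>u. min (a u) C) (l * b + t) - depth (\<lambda>u. min (a u) C) (l * b + s))
      = sgn (depth a (l * b + t) - depth a (l * b + s))"
    by (rule depth_clip_sgn) (use st assms in auto)
  then show "sgn (depth a (l * b + t) - depth a (l * b + s))
      = sgn (depth ((!) (block C b a l)) t - depth ((!) (block C b a l)) s)"
    unfolding block_def using st assms by (simp add: depth_map)
qed

text \<open>The usual sparse-table device: two windows of \<open>2 ^ k\<close> cells, flush with
  either end, cover the range, since \<open>2 ^ k\<close> exceeds half its number of cells. Overlap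
  does no harm to minima.\<close>

lemma argmin_sparse:
  assumes "u \<le> v" and "1 \<le> (s::nat)" and k: "k = floor_log (Suc v - u)"
  shows "argmin d (u * s) (Suc v * s - 1) =
    (let c = argmin d (u * s) ((u + 2 ^ k) * s - 1);
         c' = argmin d ((Suc v - 2 ^ k) * s) (Suc v * s - 1)
     in if d c' \<le> d c then c' else c)"
proof -
  have k1: "2 ^ k \<le> Suc v - u" using assms(1) unfolding k by (intro floor_log_exp2_le) simp
  have k2: "Suc v - u < 2 * 2 ^ k" unfolding k using floor_log_exp2_gt[of "Suc v - u"] by simp
  have "u * s + 1 \<le> (u + 2 ^ k) * s"
  proof -
    have "u * s + 1 * 1 \<le> u * s + 2 ^ k * s" using assms(2) by (intro add_left_mono mult_le_mono) auto
    then show ?thesis by (simp add: algebra_simps)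
  qed
  moreover have "(Suc v - 2 ^ k) * s + 1 \<le> Suc v * s"
  proof -
    have "(Suc v - 2 ^ k) * s + 1 * 1 \<le> (Suc v - 2 ^ k) * s + 2 ^ k * s" using assms(2) by (intro add_left_mono mult_le_mono) auto
    also have "\<dots> = Suc v * s" using k1 by (simp flip: distrib_right)
    finally show ?thesis by simp
  qed
  moreover have "u * s \<le> (Suc v - 2 ^ k) * s" using k1 assms(1) by (intro mult_le_mono1) linarith
  moreover have "(u + 2 ^ k) * s \<le> Suc v * s" using k1 assms(1) by (intro mult_le_mono1) linarith
  moreover have "(Suc v - 2 ^ k) * s \<le> (u + 2 ^ k) * s" using k2 assms(1) by (intro mult_le_mono1) linarith
  ultimately show ?thesis
    unfolding Let_def by (intro argmin_merge) linarith+
qed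

text \<open>Inside a superblock without clipped codes the depths are small relative to its start and are
  obtained from per-block and per-type tables; the few other superblocks store all depths explicitly.\<close>

definition clean :: "nat \<Rightarrow> (nat \<Rightarrow> nat) \<Rightarrow> nat \<Rightarrow> nat \<Rightarrow> bool" where
  "clean C a si S \<longleftrightarrow> (\<forall>t\<in>{S * 2 ^ si..<Suc S * 2 ^ si}. a t \<le> C)"

definition super_height :: "(nat \<Rightarrow> nat) \<Rightarrow> nat \<Rightarrow> nat \<Rightarrow> nat" where
  "super_height a si S = nat (height a (S * 2 ^ si))"

text \<open>In a clean superblock a step lowers the height by at most \<open>C\<close>, so the
  offset makes the value nonnegative before \<open>nat\<close> is applied. The offset
  \<open>2 ^ be * C\<close> in \<open>type_depth\<close> does the same inside a block.\<close>

definition block_height :: "nat \<Rightarrow> (nat \<Rightarrow> nat) \<Rightarrow> nat \<Rightarrow> nat \<Rightarrow> nat \<Rightarrow> nat" where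
  "block_height C a be si l =
    nat (height a (l * 2 ^ be) - height a (l div 2 ^ (si - be) * 2 ^ si) + int (2 ^ si * C))"

definition type_depth :: "nat \<Rightarrow> nat \<Rightarrow> nat list \<Rightarrow> nat \<Rightarrow> nat" where
  "type_depth C be \<tau> x = nat (depth ((!) \<tau>) x + int (2 ^ be * C))"

text \<open>The two offsets together are the same for all positions and do not affect comparisons.
  Explicitly stored depths carry them too, so as to be comparable with computed ones.\<close>

definition shifted_depth :: "nat \<Rightarrow> (nat \<Rightarrow> nat) \<Rightarrow> nat \<Rightarrow> nat \<Rightarrow> nat \<Rightarrow> nat" where
  "shifted_depth C a be si t = nat (depth a t + int (2 ^ si * C) + int (2 ^ be * C))"

lemma div_exp_div_exp: "be \<le> si \<Longrightarrow> t div 2 ^ be div 2 ^ (si - be) = t div (2::nat) ^ si"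
  by (simp add: div_mult2_eq[symmetric] flip: power_add)

lemma type_depth_ge:
  assumes "\<tau> \<in> types C b" "x < b"
  shows "- int (b * C) \<le> depth ((!) \<tau>) x"
proof -
  have "- int ((Suc x - 0) * C) \<le> height ((!) \<tau>) (Suc x) - height ((!) \<tau>) 0"
    using assms by (intro height_diff_ge) (auto simp: types_def subset_iff)
  moreover have "(Suc x - 0) * C \<le> b * C" using assms(2) by (intro mult_le_mono1) simp
  moreover have "height ((!) \<tau>) 0 = 0" by (simp add: height_def)
  moreover have "(0::int) \<le> of_bool (\<tau> ! x = 0)" by simp
  ultimately show ?thesis unfolding depth_def by linarith
qed

lemma type_depth_le: "type_depth C be \<tau> x \<le> 2 ^ be * C + x + 2"
proof -
  have "height ((!) \<tau>) (Suc x) - height ((!) \<tau>) 0 \<le> int (Suc x - 0)" by (rule height_diff_le) simp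
  moreover have "height ((!) \<tau>) 0 = 0" by (simp add: height_def)
  moreover have "(of_bool (\<tau> ! x = 0) :: int) \<le> 1" by simp
  ultimately show ?thesis unfolding type_depth_def depth_def by linarith
qed

lemma block_height_le:
  assumes "be \<le> si"
  shows "block_height C a be si l \<le> 2 ^ si + 2 ^ si * C"
proof -
  let ?s = "l div 2 ^ (si - be) * 2 ^ si" and ?t = "l * 2 ^ be"
  have e: "(2::nat) ^ si = 2 ^ (si - be) * 2 ^ be" using assms by (simp flip: power_add)
  have st: "?s \<le> ?t"
    unfolding e by (metis div_times_less_eq_dividend mult.assoc mult_le_mono1)
  moreover have "?t \<le> ?s + 2 ^ si"
  proof -
    have "l \<le> l div 2 ^ (si - be) * 2 ^ (si - be) + 2 ^ (si - be)"
      by (metis add_le_cancel_left div_mult_mod_eq mod_le_divisor zero_less_numeral zero_less_power)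
    then have "l * 2 ^ be \<le> (l div 2 ^ (si - be) * 2 ^ (si - be) + 2 ^ (si - be)) * 2 ^ be" by (rule mult_le_mono1)
    then show ?thesis unfolding e by (simp add: algebra_simps)
  qed
  ultimately have "height a ?t - height a ?s \<le> int (2 ^ si)"
    using height_diff_le[OF st, of a] by linarith
  then show ?thesis unfolding block_height_def by (simp add: nat_le_iff)
qed

text \<open>The block of \<open>t\<close> lies within the superblock of \<open>t\<close>, where no
  code is clipped, so heights telescope over superblock start, block start and position.\<close>

lemma shifted_depth_clean:
  assumes be: "be \<le> si" and cl: "clean C a si (t div 2 ^ si)" and h: "0 \<le> height a (t div 2 ^ si * 2 ^ si)"
  shows "shifted_depth C a be si t = super_height a si (t div 2 ^ si) + block_height C a be si (t div 2 ^ be)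
    + type_depth C be (block C (2 ^ be) a (t div 2 ^ be)) (t mod 2 ^ be)"
proof -
  define S where "S = t div 2 ^ si"
  define l where "l = t div 2 ^ be"
  define x where "x = t mod 2 ^ be"
  have t: "t = l * 2 ^ be + x" unfolding l_def x_def by (rule div_mult_mod_eq[symmetric])
  have x: "x < 2 ^ be" by (simp add: x_def)
  have S: "l div 2 ^ (si - be) = S" unfolding l_def S_def using be by (rule div_exp_div_exp)
  have e: "(2::nat) ^ si = 2 ^ (si - be) * 2 ^ be" using be by (simp flip: power_add)
  have lo: "S * 2 ^ si \<le> l * 2 ^ be"
    unfolding S[symmetric] e by (metis div_times_less_eq_dividend mult.assoc mult_le_mono1)
  have hi: "l * 2 ^ be + 2 ^ be \<le> Suc S * 2 ^ si"
  proof -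
    have "Suc l \<le> Suc S * 2 ^ (si - be)"
      unfolding S[symmetric] using dividend_less_div_times[of "2 ^ (si - be)" l] by (simp add: Suc_le_eq)
    then have "Suc l * 2 ^ be \<le> (Suc S * 2 ^ (si - be)) * 2 ^ be" by (rule mult_le_mono1)
    then show ?thesis unfolding e by (simp add: algebra_simps)
  qed
  have aC: "a u \<le> C" if "u \<in> {S * 2 ^ si..<Suc S * 2 ^ si}" for u
    using cl that by (simp add: clean_def S_def)
  have "block C (2 ^ be) a l = map a [l * 2 ^ be..<l * 2 ^ be + 2 ^ be]"
    unfolding block_def using aC lo hi by (auto simp: min_def)
  then have d: "depth ((!) (block C (2 ^ be) a l)) x = depth a t - height a (l * 2 ^ be)"
    using depth_map[OF x, of a "l * 2 ^ be"] by (simp add: t)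
  have "- int ((l * 2 ^ be - S * 2 ^ si) * C) \<le> height a (l * 2 ^ be) - height a (S * 2 ^ si)"
    by (rule height_diff_ge[OF lo]) (use aC hi in auto)
  moreover have "(l * 2 ^ be - S * 2 ^ si) * C \<le> 2 ^ si * C"
    using hi by (intro mult_le_mono1) (simp add: algebra_simps)
  ultimately have 1: "0 \<le> height a (l * 2 ^ be) - height a (S * 2 ^ si) + int (2 ^ si * C)" by linarith
  have 2: "0 \<le> depth ((!) (block C (2 ^ be) a l)) x + int (2 ^ be * C)"
    using type_depth_ge[OF block_in_types x, of C a l] by linarith
  show ?thesis
    unfolding S_def[symmetric] l_def[symmetric] x_def[symmetric]
    unfolding shifted_depth_def super_height_def block_height_def type_depth_def S
    using 1 2 h[folded S_def] d by (simp add: nat_add_distrib[symmetric])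
qed

lemma shifted_depth_le_iff:
  assumes "0 \<le> depth a t" "0 \<le> depth a t'"
  shows "shifted_depth C a be si t \<le> shifted_depth C a be si t' \<longleftrightarrow> depth a t \<le> depth a t'"
  using assms unfolding shifted_depth_def by (subst nat_le_eq_zle) auto

definition dirty_rank :: "nat \<Rightarrow> (nat \<Rightarrow> nat) \<Rightarrow> nat \<Rightarrow> nat \<Rightarrow> nat" where
  "dirty_rank C a si S = card {S'. S' < S \<and> \<not> clean C a si S'}"

text \<open>One field serves as flag and pointer: 0 means clean, any other value minus 1 selects a
  group of explicit depths.\<close>

definition dirty_mark :: "nat \<Rightarrow> (nat \<Rightarrow> nat) \<Rightarrow> nat \<Rightarrow> nat \<Rightarrow> nat" where
  "dirty_mark C a si S = (if clean C a si S then 0 else Suc (dirty_rank C a si S))"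

definition dirty_unrank :: "nat \<Rightarrow> (nat \<Rightarrow> nat) \<Rightarrow> nat \<Rightarrow> nat \<Rightarrow> nat" where
  "dirty_unrank C a si r = (SOME S. \<not> clean C a si S \<and> dirty_rank C a si S = r)"

lemma dirty_rank_less:
  assumes "S < S'" "\<not> clean C a si S"
  shows "dirty_rank C a si S < dirty_rank C a si S'"
  unfolding dirty_rank_def
proof (rule psubset_card_mono)
  have "S \<in> {S''. S'' < S' \<and> \<not> clean C a si S''}" using assms by simp
  moreover have "S \<notin> {S''. S'' < S \<and> \<not> clean C a si S''}" by simp
  moreover have "{S''. S'' < S \<and> \<not> clean C a si S''} \<subseteq> {S''. S'' < S' \<and> \<not> clean C a si S''}"
    using assms(1) by auto
  ultimately show "{S''. S'' < S \<and> \<not> clean C a si S''} \<subset> {S''. S'' < S' \<and> \<not> clean C a si S''}" by blast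
qed simp

lemma dirty_unrank:
  assumes "\<not> clean C a si S"
  shows "dirty_unrank C a si (dirty_rank C a si S) = S"
  unfolding dirty_unrank_def
proof (rule some_equality)
  fix S' assume *: "\<not> clean C a si S' \<and> dirty_rank C a si S' = dirty_rank C a si S"
  then show "S' = S"
    using dirty_rank_less[of S S' C a si] dirty_rank_less[of S' S C a si] assms by (cases S S' rule: linorder_cases) auto
qed (use assms in simp)

definition dirty_table :: "nat \<Rightarrow> (nat \<Rightarrow> nat) \<Rightarrow> nat \<Rightarrow> nat \<Rightarrow> nat \<Rightarrow> nat" where
  "dirty_table C a be si i = shifted_depth C a be si (dirty_unrank C a si (i div 2 ^ si) * 2 ^ si + i mod 2 ^ si)"

lemma dirty_table_eq:
  assumes "\<not> clean C a si (t div 2 ^ si)"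
  shows "dirty_table C a be si (dirty_rank C a si (t div 2 ^ si) * 2 ^ si + t mod 2 ^ si) = shifted_depth C a be si t"
  unfolding dirty_table_def using dirty_unrank[OF assms] by (simp add: div_mult_mod_eq)

definition dirty_count :: "nat \<Rightarrow> (nat \<Rightarrow> nat) \<Rightarrow> nat \<Rightarrow> nat \<Rightarrow> nat" where
  "dirty_count C a si n = dirty_rank C a si (Suc (n div 2 ^ si))"

text \<open>Every superblock that is not clean has a code above \<open>C\<close>, and different
  superblocks contribute disjoint parts of the total.\<close>

lemma dirty_count_le:
  assumes "\<And>t. n < t \<Longrightarrow> a t = 0"
  shows "dirty_count C a si n * C \<le> (\<Sum>t\<le>n. a t)"
proof -
  let ?D = "{S. S < Suc (n div 2 ^ si) \<and> \<not> clean C a si S}"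
  have "dirty_count C a si n * C = (\<Sum>S\<in>?D. C)" by (simp add: dirty_count_def dirty_rank_def)
  also have "\<dots> \<le> (\<Sum>S\<in>?D. \<Sum>t=S * 2 ^ si..<S * 2 ^ si + 2 ^ si. a t)"
  proof (rule sum_mono)
    fix S assume "S \<in> ?D"
    then obtain t where t: "t \<in> {S * 2 ^ si..<S * 2 ^ si + 2 ^ si}" "C < a t"
      unfolding clean_def mult_Suc by (auto simp: not_le add.commute)
    then show "C \<le> (\<Sum>t=S * 2 ^ si..<S * 2 ^ si + 2 ^ si. a t)"
      using member_le_sum[of t "{S * 2 ^ si..<S * 2 ^ si + 2 ^ si}" a] by simp
  qed
  also have "\<dots> \<le> (\<Sum>S\<le>n div 2 ^ si. \<Sum>t=S * 2 ^ si..<S * 2 ^ si + 2 ^ si. a t)"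
    by (rule sum_mono2) auto
  also have "\<dots> = (\<Sum>t\<le>n. a t)" by (rule sum_blocks) (use assms in auto)
  finally show ?thesis .
qed

section \<open>Computing range minima from the tables\<close>

text \<open>Positions are relative to the enclosing cell of size \<open>2 ^ q\<close>, so that
  entries inside superblocks fit short fields. At the upper level this cell contains the whole array
  and the position is absolute.\<close>

definition sparse :: "(nat \<Rightarrow> int) \<Rightarrow> nat \<Rightarrow> nat \<Rightarrow> nat \<Rightarrow> nat \<Rightarrow> nat" where
  "sparse d p q u k = argmin d (u * 2 ^ p) ((u + 2 ^ k) * 2 ^ p - 1) - u * 2 ^ p div 2 ^ q * 2 ^ q"

text \<open>The windows that a query can ask for: inside the array, whose positions here run from 0
  to \<open>n\<close>, and inside one cell of size \<open>2 ^ q\<close>. The pair of start and level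
  is packed into one index.\<close>

definition sparse_cells :: "nat \<Rightarrow> nat \<Rightarrow> nat \<Rightarrow> nat \<Rightarrow> nat set" where
  "sparse_cells n p q ka = {u * 2 ^ ka + k | u k. k < 2 ^ ka \<and> (u + 2 ^ k) * 2 ^ p \<le> n + 1 \<and>
    u * 2 ^ p div 2 ^ q = ((u + 2 ^ k) * 2 ^ p - 1) div 2 ^ q}"

text \<open>The query procedure needs only this interface; concrete sizes are fixed later.
  \<open>be\<close>, \<open>si\<close> and \<open>top\<close> are the exponents of the lengths of
  blocks, superblocks and a range containing the whole array; \<open>2 ^ ka\<close> and
  \<open>2 ^ kb\<close> bound the numbers of levels of the two sparse tables.\<close>

locale index = ram V w n B A inp R K
  for V :: "'x set" and w n :: "'x \<Rightarrow> nat" and B :: "'x \<Rightarrow> bool list"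
    and A :: "'x \<Rightarrow> nat \<Rightarrow> nat" and inp :: "'x \<Rightarrow> regs" and R K :: nat +
  fixes a :: "'x \<Rightarrow> nat \<Rightarrow> nat" and be si top ka kb C :: "'x \<Rightarrow> nat"
    and len enc :: "'x \<Rightarrow> nat list \<Rightarrow> nat" and code_base :: "'x \<Rightarrow> nat"
  assumes cw_w: "cw w"
    and len_B: "x \<in> V \<Longrightarrow> length (B x) + K * w x < 2 ^ (K * w x)"
    and big_n: "big n" and big_be: "big be" and big_si: "big si" and big_top: "big top"
    and big_ka: "big ka" and big_kb: "big kb" and big_code_base: "big code_base"
    and be_si: "x \<in> V \<Longrightarrow> be x \<le> si x" and si_top: "x \<in> V \<Longrightarrow> si x \<le> top x"
    and top_le: "x \<in> V \<Longrightarrow> top x \<le> K * w x"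
    and ka_le: "x \<in> V \<Longrightarrow> ka x \<le> K * w x" and kb_le: "x \<in> V \<Longrightarrow> kb x \<le> K * w x"
    and n_top: "x \<in> V \<Longrightarrow> n x < 2 ^ top x"
    and n_si: "x \<in> V \<Longrightarrow> n x + 2 ^ si x < 2 ^ (K * w x)"
    and n_ka: "x \<in> V \<Longrightarrow> (n x + 2) * 2 ^ ka x < 2 ^ (K * w x)"
    and n_kb: "x \<in> V \<Longrightarrow> (n x + 2) * 2 ^ kb x < 2 ^ (K * w x)"
    and C_gt: "x \<in> V \<Longrightarrow> 2 ^ be x + 2 < C x"
    and a_height: "x \<in> V \<Longrightarrow> t \<le> Suc (n x) \<Longrightarrow> 0 \<le> height (a x) t"
    and id_inj: "x \<in> V \<Longrightarrow> inj_on (\<lambda>\<tau>. 2 ^ len x \<tau> + enc x \<tau>) (types (C x) (2 ^ be x))"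
    and id_bound: "x \<in> V \<Longrightarrow> \<tau> \<in> types (C x) (2 ^ be x) \<Longrightarrow> len x \<tau> \<le> K * w x \<and> enc x \<tau> < 2 ^ len x \<tau> \<and>
       2 ^ len x \<tau> * 2 * 2 ^ be x * 2 ^ be x < (2 ^ (K * w x) :: nat)"
    and sd_bound: "x \<in> V \<Longrightarrow> t \<le> n x \<Longrightarrow> shifted_depth (C x) (a x) (be x) (si x) t < 2 ^ (K * w x)"
    and code_read: "x \<in> V \<Longrightarrow> l \<le> n x div 2 ^ be x \<Longrightarrow>
       code_base x + (\<Sum>k<l. len x (block (C x) (2 ^ be x) (a x) k)) \<le> length (B x) \<and>
       read_word (len x (block (C x) (2 ^ be x) (a x) l)) (B x)
         (code_base x + (\<Sum>k<l. len x (block (C x) (2 ^ be x) (a x) k)))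
       = enc x (block (C x) (2 ^ be x) (a x) l)"
    and st_super_ptr: "stored (\<lambda>x. {..n x div 2 ^ si x})
       (\<lambda>x S. \<Sum>k<S * 2 ^ (si x - be x). len x (block (C x) (2 ^ be x) (a x) k))"
    and st_block_ptr: "stored (\<lambda>x. {..n x div 2 ^ be x})
       (\<lambda>x l. \<Sum>k=l div 2 ^ (si x - be x) * 2 ^ (si x - be x)..<l. len x (block (C x) (2 ^ be x) (a x) k))"
    and st_len: "stored (\<lambda>x. {..n x div 2 ^ be x}) (\<lambda>x l. len x (block (C x) (2 ^ be x) (a x) l))"
    and st_mark: "stored (\<lambda>x. {..n x div 2 ^ si x}) (\<lambda>x S. dirty_mark (C x) (a x) (si x) S)"
    and st_super_height: "stored (\<lambda>x. {..n x div 2 ^ si x}) (\<lambda>x S. super_height (a x) (si x) S)"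
    and st_block_height: "stored (\<lambda>x. {l. l \<le> n x div 2 ^ be x})
       (\<lambda>x l. block_height (C x) (a x) (be x) (si x) l)"
    and st_type_depth: "stored (\<lambda>x. {(2 ^ len x \<tau> + enc x \<tau>) * 2 ^ be x + t | \<tau> t. \<tau> \<in> types (C x) (2 ^ be x) \<and> t < 2 ^ be x})
       (\<lambda>x i. type_depth (C x) (be x)
          (inv_into (types (C x) (2 ^ be x)) (\<lambda>\<tau>. 2 ^ len x \<tau> + enc x \<tau>) (i div 2 ^ be x)) (i mod 2 ^ be x))"
    and st_type_argmin: "stored (\<lambda>x. {((2 ^ len x \<tau> + enc x \<tau>) * 2 ^ be x + t) * 2 ^ be x + u | \<tau> t u.
         \<tau> \<in> types (C x) (2 ^ be x) \<and> t < 2 ^ be x \<and> u < 2 ^ be x \<and> t \<le> u})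
       (\<lambda>x i. argmin (depth ((!) (inv_into (types (C x) (2 ^ be x)) (\<lambda>\<tau>. 2 ^ len x \<tau> + enc x \<tau>)
          (i div 2 ^ be x div 2 ^ be x)))) (i div 2 ^ be x mod 2 ^ be x) (i mod 2 ^ be x))"
    and st_dirty: "stored (\<lambda>x. {dirty_rank (C x) (a x) (si x) (t div 2 ^ si x) * 2 ^ si x + t mod 2 ^ si x | t.
         t \<le> n x \<and> \<not> clean (C x) (a x) (si x) (t div 2 ^ si x)})
       (\<lambda>x i. dirty_table (C x) (a x) (be x) (si x) i)"
    and st_log: "stored (\<lambda>x. {..n x div 2 ^ si x + 2 ^ (si x - be x)}) (\<lambda>x m. floor_log m)"
    and st_low: "stored (\<lambda>x. sparse_cells (n x) (be x) (si x) (ka x))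
       (\<lambda>x i. sparse (depth (a x)) (be x) (si x) (i div 2 ^ ka x) (i mod 2 ^ ka x))"
    and st_high: "stored (\<lambda>x. sparse_cells (n x) (si x) (top x) (kb x))
       (\<lambda>x i. sparse (depth (a x)) (si x) (top x) (i div 2 ^ kb x) (i mod 2 ^ kb x))"
    and low_log: "x \<in> V \<Longrightarrow> si x - be x < 2 ^ ka x"
    and high_log: "x \<in> V \<Longrightarrow> n x + 1 < 2 ^ 2 ^ kb x"
begin

lemma read_if:
  assumes "stored I f" "cb p" "big i" "\<And>x. x \<in> V \<Longrightarrow> p x \<Longrightarrow> i x \<in> I x"
  shows "big (\<lambda>x. if p x then f x (i x) else 0)"
  by (rule stored_read_if[OF cw_w _ assms]) (rule len_B)

lemma read:
  assumes "stored I f" "big i" "\<And>x. x \<in> V \<Longrightarrow> i x \<in> I x"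
  shows "big (\<lambda>x. f x (i x))"
  by (rule stored_read[OF cw_w _ assms]) (rule len_B)

lemma si_le: "x \<in> V \<Longrightarrow> si x \<le> K * w x" and be_le: "x \<in> V \<Longrightarrow> be x \<le> K * w x"
  using si_top top_le be_si le_trans by blast+

lemma n_bound: "x \<in> V \<Longrightarrow> n x + 1 < 2 ^ (K * w x)"
  using n_si[of x] one_le_power[of "2::nat" "si x"] by linarith

lemma big_div: "big f \<Longrightarrow> big s \<Longrightarrow> (\<And>x. x \<in> V \<Longrightarrow> s x \<le> K * w x) \<Longrightarrow> big (\<lambda>x. f x div 2 ^ s x)"
  by (rule big_shr[OF cw_w])

lemma big_floor: "big f \<Longrightarrow> big s \<Longrightarrow> (\<And>x. x \<in> V \<Longrightarrow> s x \<le> K * w x) \<Longrightarrow> big (\<lambda>x. f x div 2 ^ s x * 2 ^ s x)"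
  by (intro big_shl[OF cw_w] big_div) (use big_less_bound div_times_less_eq_dividend le_less_trans in blast)+

lemma big_mod:
  assumes "big f" "big s" "\<And>x. x \<in> V \<Longrightarrow> s x \<le> K * w x"
  shows "big (\<lambda>x. f x mod 2 ^ s x)"
proof -
  have "big (\<lambda>x. f x - f x div 2 ^ s x * 2 ^ s x)" by (intro big_tsub big_floor assms)
  then show ?thesis by (rule big_cong[rotated]) (simp add: minus_div_mult_eq_mod)
qed

abbreviation "blk x l \<equiv> block (C x) (2 ^ be x) (a x) l"

definition ident :: "'x \<Rightarrow> nat list \<Rightarrow> nat" where "ident x \<tau> = 2 ^ len x \<tau> + enc x \<tau>"

lemma inv_ident: "x \<in> V \<Longrightarrow> \<tau> \<in> types (C x) (2 ^ be x) \<Longrightarrow>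
    inv_into (types (C x) (2 ^ be x)) (\<lambda>\<tau>. 2 ^ len x \<tau> + enc x \<tau>) (ident x \<tau>) = \<tau>"
  unfolding ident_def using inv_into_f_f[OF id_inj, of x \<tau>] by simp

lemma ident_less:
  assumes "x \<in> V" "\<tau> \<in> types (C x) (2 ^ be x)"
  shows "(ident x \<tau> + 1) * 2 ^ be x * 2 ^ be x < 2 ^ (K * w x)"
proof -
  have "ident x \<tau> + 1 \<le> 2 ^ len x \<tau> * 2" using id_bound[OF assms] by (simp add: ident_def)
  then have "(ident x \<tau> + 1) * 2 ^ be x * 2 ^ be x \<le> 2 ^ len x \<tau> * 2 * 2 ^ be x * 2 ^ be x" by (intro mult_le_mono1)
  then show ?thesis using id_bound[OF assms] by linarith
qed

text \<open>The code of block \<open>l\<close> starts at a pointer stored per superblock plus one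
  stored per block relative to its superblock; the latter is short enough to be kept for every
  block. Length and code together give the identifier.\<close>

lemma big_ident:
  assumes l: "big l" and le: "\<And>x. x \<in> V \<Longrightarrow> l x \<le> n x div 2 ^ be x"
  shows "big (\<lambda>x. ident x (blk x (l x)))"
proof -
  have bw: "big (\<lambda>x. si x - be x)" by (intro big_tsub big_si big_be)
  have S: "big (\<lambda>x. l x div 2 ^ (si x - be x))"
    by (rule big_div[OF l bw]) (use si_le in fastforce)
  have Sle: "l x div 2 ^ (si x - be x) \<le> n x div 2 ^ si x" if "x \<in> V" for x
    using div_le_mono[OF le[OF that], of "2 ^ (si x - be x)"] by (simp add: div_exp_div_exp be_si[OF that])
  have ln: "big (\<lambda>x. len x (blk x (l x)))" by (rule read[OF st_len l]) (use le in auto)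
  let ?s = "\<lambda>x. \<Sum>k<l x div 2 ^ (si x - be x) * 2 ^ (si x - be x). len x (blk x k)"
  let ?r = "\<lambda>x. \<Sum>k=l x div 2 ^ (si x - be x) * 2 ^ (si x - be x)..<l x. len x (blk x k)"
  have s: "big ?s" by (rule read[OF st_super_ptr S]) (use Sle in auto)
  have r: "big ?r" by (rule read[OF st_block_ptr l]) (use le in auto)
  have sr: "?s x + ?r x = (\<Sum>k<l x. len x (blk x k))" for x
    using sum.atLeastLessThan_concat[of 0 "l x div 2 ^ (si x - be x) * 2 ^ (si x - be x)" "l x" "\<lambda>k. len x (blk x k)"]
    by (simp add: atLeast0LessThan)
  have bd: "code_base x + ?s x + ?r x + K * w x < 2 ^ (K * w x)" if "x \<in> V" for x
    using code_read[OF that le[OF that]] len_B[OF that] sr[of x] by linarith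
  have cs: "big (\<lambda>x. code_base x + ?s x)"
  proof (rule big_add[OF big_code_base s])
    show "code_base x + ?s x < 2 ^ (K * w x)" if "x \<in> V" for x using bd[OF that] by linarith
  qed
  have csr: "big (\<lambda>x. code_base x + ?s x + ?r x)"
  proof (rule big_add[OF cs r])
    show "code_base x + ?s x + ?r x < 2 ^ (K * w x)" if "x \<in> V" for x using bd[OF that] by linarith
  qed
  have lnle: "len x (blk x (l x)) \<le> K * w x" if "x \<in> V" for x
    using id_bound[OF that block_in_types] by blast
  have "big (\<lambda>x. read_word (len x (blk x (l x))) (B x) (code_base x + ?s x + ?r x))"
    by (rule big_field[OF cw_w csr ln lnle bd])
  then have e: "big (\<lambda>x. enc x (blk x (l x)))"
    by (rule big_cong[rotated]) (use code_read le sr in \<open>auto simp: add.assoc\<close>)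
  have bd2: "ident x (blk x (l x)) < 2 ^ (K * w x)" if "x \<in> V" for x
  proof -
    have "(ident x (blk x (l x)) + 1) * 1 * 1 \<le> (ident x (blk x (l x)) + 1) * 2 ^ be x * 2 ^ be x"
      by (intro mult_le_mono) auto
    from le_less_trans[OF this ident_less[OF that block_in_types[of "C x" "2 ^ be x" "a x" "l x"]]] show ?thesis by simp
  qed
  have "big (\<lambda>x. 1 * 2 ^ len x (blk x (l x)))"
  proof (rule big_shl[OF cw_w big_1 ln lnle])
    show "(1::nat) * 2 ^ len x (blk x (l x)) < 2 ^ (K * w x)" if "x \<in> V" for x
      using bd2[OF that] unfolding ident_def by linarith
  qed
  then have "big (\<lambda>x. 2 ^ len x (blk x (l x)) + enc x (blk x (l x)))"
    using bd2 unfolding ident_def mult_1 by (intro big_add e)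
  then show ?thesis unfolding ident_def .
qed

lemma big_ident_shift:
  assumes l: "big l" and le: "\<And>x. x \<in> V \<Longrightarrow> l x \<le> n x div 2 ^ be x"
    and t: "big t" and tb: "\<And>x. x \<in> V \<Longrightarrow> t x < 2 ^ be x"
  shows "big (\<lambda>x. ident x (blk x (l x)) * 2 ^ be x + t x)"
    and "x \<in> V \<Longrightarrow> (ident x (blk x (l x)) * 2 ^ be x + t x + 1) * 2 ^ be x < 2 ^ (K * w x)"
proof -
  have 1: "(ident x (blk x (l x)) * 2 ^ be x + t x + 1) * 2 ^ be x < 2 ^ (K * w x)" if "x \<in> V" for x
  proof -
    have "(ident x (blk x (l x)) * 2 ^ be x + t x + 1) * 2 ^ be x \<le> ((ident x (blk x (l x)) + 1) * 2 ^ be x) * 2 ^ be x"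
      using tb[OF that] by (intro mult_le_mono1) simp
    from le_less_trans[OF this ident_less[OF that block_in_types[of "C x" "2 ^ be x" "a x" "l x"]]] show ?thesis .
  qed
  then show "x \<in> V \<Longrightarrow> (ident x (blk x (l x)) * 2 ^ be x + t x + 1) * 2 ^ be x < 2 ^ (K * w x)" .
  have 2: "ident x (blk x (l x)) * 2 ^ be x + t x < 2 ^ (K * w x)" if "x \<in> V" for x
  proof -
    have "(ident x (blk x (l x)) * 2 ^ be x + t x + 1) * 1 \<le> (ident x (blk x (l x)) * 2 ^ be x + t x + 1) * 2 ^ be x"
      by (intro mult_le_mono2) simp
    from le_less_trans[OF this 1[OF that]] show ?thesis by simp
  qed
  have "big (\<lambda>x. ident x (blk x (l x)) * 2 ^ be x)"
  proof (rule big_shl[OF cw_w big_ident[OF l le] big_be be_le])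
    show "ident x (blk x (l x)) * 2 ^ be x < 2 ^ (K * w x)" if "x \<in> V" for x
      using 2[OF that] by (rule le_less_trans[OF le_add1])
  qed
  then show "big (\<lambda>x. ident x (blk x (l x)) * 2 ^ be x + t x)"
    by (rule big_add[OF _ t 2])
qed

abbreviation "sd x t \<equiv> shifted_depth (C x) (a x) (be x) (si x) t"

text \<open>The mark of the superblock selects between a sum of three table entries and an explicit
  entry. Both are values of \<open>shifted_depth\<close>, so results from either kind of superblock
  can be compared.\<close>

lemma big_depth:
  assumes t: "big t" and tn: "\<And>x. x \<in> V \<Longrightarrow> t x \<le> n x"
  shows "big (\<lambda>x. sd x (t x))"
proof -
  have S: "big (\<lambda>x. t x div 2 ^ si x)" by (rule big_div[OF t big_si si_le])
  have l: "big (\<lambda>x. t x div 2 ^ be x)" by (rule big_div[OF t big_be be_le])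
  have m: "big (\<lambda>x. t x mod 2 ^ be x)" by (rule big_mod[OF t big_be be_le])
  have ms: "big (\<lambda>x. t x mod 2 ^ si x)" by (rule big_mod[OF t big_si si_le])
  have Sn: "t x div 2 ^ si x \<le> n x div 2 ^ si x" and ln: "t x div 2 ^ be x \<le> n x div 2 ^ be x" if "x \<in> V" for x
    using div_le_mono[OF tn[OF that]] by auto
  let ?m = "\<lambda>x. dirty_mark (C x) (a x) (si x) (t x div 2 ^ si x)"
  \<comment> \<open>\<open>big_cond\<close> requires both branches to be computable on all of
    \<open>V\<close>; each read that depends on the mark is therefore guarded by this test and
    defaults to 0.\<close>
  let ?c = "\<lambda>x. ?m x = 0"
  have mk: "big ?m" by (rule read[OF st_mark S]) (use Sn in auto)
  have c: "cb ?c" by (rule cb_big_eq[OF mk big_0])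
  have cl: "?c x \<longleftrightarrow> clean (C x) (a x) (si x) (t x div 2 ^ si x)" for x by (simp add: dirty_mark_def)
  have sh: "big (\<lambda>x. if ?c x then super_height (a x) (si x) (t x div 2 ^ si x) else 0)"
    by (rule read_if[OF st_super_height c S]) (use Sn in auto)
  have bh: "big (\<lambda>x. if ?c x then block_height (C x) (a x) (be x) (si x) (t x div 2 ^ be x) else 0)"
    by (rule read_if[OF st_block_height c l]) (use ln in auto)
  let ?i = "\<lambda>x. ident x (blk x (t x div 2 ^ be x)) * 2 ^ be x + t x mod 2 ^ be x"
  have mb: "t x mod 2 ^ be x < 2 ^ be x" for x by (rule mod_less_divisor) simp
  have i: "big ?i" by (rule big_ident_shift(1)[OF l ln m mb])
  have "big (\<lambda>x. if ?c x then type_depth (C x) (be x)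
          (inv_into (types (C x) (2 ^ be x)) (\<lambda>\<tau>. 2 ^ len x \<tau> + enc x \<tau>) (?i x div 2 ^ be x)) (?i x mod 2 ^ be x) else 0)"
  proof (rule read_if[OF st_type_depth c i])
    fix x assume "x \<in> V"
    show "?i x \<in> {(2 ^ len x \<tau> + enc x \<tau>) * 2 ^ be x + t | \<tau> t. \<tau> \<in> types (C x) (2 ^ be x) \<and> t < 2 ^ be x}"
      unfolding ident_def using block_in_types[of "C x" "2 ^ be x" "a x" "t x div 2 ^ be x"] mb[of x] by blast
  qed
  then have td: "big (\<lambda>x. if ?c x then type_depth (C x) (be x) (blk x (t x div 2 ^ be x)) (t x mod 2 ^ be x) else 0)"
    by (rule big_cong[rotated]) (simp add: inv_ident[OF _ block_in_types])
  define r where "r x = (if ?c x then 0 else dirty_rank (C x) (a x) (si x) (t x div 2 ^ si x))" for x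
  have r: "big r"
  proof -
    have "big (\<lambda>x. ?m x - 1)" by (intro big_tsub mk big_1)
    then show ?thesis by (rule big_cong[rotated]) (auto simp: r_def dirty_mark_def)
  qed
  \<comment> \<open>A rank is at most the index of its superblock, which bounds the index into the
    compacted table by \<open>t x\<close>.\<close>
  have rn: "r x \<le> t x div 2 ^ si x" for x
  proof -
    have "card {S'. S' < t x div 2 ^ si x \<and> \<not> clean (C x) (a x) (si x) S'} \<le> card {..<t x div 2 ^ si x}"
      by (rule card_mono) auto
    then show ?thesis by (simp add: r_def dirty_rank_def)
  qed
  have rb: "r x * 2 ^ si x + t x mod 2 ^ si x < 2 ^ (K * w x)" if "x \<in> V" for x
  proof -
    have "r x * 2 ^ si x \<le> t x div 2 ^ si x * 2 ^ si x" using rn by (intro mult_le_mono1)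
    then have "r x * 2 ^ si x + t x mod 2 ^ si x \<le> t x" using div_mult_mod_eq[of "t x" "2 ^ si x"] by linarith
    then show ?thesis using tn[OF that] n_bound[OF that] by linarith
  qed
  have "big (\<lambda>x. r x * 2 ^ si x)"
  proof (rule big_shl[OF cw_w r big_si si_le])
    show "r x * 2 ^ si x < 2 ^ (K * w x)" if "x \<in> V" for x
      using rb[OF that] by (rule le_less_trans[OF le_add1])
  qed
  then have di: "big (\<lambda>x. r x * 2 ^ si x + t x mod 2 ^ si x)" by (rule big_add[OF _ ms rb])
  have "big (\<lambda>x. if \<not> ?c x then dirty_table (C x) (a x) (be x) (si x) (r x * 2 ^ si x + t x mod 2 ^ si x) else 0)"
  proof (rule read_if[OF st_dirty cb_not[OF c] di])
    fix x assume "x \<in> V" "\<not> ?c x"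
    then show "r x * 2 ^ si x + t x mod 2 ^ si x \<in> {dirty_rank (C x) (a x) (si x) (t div 2 ^ si x) * 2 ^ si x + t mod 2 ^ si x | t.
         t \<le> n x \<and> \<not> clean (C x) (a x) (si x) (t div 2 ^ si x)}"
      unfolding cl r_def using tn by (auto simp: dirty_mark_def)
  qed
  then have dt: "big (\<lambda>x. if \<not> ?c x then sd x (t x) else 0)"
    by (rule big_cong[rotated]) (auto simp: r_def cl dirty_table_eq dirty_mark_def)
  have eq: "sd x (t x) = super_height (a x) (si x) (t x div 2 ^ si x) + block_height (C x) (a x) (be x) (si x) (t x div 2 ^ be x)
      + type_depth (C x) (be x) (blk x (t x div 2 ^ be x)) (t x mod 2 ^ be x)" if "x \<in> V" "?c x" for x
  proof (rule shifted_depth_clean[OF be_si[OF that(1)]])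
    show "clean (C x) (a x) (si x) (t x div 2 ^ si x)" using that(2) by (simp only: cl)
    show "0 \<le> height (a x) (t x div 2 ^ si x * 2 ^ si x)"
    proof (rule a_height[OF that(1)])
      show "t x div 2 ^ si x * 2 ^ si x \<le> Suc (n x)"
        using tn[OF that(1)] div_times_less_eq_dividend[of "t x" "2 ^ si x"] by linarith
    qed
  qed
  have le: "(if ?c x then super_height (a x) (si x) (t x div 2 ^ si x) else 0)
      + (if ?c x then block_height (C x) (a x) (be x) (si x) (t x div 2 ^ be x) else 0)
      + (if ?c x then type_depth (C x) (be x) (blk x (t x div 2 ^ be x)) (t x mod 2 ^ be x) else 0) < 2 ^ (K * w x)"
    if "x \<in> V" for x
    using sd_bound[OF that tn[OF that]] eq[OF that] by (cases "?c x") simp_all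
  have "big (\<lambda>x. (if ?c x then super_height (a x) (si x) (t x div 2 ^ si x) else 0)
      + (if ?c x then block_height (C x) (a x) (be x) (si x) (t x div 2 ^ be x) else 0)
      + (if ?c x then type_depth (C x) (be x) (blk x (t x div 2 ^ be x)) (t x mod 2 ^ be x) else 0))"
    by (intro big_add sh bh td) (use le add_lessD1 in blast)+
  then have "big (\<lambda>x. if ?c x then (if ?c x then super_height (a x) (si x) (t x div 2 ^ si x) else 0)
      + (if ?c x then block_height (C x) (a x) (be x) (si x) (t x div 2 ^ be x) else 0)
      + (if ?c x then type_depth (C x) (be x) (blk x (t x div 2 ^ be x)) (t x mod 2 ^ be x) else 0)
      else (if \<not> ?c x then sd x (t x) else 0))"
    by (intro big_cond c dt)
  then show ?thesis by (rule big_cong[rotated]) (use eq in simp)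
qed

end

section \<open>Range minima level by level\<close>

lemma mult_exp_div_exp:
  assumes "p \<le> q" shows "u * 2 ^ p div 2 ^ q = u div (2::nat) ^ (q - p)"
proof -
  have e: "(2::nat) ^ q = 2 ^ p * 2 ^ (q - p)" using assms by (simp flip: power_add)
  show ?thesis unfolding e div_mult2_eq by simp
qed

lemma pred_mult_div:
  assumes "1 \<le> (s::nat)" shows "(Suc c * s - 1) div s = c"
proof -
  have "Suc c * s - 1 = (s - 1) + c * s" using assms by simp
  moreover have "((s - 1) + c * s) div s = c + (s - 1) div s" using assms by (intro div_mult_self1) simp
  ultimately show ?thesis using assms by simp
qed

context index
begin

abbreviation "am x \<equiv> argmin (depth (a x))"

lemma depth_nonneg: "x \<in> V \<Longrightarrow> t \<le> n x \<Longrightarrow> 0 \<le> depth (a x) t"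
  using a_height[of x "Suc t"] by (simp add: depth_def)

lemma big_merge:
  assumes c: "big c" "big c'" and n: "\<And>x. x \<in> V \<Longrightarrow> c x \<le> n x" "\<And>x. x \<in> V \<Longrightarrow> c' x \<le> n x"
  shows "big (\<lambda>x. if depth (a x) (c' x) \<le> depth (a x) (c x) then c' x else c x)"
proof -
  have "big (\<lambda>x. if sd x (c' x) \<le> sd x (c x) then c' x else c x)"
    by (intro big_cond cb_big_le big_depth c n)
  then show ?thesis
    by (rule big_cong[rotated]) (use n depth_nonneg in \<open>simp add: shifted_depth_le_iff\<close>)
qed

text \<open>The identifier of the block and the two offsets are packed into one table index, with
  \<open>be x\<close> bits for each offset.\<close>

lemma big_argmin_block:
  assumes f: "big f" and g: "big g" and fg: "\<And>x. x \<in> V \<Longrightarrow> f x \<le> g x" "\<And>x. x \<in> V \<Longrightarrow> g x \<le> n x"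
    "\<And>x. x \<in> V \<Longrightarrow> f x div 2 ^ be x = g x div 2 ^ be x"
  shows "big (\<lambda>x. am x (f x) (g x))"
proof -
  let ?l = "\<lambda>x. f x div 2 ^ be x"
  have l: "big ?l" by (rule big_div[OF f big_be be_le])
  have ln: "?l x \<le> n x div 2 ^ be x" if "x \<in> V" for x using fg[OF that] by (simp add: div_le_mono)
  have mf: "big (\<lambda>x. f x mod 2 ^ be x)" by (rule big_mod[OF f big_be be_le])
  have mg: "big (\<lambda>x. g x mod 2 ^ be x)" by (rule big_mod[OF g big_be be_le])
  have mb: "t mod 2 ^ be x < 2 ^ be x" for x and t :: nat by (rule mod_less_divisor) simp
  have mle: "f x mod 2 ^ be x \<le> g x mod 2 ^ be x" if "x \<in> V" for x
    using fg(1)[OF that] fg(3)[OF that] by (metis add_le_cancel_left div_mult_mod_eq)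
  let ?j = "\<lambda>x. ident x (blk x (?l x)) * 2 ^ be x + f x mod 2 ^ be x"
  let ?i = "\<lambda>x. ?j x * 2 ^ be x + g x mod 2 ^ be x"
  have j: "big ?j" by (rule big_ident_shift(1)[OF l ln mf mb])
  have jb: "(?j x + 1) * 2 ^ be x < 2 ^ (K * w x)" if "x \<in> V" for x
    by (rule big_ident_shift(2)[OF l ln mf mb that])
  have ib: "?i x < 2 ^ (K * w x)" if "x \<in> V" for x
    using jb[OF that] mb[of "g x" x] by (simp only: distrib_right mult_1)
  have "big (\<lambda>x. ?j x * 2 ^ be x)"
  proof (rule big_shl[OF cw_w j big_be be_le])
    show "?j x * 2 ^ be x < 2 ^ (K * w x)" if "x \<in> V" for x
      using ib[OF that] by (rule le_less_trans[OF le_add1])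
  qed
  then have i: "big ?i" by (rule big_add[OF _ mg ib])
  have "big (\<lambda>x. argmin (depth ((!) (inv_into (types (C x) (2 ^ be x)) (\<lambda>\<tau>. 2 ^ len x \<tau> + enc x \<tau>)
          (?i x div 2 ^ be x div 2 ^ be x)))) (?i x div 2 ^ be x mod 2 ^ be x) (?i x mod 2 ^ be x))"
  proof (rule read[OF st_type_argmin i])
    fix x assume x: "x \<in> V"
    show "?i x \<in> {((2 ^ len x \<tau> + enc x \<tau>) * 2 ^ be x + t) * 2 ^ be x + u | \<tau> t u.
         \<tau> \<in> types (C x) (2 ^ be x) \<and> t < 2 ^ be x \<and> u < 2 ^ be x \<and> t \<le> u}"
      unfolding ident_def using block_in_types[of "C x" "2 ^ be x" "a x" "?l x"] mb[of "f x" x] mb[of "g x" x] mle[OF x] by blast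
  qed
  then have q: "big (\<lambda>x. argmin (depth ((!) (blk x (?l x)))) (f x mod 2 ^ be x) (g x mod 2 ^ be x))"
    by (rule big_cong[rotated]) (simp add: inv_ident[OF _ block_in_types] mb)
  have eq: "am x (f x) (g x) = ?l x * 2 ^ be x + argmin (depth ((!) (blk x (?l x)))) (f x mod 2 ^ be x) (g x mod 2 ^ be x)"
    if "x \<in> V" for x
  proof -
    have "f x = ?l x * 2 ^ be x + f x mod 2 ^ be x" "g x = ?l x * 2 ^ be x + g x mod 2 ^ be x"
      using div_mult_mod_eq[of "f x" "2 ^ be x"] div_mult_mod_eq[of "g x" "2 ^ be x"] fg(3)[OF that] by simp_all
    then show ?thesis using argmin_block[OF mle[OF that] mb C_gt[OF that], of "a x" "?l x"] by simp
  qed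
  have "big (\<lambda>x. ?l x * 2 ^ be x + argmin (depth ((!) (blk x (?l x)))) (f x mod 2 ^ be x) (g x mod 2 ^ be x))"
  proof (rule big_add[OF big_floor[OF f big_be be_le] q])
    fix x assume x: "x \<in> V"
    have "am x (f x) (g x) \<le> n x" using argmin_in[OF fg(1)[OF x], of "depth (a x)"] fg(2)[OF x] by simp
    then show "?l x * 2 ^ be x + argmin (depth ((!) (blk x (?l x)))) (f x mod 2 ^ be x) (g x mod 2 ^ be x) < 2 ^ (K * w x)"
      using eq[OF x] n_bound[OF x] by linarith
  qed
  then show ?thesis by (rule big_cong[rotated]) (use eq in simp)
qed

text \<open>One level of the decomposition: from intervals inside cells of length
  \<open>2 ^ p x\<close> to intervals inside cells of length \<open>2 ^ q x\<close>. It is applied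
  to blocks in superblocks and to superblocks in the array. The interval is cut into an initial
  part, whole cells answered by two sparse-table windows, and a final part.\<close>

lemma big_argmin_level:
  assumes sub: "\<And>f g. big f \<Longrightarrow> big g \<Longrightarrow> (\<And>x. x \<in> V \<Longrightarrow> f x \<le> g x) \<Longrightarrow> (\<And>x. x \<in> V \<Longrightarrow> g x \<le> n x) \<Longrightarrow>
      (\<And>x. x \<in> V \<Longrightarrow> f x div 2 ^ p x = g x div 2 ^ p x) \<Longrightarrow> big (\<lambda>x. am x (f x) (g x))"
    and p: "big p" and q: "big q" and k: "big k"
    and pq: "\<And>x. x \<in> V \<Longrightarrow> p x \<le> q x" and qK: "\<And>x. x \<in> V \<Longrightarrow> q x \<le> K * w x" and kK: "\<And>x. x \<in> V \<Longrightarrow> k x \<le> K * w x"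
    and np: "\<And>x. x \<in> V \<Longrightarrow> n x + 2 ^ p x < 2 ^ (K * w x)"
    and nk: "\<And>x. x \<in> V \<Longrightarrow> (n x + 2) * 2 ^ k x < 2 ^ (K * w x)"
    and st: "stored (\<lambda>x. sparse_cells (n x) (p x) (q x) (k x))
       (\<lambda>x i. sparse (depth (a x)) (p x) (q x) (i div 2 ^ k x) (i mod 2 ^ k x))"
    and lg: "\<And>x m. x \<in> V \<Longrightarrow> 1 \<le> m \<Longrightarrow> m * 2 ^ p x \<le> n x + 1 \<Longrightarrow> m * 2 ^ p x \<le> 2 ^ q x \<Longrightarrow>
       m \<le> n x div 2 ^ si x + 2 ^ (si x - be x) \<and> floor_log m < 2 ^ k x"
    and f: "big f" and g: "big g" and fg: "\<And>x. x \<in> V \<Longrightarrow> f x \<le> g x" "\<And>x. x \<in> V \<Longrightarrow> g x \<le> n x"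
    "\<And>x. x \<in> V \<Longrightarrow> f x div 2 ^ q x = g x div 2 ^ q x"
  shows "big (\<lambda>x. am x (f x) (g x))"
proof -
  have pK: "p x \<le> K * w x" if "x \<in> V" for x using pq[OF that] qK[OF that] by simp
  define cf cg where "cf x = f x div 2 ^ p x" and "cg x = g x div 2 ^ p x" for x
  have bcf: "big cf" unfolding cf_def by (rule big_div[OF f p pK])
  have bcg: "big cg" unfolding cg_def by (rule big_div[OF g p pK])
  have cfg: "cf x \<le> cg x" if "x \<in> V" for x unfolding cf_def cg_def by (rule div_le_mono[OF fg(1)[OF that]])
  have cg1: "cg x * 2 ^ p x \<le> g x" for x unfolding cg_def by (rule div_times_less_eq_dividend)
  have cf1: "cf x * 2 ^ p x \<le> f x" for x unfolding cf_def by (rule div_times_less_eq_dividend)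
  have cf2: "f x < Suc (cf x) * 2 ^ p x" for x
    unfolding cf_def using dividend_less_div_times[of "2 ^ p x" "f x"] by simp
  have cgn: "cg x \<le> n x" if "x \<in> V" for x
    using cg1[of x] fg(2)[OF that] le_trans[of "cg x" "cg x * 2 ^ p x"] by simp
  have cfn: "Suc (cf x) \<le> n x + 1" if "x \<in> V" for x using cfg[OF that] cgn[OF that] by simp
  let ?same = "\<lambda>x. cf x = cg x" let ?mid = "\<lambda>x. Suc (cf x) < cg x"
  have bs: "big (\<lambda>x. Suc (cf x))"
  proof -
    have "cf x + 1 < 2 ^ (K * w x)" if "x \<in> V" for x using cfn[OF that] n_bound[OF that] by linarith
    from big_add[OF bcf big_1 this] show ?thesis by simp
  qed
  have same: "cb ?same" by (rule cb_big_eq[OF bcf bcg])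
  have mid: "cb ?mid" by (rule cb_big_less[OF bs bcg])
  have split: "Suc (cf x) * 2 ^ p x \<le> cg x * 2 ^ p x" if "x \<in> V" "\<not> ?same x" for x
    using cfg[OF that(1)] that(2) by (intro mult_le_mono1) simp
  have e: "big (\<lambda>x. Suc (cf x) * 2 ^ p x)"
  proof (rule big_shl[OF cw_w bs p pK])
    fix x assume x: "x \<in> V"
    have "Suc (cf x) * 2 ^ p x \<le> n x + 2 ^ p x" using cf1[of x] fg[OF x] by simp
    then show "Suc (cf x) * 2 ^ p x < 2 ^ (K * w x)" using np[OF x] by (rule le_less_trans)
  qed
  \<comment> \<open>\<open>g1\<close> ends the initial part and \<open>f3\<close> starts the final
    one. If both ends lie in one cell, either part is the whole interval, so \<open>sub\<close>
    applies in all cases.\<close>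
  define g1 where "g1 x = (if ?same x then g x else Suc (cf x) * 2 ^ p x - 1)" for x
  define f3 where "f3 x = (if ?same x then f x else cg x * 2 ^ p x)" for x
  have g1: "big g1" unfolding g1_def by (intro big_cond same g big_tsub e big_1)
  have f3: "big f3" unfolding f3_def cg_def[of _] by (intro big_cond same[unfolded cg_def] f big_floor g p pK)
  have fg1: "f x \<le> g1 x" "g1 x \<le> g x" "f x div 2 ^ p x = g1 x div 2 ^ p x" if "x \<in> V" for x
  proof -
    show "f x \<le> g1 x" using fg(1)[OF that] less_imp_Suc_add[OF cf2[of x]] by (auto simp: g1_def)
    show "g1 x \<le> g x"
    proof (cases "?same x")
      case False
      have "Suc (cf x) * 2 ^ p x - 1 \<le> g x" using split[OF that False] cg1[of x] by linarith
      then show ?thesis using False by (simp only: g1_def if_False)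
    qed (simp add: g1_def)
    show "f x div 2 ^ p x = g1 x div 2 ^ p x"
    proof (cases "?same x")
      case False
      have "(Suc (cf x) * 2 ^ p x - 1) div 2 ^ p x = cf x" by (rule pred_mult_div) simp
      then show ?thesis using False by (simp add: g1_def cf_def)
    qed (simp add: g1_def cf_def cg_def)
  qed
  have f3g: "f3 x \<le> g x" "f3 x div 2 ^ p x = g x div 2 ^ p x" if "x \<in> V" for x
    using fg(1)[OF that] cg1[of x] by (auto simp: f3_def cf_def cg_def)
  have e1: "big (\<lambda>x. am x (f x) (g1 x))"
    by (rule sub[OF f g1]) (use fg1 fg le_trans in blast)+
  have e3: "big (\<lambda>x. am x (f3 x) (g x))"
    by (rule sub[OF f3 g]) (use f3g fg in blast)+
  define m where "m x = cg x - Suc (cf x)" for x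
  have m: "big m" unfolding m_def by (intro big_tsub bcg bs)
  have base: "u div 2 ^ (q x - p x) = f x div 2 ^ q x" if "x \<in> V" "cf x \<le> u" "u \<le> cg x" for x u
  proof -
    have "cf x div 2 ^ (q x - p x) = f x div 2 ^ q x" "cg x div 2 ^ (q x - p x) = f x div 2 ^ q x"
      using fg(3)[OF that(1)] by (simp_all add: cf_def cg_def div_exp_div_exp pq[OF that(1)])
    then show ?thesis using div_le_mono[OF that(2), of "2 ^ (q x - p x)"] div_le_mono[OF that(3), of "2 ^ (q x - p x)"] by simp
  qed
  have cells: "1 \<le> m x" "m x * 2 ^ p x \<le> n x + 1" "m x * 2 ^ p x \<le> 2 ^ q x" if "x \<in> V" "?mid x" for x
  proof -
    show "1 \<le> m x" using that(2) by (simp add: m_def)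
    have "m x * 2 ^ p x \<le> cg x * 2 ^ p x" unfolding m_def by (intro mult_le_mono1) simp
    then show "m x * 2 ^ p x \<le> n x + 1" using cg1[of x] fg(2)[OF that(1)] by linarith
    have e: "(2::nat) ^ q x = 2 ^ (q x - p x) * 2 ^ p x" using pq[OF that(1)] by (simp flip: power_add)
    have "cg x < Suc (cf x div 2 ^ (q x - p x)) * 2 ^ (q x - p x)"
      using base[OF that(1), of "cg x"] base[OF that(1), of "cf x"] cfg[OF that(1)]
        dividend_less_div_times[of "2 ^ (q x - p x)" "cg x"] by simp
    moreover have "cf x div 2 ^ (q x - p x) * 2 ^ (q x - p x) \<le> cf x" by (rule div_times_less_eq_dividend)
    ultimately have "m x \<le> 2 ^ (q x - p x)" unfolding m_def mult_Suc by linarith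
    then show "m x * 2 ^ p x \<le> 2 ^ q x" unfolding e by (rule mult_le_mono1)
  qed
  \<comment> \<open>Without whole cells in between, the level is 0, which keeps
    \<open>2 ^ h x\<close> and all addresses bounded.\<close>
  define h where "h x = (if ?mid x then floor_log (m x) else 0)" for x
  have h: "big h" unfolding h_def
    by (rule read_if[OF st_log mid m]) (use lg cells in auto)
  have hk: "h x < 2 ^ k x" if "x \<in> V" for x
    using lg[OF that] cells[OF that] by (cases "?mid x") (simp_all add: h_def)
  have hm: "2 ^ h x \<le> m x" if "x \<in> V" "?mid x" for x
    using cells(1)[OF that] that(2) by (simp add: h_def floor_log_exp2_le)
  have h1: "2 ^ h x \<le> n x + 1" if "x \<in> V" for x
    using hm[OF that] cgn[OF that] by (cases "?mid x") (auto simp: m_def h_def)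
  have hK: "h x \<le> K * w x" if "x \<in> V" for x
  proof -
    have "(2::nat) ^ h x < 2 ^ (K * w x)" using h1[OF that] n_bound[OF that] by linarith
    then show ?thesis by simp
  qed
  have "big (\<lambda>x. 1 * 2 ^ h x)"
  proof (rule big_shl[OF cw_w big_1 h hK])
    show "(1::nat) * 2 ^ h x < 2 ^ (K * w x)" if "x \<in> V" for x
      using h1[OF that] n_bound[OF that] by linarith
  qed
  then have h2: "big (\<lambda>x. 2 ^ h x)" by simp
  \<comment> \<open>The start of the enclosing \<open>2 ^ q x\<close> cell is the base of the
    relative table entries and, being at most \<open>n x\<close>, also a valid default
    candidate.\<close>
  define lo where "lo x = f x div 2 ^ q x * 2 ^ q x" for x
  have lo: "big lo" unfolding lo_def by (rule big_floor[OF f q qK])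
  have piece: "big (\<lambda>x. if ?mid x then am x (u x * 2 ^ p x) ((u x + 2 ^ h x) * 2 ^ p x - 1) else lo x)"
    and piece_le: "\<And>x. x \<in> V \<Longrightarrow> (if ?mid x then am x (u x * 2 ^ p x) ((u x + 2 ^ h x) * 2 ^ p x - 1) else lo x) \<le> n x"
    if u: "big u" and un: "\<And>x. x \<in> V \<Longrightarrow> u x \<le> n x + 1"
      and ul: "\<And>x. x \<in> V \<Longrightarrow> ?mid x \<Longrightarrow> cf x \<le> u x \<and> u x + 2 ^ h x \<le> cg x" for u
  proof -
    let ?i = "\<lambda>x. u x * 2 ^ k x + h x"
    have ib: "?i x < 2 ^ (K * w x)" if "x \<in> V" for x
    proof -
      have "?i x \<le> u x * 2 ^ k x + 2 ^ k x" using hk[OF that] by simp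
      also have "\<dots> = (u x + 1) * 2 ^ k x" by simp
      also have "\<dots> \<le> (n x + 2) * 2 ^ k x" using un[OF that] by (intro mult_le_mono1) simp
      finally show ?thesis using nk[OF that] by (rule le_less_trans)
    qed
    have "big (\<lambda>x. u x * 2 ^ k x)"
    proof (rule big_shl[OF cw_w u k kK])
      show "u x * 2 ^ k x < 2 ^ (K * w x)" if "x \<in> V" for x using ib[OF that] by (rule le_less_trans[OF le_add1])
    qed
    then have i: "big ?i" by (rule big_add[OF _ h ib])
    have inn: "(u x + 2 ^ h x) * 2 ^ p x \<le> n x + 1" and cell: "u x * 2 ^ p x div 2 ^ q x = f x div 2 ^ q x"
      "((u x + 2 ^ h x) * 2 ^ p x - 1) div 2 ^ q x = f x div 2 ^ q x"
      and ne: "u x * 2 ^ p x \<le> (u x + 2 ^ h x) * 2 ^ p x - 1" if "x \<in> V" "?mid x" for x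
    proof -
      have "(u x + 2 ^ h x) * 2 ^ p x \<le> cg x * 2 ^ p x" using ul[OF that] by (intro mult_le_mono1) simp
      then have le: "(u x + 2 ^ h x) * 2 ^ p x \<le> g x" using cg1[of x] by (rule le_trans)
      then show "(u x + 2 ^ h x) * 2 ^ p x \<le> n x + 1" using fg(2)[OF that(1)] by simp
      have "u x \<le> cg x" using ul[OF that] by simp
      then show c1: "u x * 2 ^ p x div 2 ^ q x = f x div 2 ^ q x"
        using base[OF that(1), of "u x"] ul[OF that] by (simp add: mult_exp_div_exp pq[OF that(1)])
      have "(1::nat) * 1 \<le> 2 ^ h x * 2 ^ p x" by (intro mult_le_mono) auto
      then show ne: "u x * 2 ^ p x \<le> (u x + 2 ^ h x) * 2 ^ p x - 1" unfolding distrib_right by linarith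
      show "((u x + 2 ^ h x) * 2 ^ p x - 1) div 2 ^ q x = f x div 2 ^ q x"
      proof (rule antisym)
        have "((u x + 2 ^ h x) * 2 ^ p x - 1) div 2 ^ q x \<le> g x div 2 ^ q x" using le by (intro div_le_mono) simp
        then show "((u x + 2 ^ h x) * 2 ^ p x - 1) div 2 ^ q x \<le> f x div 2 ^ q x" using fg(3)[OF that(1)] by simp
        show "f x div 2 ^ q x \<le> ((u x + 2 ^ h x) * 2 ^ p x - 1) div 2 ^ q x"
          unfolding c1[symmetric] by (rule div_le_mono[OF ne])
      qed
    qed
    have s: "big (\<lambda>x. if ?mid x then sparse (depth (a x)) (p x) (q x) (?i x div 2 ^ k x) (?i x mod 2 ^ k x) else 0)"
    proof (rule read_if[OF st mid i])
      fix x assume x: "x \<in> V" "?mid x"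
      have "u x * 2 ^ p x div 2 ^ q x = ((u x + 2 ^ h x) * 2 ^ p x - 1) div 2 ^ q x" using cell[OF x] by simp
      then show "?i x \<in> sparse_cells (n x) (p x) (q x) (k x)"
        unfolding sparse_cells_def using hk[OF x(1)] inn[OF x] by blast
    qed
    have am_in: "am x (u x * 2 ^ p x) ((u x + 2 ^ h x) * 2 ^ p x - 1) \<in> {u x * 2 ^ p x..(u x + 2 ^ h x) * 2 ^ p x - 1}"
      if "x \<in> V" "?mid x" for x by (rule argmin_in[OF ne[OF that]])
    have val: "lo x + (if ?mid x then sparse (depth (a x)) (p x) (q x) (?i x div 2 ^ k x) (?i x mod 2 ^ k x) else 0)
        = (if ?mid x then am x (u x * 2 ^ p x) ((u x + 2 ^ h x) * 2 ^ p x - 1) else lo x)" if "x \<in> V" for x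
    proof (cases "?mid x")
      case True
      have "lo x \<le> u x * 2 ^ p x" unfolding lo_def cell(1)[OF that True, symmetric] by (rule div_times_less_eq_dividend)
      then have "lo x \<le> am x (u x * 2 ^ p x) ((u x + 2 ^ h x) * 2 ^ p x - 1)" using am_in[OF that True] by simp
      moreover have "?i x div 2 ^ k x = u x" "?i x mod 2 ^ k x = h x" using hk[OF that] by simp_all
      ultimately show ?thesis using True by (simp add: sparse_def lo_def cell(1)[OF that True])
    qed simp
    show le: "(if ?mid x then am x (u x * 2 ^ p x) ((u x + 2 ^ h x) * 2 ^ p x - 1) else lo x) \<le> n x" if "x \<in> V" for x
    proof (cases "?mid x")
      case True
      have "am x (u x * 2 ^ p x) ((u x + 2 ^ h x) * 2 ^ p x - 1) \<le> (u x + 2 ^ h x) * 2 ^ p x - 1"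
        using am_in[OF that True] by (simp only: atLeastAtMost_iff)
      also have "\<dots> \<le> n x" using inn[OF that True] by linarith
      finally show ?thesis using True by (simp only: if_True)
    next
      case False
      have "lo x \<le> f x" unfolding lo_def by (rule div_times_less_eq_dividend)
      then show ?thesis using False fg[OF that] by simp
    qed
    have "big (\<lambda>x. lo x + (if ?mid x then sparse (depth (a x)) (p x) (q x) (?i x div 2 ^ k x) (?i x mod 2 ^ k x) else 0))"
    proof (rule big_add[OF lo s])
      fix x assume x: "x \<in> V"
      have "n x < 2 ^ (K * w x)" using n_bound[OF x] by linarith
      then show "lo x + (if ?mid x then sparse (depth (a x)) (p x) (q x) (?i x div 2 ^ k x) (?i x mod 2 ^ k x) else 0) < 2 ^ (K * w x)"
        unfolding val[OF x] by (rule le_less_trans[OF le[OF x]])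
    qed
    then show "big (\<lambda>x. if ?mid x then am x (u x * 2 ^ p x) ((u x + 2 ^ h x) * 2 ^ p x - 1) else lo x)"
      by (rule big_cong[rotated]) (rule val)
  qed
  \<comment> \<open>Start of the window that is flush with the right end; the other window starts at
    \<open>Suc (cf x)\<close>.\<close>
  define v where "v x = cg x - 2 ^ h x" for x
  have v: "big v" unfolding v_def by (intro big_tsub bcg h2)
  have u1: "cf x \<le> Suc (cf x) \<and> Suc (cf x) + 2 ^ h x \<le> cg x" and u2: "cf x \<le> v x \<and> v x + 2 ^ h x \<le> cg x"
    if "x \<in> V" "?mid x" for x
    using hm[OF that] that(2) by (auto simp: m_def v_def)
  have vn: "v x \<le> n x + 1" if "x \<in> V" for x using cgn[OF that] by (simp add: v_def)
  define c1 where "c1 x = (if ?mid x then am x (Suc (cf x) * 2 ^ p x) ((Suc (cf x) + 2 ^ h x) * 2 ^ p x - 1) else lo x)" for x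
  define c2 where "c2 x = (if ?mid x then am x (v x * 2 ^ p x) ((v x + 2 ^ h x) * 2 ^ p x - 1) else lo x)" for x
  have c1: "big c1" unfolding c1_def by (rule piece[OF bs cfn u1])
  have c1n: "c1 x \<le> n x" if "x \<in> V" for x unfolding c1_def by (rule piece_le[OF bs cfn u1 that])
  have c2: "big c2" unfolding c2_def by (rule piece[OF v vn u2])
  have c2n: "c2 x \<le> n x" if "x \<in> V" for x unfolding c2_def by (rule piece_le[OF v vn u2 that])
  define mg where "mg x s t = (if depth (a x) t \<le> depth (a x) s then t else s)" for x s t
  have mgn: "mg x s t \<le> n x" if "s \<le> n x" "t \<le> n x" for x s t using that by (simp add: mg_def)
  have mgm: "mg x (am x r y) (am x r' y') = am x r y'"
    if "r \<le> y" "r' \<le> y'" "r \<le> r'" "y \<le> y'" "r' \<le> Suc y" for x r y r' y'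
    unfolding mg_def by (rule argmin_merge[symmetric, OF that])
  have bmg: "big (\<lambda>x. mg x (s x) (t x))" if "big s" "big t" "\<And>x. x \<in> V \<Longrightarrow> s x \<le> n x" "\<And>x. x \<in> V \<Longrightarrow> t x \<le> n x" for s t
    unfolding mg_def by (rule big_merge[OF that])
  define d1 where "d1 x = am x (f x) (g1 x)" for x
  define d3 where "d3 x = am x (f3 x) (g x)" for x
  have d1n: "d1 x \<le> n x" if "x \<in> V" for x
    using argmin_in[OF fg1(1)[OF that], of "depth (a x)"] fg1(2)[OF that] fg(2)[OF that] by (simp add: d1_def)
  have d3n: "d3 x \<le> n x" if "x \<in> V" for x
    using argmin_in[OF f3g(1)[OF that], of "depth (a x)"] fg(2)[OF that] by (simp add: d3_def)
  have bd1: "big d1" unfolding d1_def by (rule e1)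
  have bd3: "big d3" unfolding d3_def by (rule e3)
  \<comment> \<open>Each merge has the left piece as first argument, as \<open>mg\<close> resolves
    ties in favour of the second.\<close>
  have "big (\<lambda>x. if ?same x then d1 x else if ?mid x then mg x (mg x (d1 x) (mg x (c1 x) (c2 x))) (d3 x) else mg x (d1 x) (d3 x))"
    by (intro big_cond same mid bmg bd1 bd3 c1 c2 mgn d1n d3n c1n c2n)
  then show ?thesis
  proof (rule big_cong[rotated])
    fix x assume x: "x \<in> V"
    let ?s = "2 ^ p x :: nat"
    show "(if ?same x then d1 x else if ?mid x then mg x (mg x (d1 x) (mg x (c1 x) (c2 x))) (d3 x) else mg x (d1 x) (d3 x))
        = am x (f x) (g x)"
    proof (cases "?same x")
      case True
      then show ?thesis by (simp add: d1_def g1_def)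
    next
      case ns: False
      have s1: "1 \<le> ?s" by simp
      have d1e: "d1 x = am x (f x) (Suc (cf x) * ?s - 1)" and d3e: "d3 x = am x (cg x * ?s) (g x)"
        using ns by (simp_all add: d1_def d3_def g1_def f3_def)
      have o1: "f x \<le> Suc (cf x) * ?s - 1" using cf2[of x] by linarith
      have o2: "Suc (cf x) * ?s \<le> cg x * ?s" by (rule split[OF x ns])
      show ?thesis
      proof (cases "?mid x")
        case True
        obtain z where z: "cg x = Suc z" "Suc (cf x) \<le> z" using True by (cases "cg x") auto
        have "h x = floor_log (Suc z - Suc (cf x))" using True z by (simp add: h_def m_def)
        from argmin_sparse[OF z(2) s1 this, of "depth (a x)"]
        have mid: "mg x (c1 x) (c2 x) = am x (Suc (cf x) * ?s) (cg x * ?s - 1)"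
        proof -
          have "v x + 2 ^ h x = cg x" using hm[OF x True] by (simp add: v_def m_def)
          then have "c2 x = am x ((cg x - 2 ^ h x) * ?s) (cg x * ?s - 1)" using True by (simp add: c2_def v_def)
          then show ?thesis
            using \<open>argmin (depth (a x)) (Suc (cf x) * ?s) (Suc z * ?s - 1) = _\<close> True
            unfolding z(1)[symmetric] by (simp add: mg_def c1_def Let_def)
        qed
        have "Suc (cf x) * ?s + 1 * 1 \<le> Suc (cf x) * ?s + (cg x - Suc (cf x)) * ?s"
          using True by (intro add_left_mono mult_le_mono) auto
        also have "\<dots> = cg x * ?s" using True by (simp only: distrib_right[symmetric] le_add_diff_inverse less_imp_le)
        finally have o3: "Suc (cf x) * ?s + 1 \<le> cg x * ?s" by simp
        have "mg x (d1 x) (mg x (c1 x) (c2 x)) = am x (f x) (cg x * ?s - 1)"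
          unfolding mid d1e by (rule mgm) (use o1 o3 cf2[of x] in linarith)+
        moreover have "mg x (am x (f x) (cg x * ?s - 1)) (d3 x) = am x (f x) (g x)"
          unfolding d3e by (rule mgm) (use o1 o2 o3 cf2[of x] cg1[of x] in linarith)+
        ultimately have "mg x (mg x (d1 x) (mg x (c1 x) (c2 x))) (d3 x) = am x (f x) (g x)" by simp
        then show ?thesis using ns True by simp
      next
        case False
        then have cge: "cg x = Suc (cf x)" using ns cfg[OF x] by simp
        have "mg x (d1 x) (d3 x) = am x (f x) (g x)"
          unfolding d1e d3e by (rule mgm) (use o1 cf2[of x] cg1[of x] in \<open>unfold cge, linarith\<close>)+
        then show ?thesis using ns False by simp
      qed
    qed
  qed
qed

text \<open>Two applications of the level lemma on top of the block table. The uppermost cell has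
  length \<open>2 ^ top x\<close>, which exceeds \<open>n x\<close>, and so contains every
  interval.\<close>

lemma big_argmin:
  assumes f: "big f" and g: "big g" and fg: "\<And>x. x \<in> V \<Longrightarrow> f x \<le> g x" "\<And>x. x \<in> V \<Longrightarrow> g x \<le> n x"
  shows "big (\<lambda>x. am x (f x) (g x))"
proof (rule big_argmin_level[OF _ big_si big_top big_kb si_top top_le kb_le n_si n_kb st_high _ f g fg])
  show "f x div 2 ^ top x = g x div 2 ^ top x" if "x \<in> V" for x
    using fg[OF that] n_top[OF that] by simp
next
  fix x m assume x: "x \<in> V" and m: "1 \<le> m" "m * 2 ^ si x \<le> n x + 1"
  have "m \<le> (n x + 1) div 2 ^ si x" using div_le_mono[OF m(2), of "2 ^ si x"] by simp
  also have "\<dots> \<le> n x div 2 ^ si x + 1" by (simp add: div_Suc)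
  also have "\<dots> \<le> n x div 2 ^ si x + 2 ^ (si x - be x)" by simp
  finally have 1: "m \<le> n x div 2 ^ si x + 2 ^ (si x - be x)" .
  have "m * 1 \<le> m * 2 ^ si x" by (intro mult_le_mono2) simp
  moreover have "2 ^ floor_log m \<le> m" using m(1) by (intro floor_log_exp2_le) simp
  ultimately have "(2::nat) ^ floor_log m < 2 ^ 2 ^ kb x" using m(2) high_log[OF x] by linarith
  then show "m \<le> n x div 2 ^ si x + 2 ^ (si x - be x) \<and> floor_log m < 2 ^ kb x" using 1 by simp
next
  fix f g assume f: "big f" and g: "big g" and fg: "\<And>x. x \<in> V \<Longrightarrow> f x \<le> g x" "\<And>x. x \<in> V \<Longrightarrow> g x \<le> n x"
    "\<And>x. x \<in> V \<Longrightarrow> f x div 2 ^ si x = g x div 2 ^ si x"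
  show "big (\<lambda>x. am x (f x) (g x))"
  proof (rule big_argmin_level[OF big_argmin_block big_be big_si big_ka be_si si_le ka_le _ n_ka st_low _ f g fg])
    fix x assume x: "x \<in> V"
    have "(2::nat) ^ be x \<le> 2 ^ si x" using be_si[OF x] by simp
    then show "n x + 2 ^ be x < 2 ^ (K * w x)" using n_si[OF x] by linarith
  next
    fix x and m :: nat assume x: "x \<in> V" and m: "1 \<le> m" "m * 2 ^ be x \<le> 2 ^ si x"
    have "m * 2 ^ be x \<le> 2 ^ (si x - be x) * 2 ^ be x" using m(2) be_si[OF x] by (simp flip: power_add)
    then have 1: "m \<le> 2 ^ (si x - be x)" by simp
    moreover have "2 ^ floor_log m \<le> m" using m(1) by (intro floor_log_exp2_le) simp
    ultimately have "(2::nat) ^ floor_log m \<le> 2 ^ (si x - be x)" by linarith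
    then have "floor_log m \<le> si x - be x" by simp
    then show "m \<le> n x div 2 ^ si x + 2 ^ (si x - be x) \<and> floor_log m < 2 ^ ka x" using 1 low_log[OF x] by simp
  qed
qed

end

section \<open>Layout of the index\<close>

text \<open>The parameters are functions of \<open>lam n\<close>, roughly \<open>lg (lg n)\<close>: blocks of about \<open>sqrt (lg n)\<close>
  positions, superblocks of about \<open>(lg n)^3\<close> positions and codes clipped at about \<open>(lg n)^5\<close>. Then a
  clipped block has fewer than \<open>sqrt n\<close> types for large \<open>n\<close>, so that tables over all types are small.\<close>

definition lam :: "nat \<Rightarrow> nat" where "lam n = (LEAST k. n < 2 ^ 2 ^ k)"
text \<open>Values polynomial in \<open>2 ^ lam n\<close> have a number of bits linear in
  \<open>lam n\<close>. They get fields of \<open>2 ^ mu n\<close> bits, a power of two as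
  \<open>stored\<close> demands, with room for \<open>20 * lam n + 20\<close> bits.\<close>

definition mu :: "nat \<Rightarrow> nat" where "mu n = (LEAST m. 20 * lam n + 20 \<le> 2 ^ m)"
abbreviation "bexp n \<equiv> lam n div 2"
abbreviation "sexp n \<equiv> 3 * lam n"
abbreviation "clip n \<equiv> (2::nat) ^ (5 * lam n + 2)"
abbreviation "tlen n \<equiv> (2::nat) ^ bexp n * (5 * lam n + 3)"

lemma n_less_lam: "n < 2 ^ 2 ^ lam n"
  unfolding lam_def by (rule LeastI[of _ n]) (metis less_exp less_trans)

lemma lam_le: "lam n \<noteq> 0 \<Longrightarrow> 2 ^ 2 ^ (lam n - 1) \<le> n"
  using not_less_Least[of "lam n - 1" "\<lambda>k. n < 2 ^ 2 ^ k"] by (simp add: lam_def)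

lemma mu_ge: "20 * lam n + 20 \<le> 2 ^ mu n"
  unfolding mu_def by (rule LeastI[of _ "20 * lam n + 20"]) (simp add: less_imp_le less_exp)

lemma mu_le: "2 ^ mu n \<le> 40 * lam n + 40"
proof (cases "mu n")
  case (Suc m)
  then have "\<not> 20 * lam n + 20 \<le> 2 ^ m"
    using not_less_Least[of m "\<lambda>m. 20 * lam n + 20 \<le> 2 ^ m"] by (simp add: mu_def)
  then show ?thesis using Suc by simp
qed simp

lemma Suc_lam_le: "lam n + 1 \<le> 2 ^ lam n"
  using less_exp[of "lam n"] by (simp add: Suc_le_eq)

lemma mu_le_exp: "(2::nat) ^ mu n \<le> 40 * 2 ^ lam n"
  using mu_le[of n] Suc_lam_le[of n] by linarith

text \<open>The block length is only about the square root of \<open>2 ^ lam n\<close>; the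
  remaining factor \<open>2 ^ h\<close> absorbs \<open>5 * lam n + 3\<close>.\<close>

lemma tlen_le: "tlen n \<le> 10 * 2 ^ lam n"
proof -
  define h where "h = lam n - bexp n"
  have l: "lam n \<le> 2 * h" unfolding h_def by simp
  have "h + 1 \<le> 2 ^ h" using less_exp[of h] by (simp add: Suc_le_eq)
  then have "5 * lam n + 3 \<le> 10 * 2 ^ h" using l by linarith
  then have "tlen n \<le> 2 ^ bexp n * (10 * 2 ^ h)" by (rule mult_le_mono2)
  also have "\<dots> = 10 * 2 ^ lam n" by (simp add: h_def flip: power_add)
  finally show ?thesis .
qed

lemma tlen_le_poly: "tlen n \<le> 2 ^ (4 * lam n + 2)"
proof -
  have "5 * l + 3 \<le> 2 ^ (3 * l + 2)" for l :: nat
    by (induction l) (auto simp: power_add)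
  then have "tlen n \<le> 2 ^ lam n * 2 ^ (3 * lam n + 2)"
    by (intro mult_le_mono power_increasing) auto
  also have "\<dots> = 2 ^ (4 * lam n + 2)" by (simp flip: power_add)
  finally show ?thesis .
qed

lemma clip_types: "(clip n + 1) ^ 2 ^ bexp n \<le> 2 ^ tlen n"
proof -
  have "clip n + 1 \<le> 2 ^ (5 * lam n + 3)" by (simp add: power_add)
  then have "(clip n + 1) ^ 2 ^ bexp n \<le> (2 ^ (5 * lam n + 3)) ^ 2 ^ bexp n" by (rule power_mono) simp
  also have "\<dots> = 2 ^ tlen n" by (simp add: mult.commute flip: power_mult)
  finally show ?thesis .
qed

lemma clip_gt: "2 ^ bexp n + 2 < clip n"
proof -
  have "(2::nat) ^ bexp n \<le> 2 ^ (5 * lam n)" by (intro power_increasing) auto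
  moreover have "(1::nat) \<le> 2 ^ (5 * lam n)" by simp
  moreover have "clip n = 2 ^ (5 * lam n) * 4" by (simp add: power_add)
  ultimately show ?thesis by linarith
qed

section \<open>Block codes and the regions of the index\<close>

definition block_code :: "nat \<Rightarrow> (nat list \<Rightarrow> nat) \<Rightarrow> (nat list \<Rightarrow> nat) \<Rightarrow> bool" where
  "block_code n len enc \<longleftrightarrow>
    (\<forall>\<tau>\<in>types (clip n) (2 ^ bexp n). len \<tau> \<le> cost \<tau> + (bexp n + 1) \<and> len \<tau> \<le> tlen n \<and> enc \<tau> < 2 ^ len \<tau>) \<and>
    inj_on (\<lambda>\<tau>. 2 ^ len \<tau> + enc \<tau>) (types (clip n) (2 ^ bexp n))"

text \<open>Fixed once per \<open>n\<close> and independent of the array, hence so are the tables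
  over types. Any choice will do, since codes are decoded by table lookup.\<close>

definition tcode :: "nat \<Rightarrow> (nat list \<Rightarrow> nat) \<times> (nat list \<Rightarrow> nat)" where
  "tcode n = (SOME p. block_code n (fst p) (snd p))"

abbreviation "tl_len n \<equiv> fst (tcode n)"
abbreviation "tl_enc n \<equiv> snd (tcode n)"

lemma tcode:
  shows "\<And>\<tau>. \<tau> \<in> types (clip n) (2 ^ bexp n) \<Longrightarrow>
      tl_len n \<tau> \<le> cost \<tau> + (bexp n + 1) \<and> tl_len n \<tau> \<le> tlen n \<and> tl_enc n \<tau> < 2 ^ tl_len n \<tau>"
    and "inj_on (\<lambda>\<tau>. 2 ^ tl_len n \<tau> + tl_enc n \<tau>) (types (clip n) (2 ^ bexp n))"
proof -
  have "(2::nat) ^ bexp n + 1 \<le> 2 ^ (bexp n + 1)" by simp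
  from block_encoding[OF this clip_types] obtain len enc where "block_code n len enc"
    unfolding block_code_def by blast
  then have "block_code n (fst (len, enc)) (snd (len, enc))" by simp
  then have "block_code n (tl_len n) (tl_enc n)" unfolding tcode_def by (rule someI)
  then show
    "\<And>\<tau>. \<tau> \<in> types (clip n) (2 ^ bexp n) \<Longrightarrow>
      tl_len n \<tau> \<le> cost \<tau> + (bexp n + 1) \<and> tl_len n \<tau> \<le> tlen n \<and> tl_enc n \<tau> < 2 ^ tl_len n \<tau>"
    "inj_on (\<lambda>\<tau>. 2 ^ tl_len n \<tau> + tl_enc n \<tau>) (types (clip n) (2 ^ bexp n))"
    unfolding block_code_def by blast+
qed

definition blocklen :: "nat \<Rightarrow> (nat \<Rightarrow> nat) \<Rightarrow> nat \<Rightarrow> nat" where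
  "blocklen n A l = tl_len n (block (clip n) (2 ^ bexp n) (code n A) l)"

lemma blocklen_le: "blocklen n A l \<le> tlen n"
  using tcode(1)[OF block_in_types] by (simp add: blocklen_def)

definition decode_type :: "nat \<Rightarrow> nat \<Rightarrow> nat list" where
  "decode_type n = inv_into (types (clip n) (2 ^ bexp n)) (\<lambda>\<tau>. 2 ^ tl_len n \<tau> + tl_enc n \<tau>)"

text \<open>A triple \<open>(s, N, f)\<close> is a table of \<open>N\<close> cells of
  \<open>2 ^ s\<close> bits. Numbers of the order of \<open>n\<close> get
  \<open>2 ^ (lam n + 3)\<close> bits, but occur only per superblock (times
  \<open>2 ^ (lam n + 1)\<close> levels in the upper sparse table) or per position of a superblock
  that is not clean. Everything stored per block or per type is polynomial in
  \<open>2 ^ lam n\<close> and gets \<open>2 ^ mu n\<close> bits.\<close>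

definition tabs :: "nat \<Rightarrow> (nat \<Rightarrow> nat) \<Rightarrow> (nat \<times> nat \<times> (nat \<Rightarrow> nat)) list" where
  "tabs n A =
    (let a = code n A; be = bexp n; si = sexp n; C = clip n; sm = mu n; lg = lam n + 3;
         nb = n div 2 ^ be + 1; ns = n div 2 ^ si + 1
     in [(lg, ns, \<lambda>S. \<Sum>k<S * 2 ^ (si - be). blocklen n A k),
         (sm, nb, \<lambda>l. \<Sum>k=l div 2 ^ (si - be) * 2 ^ (si - be)..<l. blocklen n A k),
         (sm, nb, blocklen n A),
         (lg, ns, dirty_mark C a si),
         (lg, ns, super_height a si),
         (sm, nb, block_height C a be si),
         (sm, 2 ^ (tlen n + 1) * 2 ^ be, \<lambda>i. type_depth C be (decode_type n (i div 2 ^ be)) (i mod 2 ^ be)),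
         (sm, 2 ^ (tlen n + 1) * 2 ^ be * 2 ^ be,
            \<lambda>i. argmin (depth ((!) (decode_type n (i div 2 ^ be div 2 ^ be)))) (i div 2 ^ be mod 2 ^ be) (i mod 2 ^ be)),
         (lg, dirty_count C a si n * 2 ^ si, dirty_table C a be si),
         (sm, n div 2 ^ si + 2 ^ (si - be) + 1, floor_log),
         (sm, nb * 2 ^ sm, \<lambda>i. sparse (depth a) be si (i div 2 ^ sm) (i mod 2 ^ sm)),
         (lg, ns * 2 ^ (lam n + 1), \<lambda>i. sparse (depth a) si (2 ^ (lam n + 2)) (i div 2 ^ (lam n + 1)) (i mod 2 ^ (lam n + 1)))])"

lemma length_tabs: "length (tabs n A) = 12"
  by (simp add: tabs_def Let_def)

definition blockstream :: "nat \<Rightarrow> (nat \<Rightarrow> nat) \<Rightarrow> bool list" where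
  "blockstream n A = stream (blocklen n A) (\<lambda>l. tl_enc n (block (clip n) (2 ^ bexp n) (code n A) l)) (n div 2 ^ bexp n + 1)"

definition lens :: "nat \<Rightarrow> nat \<Rightarrow> (nat \<Rightarrow> nat) \<Rightarrow> nat list" where
  "lens F n A = F # 19 * F # map (\<lambda>(s, N, f). N * 2 ^ s) (tabs n A) @ [length (blockstream n A)]"

text \<open>Region 0 is the width marker, region 1 this header, regions 2 to 13 are the tables and
  region 14 the block codes. The fields from 6 on are the starts of regions 2 to 14, whence
  \<open>k - 4\<close>.\<close>

definition param :: "nat \<Rightarrow> nat \<Rightarrow> (nat \<Rightarrow> nat) \<Rightarrow> nat \<Rightarrow> nat" where
  "param F n A k = (if k < 6 then [bexp n, sexp n, 2 ^ (lam n + 2), mu n, lam n + 1, lam n + 3] ! k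
     else region_base (lens F n A) (k - 4))"

definition index_bits :: "nat \<Rightarrow> nat \<Rightarrow> nat \<Rightarrow> (nat \<Rightarrow> nat) \<Rightarrow> bool list list" where
  "index_bits p F n A = map (\<lambda>q. q = p) [0..<F] # table F 19 (param F n A)
     # map (\<lambda>(s, N, f). table (2 ^ s) N f) (tabs n A) @ [blockstream n A]"

lemma map_length_index_bits: "map length (index_bits p F n A) = lens F n A"
  by (simp add: index_bits_def lens_def case_prod_beta)

lemma length_index_bits: "length (index_bits p F n A) = 15"
  by (simp add: index_bits_def length_tabs)

lemma nth_index_bits: "k < 12 \<Longrightarrow> tabs n A ! k = (s, N, f) \<Longrightarrow> index_bits p F n A ! (k + 2) = table (2 ^ s) N f"
  by (simp add: index_bits_def nth_append length_tabs)

lemma index_bits_stream: "index_bits p F n A ! 14 = blockstream n A"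
  by (simp add: index_bits_def nth_append length_tabs numeral_eq_Suc)

lemma length_concat_index_bits:
  "length (concat (index_bits p F n A)) = 20 * F + (\<Sum>(s, N, f)\<leftarrow>tabs n A. N * 2 ^ s) + length (blockstream n A)"
  unfolding length_concat map_length_index_bits by (simp add: lens_def)

lemma length_blockstream: "length (blockstream n A) = (\<Sum>l\<le>n div 2 ^ bexp n. blocklen n A l)"
  by (simp add: blockstream_def length_stream lessThan_Suc_atMost)

lemma dirty_rank_le: "dirty_rank C a si S \<le> S"
proof -
  have "card {S'. S' < S \<and> \<not> clean C a si S'} \<le> card {..<S}" by (rule card_mono) auto
  then show ?thesis by (simp add: dirty_rank_def)
qed

lemma exp_bounds:
  shows "2 ^ bexp n \<le> (2::nat) ^ 2 ^ lam n" and "2 ^ sexp n \<le> (2::nat) ^ (3 * 2 ^ lam n)"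
    and "2 ^ mu n \<le> (2::nat) ^ (6 + 2 ^ lam n)" and "2 ^ (lam n + 3) \<le> (2::nat) ^ (3 + 2 ^ lam n)"
proof -
  have l: "lam n \<le> 2 ^ lam n" using Suc_lam_le[of n] by simp
  show "2 ^ bexp n \<le> (2::nat) ^ 2 ^ lam n" "2 ^ sexp n \<le> (2::nat) ^ (3 * 2 ^ lam n)"
    "2 ^ (lam n + 3) \<le> (2::nat) ^ (3 + 2 ^ lam n)"
    using l by (intro power_increasing; linarith)+
  have "2 ^ mu n \<le> (64::nat) * 2 ^ lam n" using mu_le_exp[of n] by linarith
  also have "\<dots> = 2 ^ (6 + lam n)" by (simp add: power_add)
  also have "\<dots> \<le> 2 ^ (6 + 2 ^ lam n)" using l by (intro power_increasing) auto
  finally show "2 ^ mu n \<le> (2::nat) ^ (6 + 2 ^ lam n)" .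
qed

lemma sum_list_le_length_mult:
  "(\<And>q. q \<in> set xs \<Longrightarrow> q \<le> b) \<Longrightarrow> sum_list xs \<le> length xs * (b::nat)"
  by (induction xs) (auto simp: add_mono)

text \<open>A coarse bound, polynomial in \<open>n\<close>, which serves to fit addresses into a
  constant number of words. The 13 counts twelve tables and the stream of block codes.\<close>

lemma index_bits_bound:
  "(\<Sum>(s, N, f)\<leftarrow>tabs n A. N * 2 ^ s) + length (blockstream n A) \<le> 13 * 2 ^ (40 * 2 ^ lam n)"
proof -
  define Z where "Z = (2::nat) ^ lam n"
  have Z: "1 \<le> Z" by (simp add: Z_def)
  note e = exp_bounds[of n, folded Z_def]
  have n1: "n div m + 1 \<le> 2 ^ Z" for m
    using n_less_lam[of n] div_le_dividend[of n m] unfolding Z_def by linarith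
  have tl: "(2::nat) ^ (tlen n + 1) \<le> 2 ^ (10 * Z + 1)"
    using tlen_le[of n] unfolding Z_def by (intro power_increasing) auto
  have up: "x * y \<le> 2 ^ (i + j)" if "x \<le> 2 ^ i" "y \<le> 2 ^ j" for x y i j :: nat
    using mult_le_mono[OF that] by (simp add: power_add)
  have fin: "x \<le> 2 ^ (40 * Z)" if "x \<le> 2 ^ i" "i \<le> 40 * Z" for x i :: nat
    using that power_increasing[OF that(2), of "2::nat"] by linarith
  have kb: "(2::nat) ^ (lam n + 1) \<le> 2 ^ (3 + Z)" 
    using Suc_lam_le[of n] unfolding Z_def by (intro power_increasing) auto
  have "dirty_count (clip n) (code n A) (sexp n) n \<le> 2 ^ Z"
    unfolding dirty_count_def using dirty_rank_le le_trans n1[of "2 ^ sexp n"] by (metis Suc_eq_plus1)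
  note dc = this
  have s3: "n div 2 ^ sexp n + 2 ^ (sexp n - bexp n) + 1 \<le> 2 ^ (1 + 3 * Z)"
  proof -
    have "(2::nat) ^ (sexp n - bexp n) \<le> 2 ^ sexp n" by (intro power_increasing) auto
    moreover have "(2::nat) ^ Z \<le> 2 ^ (3 * Z)" by (intro power_increasing) auto
    moreover have "(2::nat) ^ (1 + 3 * Z) = 2 * 2 ^ (3 * Z)" by simp
    ultimately show ?thesis using n1[of "2 ^ sexp n"] e(2) by linarith
  qed
  have st: "length (blockstream n A) \<le> 2 ^ (Z + 10 * Z)"
  proof -
    have "length (blockstream n A) \<le> (\<Sum>l\<le>n div 2 ^ bexp n. tlen n)"
      unfolding length_blockstream by (intro sum_mono blocklen_le)
    also have "\<dots> = (n div 2 ^ bexp n + 1) * tlen n" by simp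
    also have "\<dots> \<le> 2 ^ (Z + 10 * Z)"
      by (intro up n1) (metis Z_def less_exp less_imp_le le_less_trans tlen_le)
    finally show ?thesis .
  qed
  have "(\<Sum>(s, N, f)\<leftarrow>tabs n A. N * 2 ^ s) \<le> 12 * 2 ^ (40 * Z)"
  proof -
    have "q \<le> 2 ^ (40 * Z)" if "q \<in> set (map (\<lambda>(s, N, f). N * 2 ^ s) (tabs n A))" for q
    proof -
      from that consider "q = (n div 2 ^ sexp n + 1) * 2 ^ (lam n + 3)" | "q = (n div 2 ^ bexp n + 1) * 2 ^ mu n"
        | "q = 2 ^ (tlen n + 1) * 2 ^ bexp n * 2 ^ mu n" | "q = 2 ^ (tlen n + 1) * 2 ^ bexp n * 2 ^ bexp n * 2 ^ mu n"
        | "q = dirty_count (clip n) (code n A) (sexp n) n * 2 ^ sexp n * 2 ^ (lam n + 3)"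
        | "q = (n div 2 ^ sexp n + 2 ^ (sexp n - bexp n) + 1) * 2 ^ mu n"
        | "q = (n div 2 ^ bexp n + 1) * 2 ^ mu n * 2 ^ mu n"
        | "q = (n div 2 ^ sexp n + 1) * 2 ^ (lam n + 1) * 2 ^ (lam n + 3)"
        by (simp only: tabs_def Let_def list.map prod.case list.set insert_iff empty_iff) blast
      then show ?thesis
      proof cases
        case 1 show ?thesis unfolding 1 by (rule fin, rule up[OF n1 e(4)]) (use Z in simp)
      next
        case 2 show ?thesis unfolding 2 by (rule fin, rule up[OF n1 e(3)]) (use Z in simp)
      next
        case 3 show ?thesis unfolding 3 by (rule fin, rule up[OF up[OF tl e(1)] e(3)]) (use Z in simp)
      next
        case 4 show ?thesis unfolding 4 by (rule fin, rule up[OF up[OF up[OF tl e(1)] e(1)] e(3)]) (use Z in simp)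
      next
        case 5 show ?thesis unfolding 5 by (rule fin, rule up[OF up[OF dc e(2)] e(4)]) (use Z in simp)
      next
        case 6 show ?thesis unfolding 6 by (rule fin, rule up[OF s3 e(3)]) (use Z in simp)
      next
        case 7 show ?thesis unfolding 7 by (rule fin, rule up[OF up[OF n1 e(3)] e(3)]) (use Z in simp)
      next
        case 8 show ?thesis unfolding 8 by (rule fin, rule up[OF up[OF n1 kb] e(4)]) (use Z in simp)
      qed
    qed
    then have "sum_list (map (\<lambda>(s, N, f). N * 2 ^ s) (tabs n A)) \<le> length (map (\<lambda>(s, N, f). N * 2 ^ s) (tabs n A)) * 2 ^ (40 * Z)"
      by (rule sum_list_le_length_mult)
    then show ?thesis by (simp add: length_tabs)
  qed
  moreover have "length (blockstream n A) \<le> 2 ^ (40 * Z)" by (rule fin[OF st]) simp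
  ultimately show ?thesis unfolding Z_def by simp
qed

text \<open>The 21 stands for marker and header, 20 fields of width at most \<open>x\<close>, and
  for one more \<open>x\<close> as slack behind the index.\<close>

lemma mult_less_exp: "10 \<le> x \<Longrightarrow> 21 * x < 2 ^ (x - 1)" for x :: nat
proof (induction x rule: dec_induct)
  case (step m)
  then have "21 * Suc m < 2 * 2 ^ (m - 1)" by simp
  also have "\<dots> = 2 ^ (Suc m - 1)" using step by (simp flip: power_Suc)
  finally show ?case .
qed simp

section \<open>Initial registers as digits of the inputs\<close>

lemma nth_concat_equal_length:
  "(\<And>xs. xs \<in> set xss \<Longrightarrow> length xs = K) \<Longrightarrow> q < length xss \<Longrightarrow> k < K \<Longrightarrow> concat xss ! (q * K + k) = xss ! q ! k"
proof (induction xss arbitrary: q)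
  case (Cons xs xss)
  then show ?case by (cases q) (auto simp: nth_append)
qed simp

lemma init_regs_dg:
  assumes "q < length xs" "k < K"
  shows "init_regs w K xs (1 + q * K + k) = dg w k (xs ! q)"
proof -
  have len: "length (concat (map (to_words w K) xs)) = length xs * K"
    by (induction xs) (simp_all add: to_words_def)
  have "q * K + k < Suc q * K" using assms(2) by simp
  also have "\<dots> \<le> length xs * K" using assms(1) by (intro mult_le_mono1) simp
  finally have lt: "q * K + k < length xs * K" .
  have "concat (map (to_words w K) xs) ! (q * K + k) = map (to_words w K) xs ! q ! k"
    by (rule nth_concat_equal_length) (use assms in \<open>auto simp: to_words_def\<close>)
  also have "\<dots> = dg w k (xs ! q)" using assms by (simp add: to_words_def dg_def)
  finally show ?thesis using lt len by (simp add: init_regs_def)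
qed

lemma init_regs_0: "init_regs w K xs 0 = w"
  by (simp add: init_regs_def)

text \<open>For \<open>n \<ge> 2\<close>, \<open>2 ^ lam n\<close> is lg n up to a constant factor,
  so \<open>Kw\<close> says that \<open>K\<close> words hold numbers polynomial in \<open>n\<close>.
  The factor 200 is generous; most bounds below get by with \<open>100 * 2 ^ lam n\<close>
  bits.\<close>

locale word_setting =
  fixes w :: "nat \<Rightarrow> nat" and K :: nat
  assumes w_ge: "1 \<le> n \<Longrightarrow> 1 \<le> w n" and K_ge: "1 \<le> K" and Kw: "1 \<le> n \<Longrightarrow> 200 * 2 ^ lam n \<le> K * w n"
begin

text \<open>The width is a power of two announced by a marker bit in the first word, provided that
  this power fits into a word. Otherwise \<open>w n \<le> lam n + 7\<close>, and a full number takes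
  at most \<open>K * (lam n + 7)\<close> bits, which is short enough for a header field.\<close>

definition width :: "nat \<Rightarrow> nat" where
  "width n = (if lam n + 7 < w n then 2 ^ (lam n + 7) else K * w n)"

definition start :: "nat \<Rightarrow> nat" where
  "start n = (if lam n + 7 < w n then lam n + 6 else 0)"

definition index_of :: "nat \<Rightarrow> (nat \<Rightarrow> nat) \<Rightarrow> bool list" where
  "index_of n A = concat (index_bits (start n) (width n) n A)"

definition queries :: "(nat \<times> (nat \<Rightarrow> nat) \<times> nat \<times> nat) set" where
  "queries = {(n, A, i, j). 1 \<le> n \<and> bij_betw A {1..n} {1..n} \<and> 1 \<le> i \<and> i \<le> j \<and> j \<le> n}"

abbreviation "qn x \<equiv> fst x"
abbreviation "qA x \<equiv> fst (snd x)"
abbreviation "qi x \<equiv> fst (snd (snd x))"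
abbreviation "qj x \<equiv> snd (snd (snd x))"

lemma queryD: "x \<in> queries \<Longrightarrow> 1 \<le> qn x \<and> bij_betw (qA x) {1..qn x} {1..qn x} \<and> 1 \<le> qi x \<and> qi x \<le> qj x \<and> qj x \<le> qn x"
  by (auto simp: queries_def)

lemma width_ge: "1 \<le> n \<Longrightarrow> 128 * 2 ^ lam n \<le> width n"
  using Kw[of n] by (auto simp: width_def power_add)

lemma width_le: "1 \<le> n \<Longrightarrow> width n \<le> K * w n"
  using Kw[of n] by (auto simp: width_def power_add)

text \<open>Needed twice: with \<open>x = K * w n\<close> for addresses in the index, and with
  \<open>x = width n\<close> for the entries of the header.\<close>

lemma length_index_of_less:
  assumes "1 \<le> n" "128 * 2 ^ lam n \<le> x" "width n \<le> x"
  shows "length (index_of n A) + x < 2 ^ x"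
proof -
  have Z: "1 \<le> (2::nat) ^ lam n" by simp
  have "length (index_of n A) \<le> 20 * width n + 13 * 2 ^ (40 * 2 ^ lam n)"
    unfolding index_of_def length_concat_index_bits using index_bits_bound[of n A] by linarith
  moreover have "13 * (2::nat) ^ (40 * 2 ^ lam n) \<le> 2 ^ (x - 1)"
  proof -
    have "13 * (2::nat) ^ (40 * 2 ^ lam n) \<le> 2 ^ 4 * 2 ^ (40 * 2 ^ lam n)" by simp
    also have "\<dots> = 2 ^ (4 + 40 * 2 ^ lam n)" by (simp add: power_add)
    also have "\<dots> \<le> 2 ^ (x - 1)" using assms(2) Z by (intro power_increasing; linarith)
    finally show ?thesis .
  qed
  moreover have "21 * x < 2 ^ (x - 1)" using assms(2) Z by (intro mult_less_exp) linarith
  moreover have "(2::nat) ^ (x - 1) + 2 ^ (x - 1) = 2 ^ x"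
    using assms(2) Z by (cases x) auto
  ultimately show ?thesis using assms(3) by linarith
qed

lemma power_bounds:
  assumes "1 \<le> n" "e \<le> 100 * 2 ^ lam n"
  shows "e \<le> K * w n" and "2 ^ e < (2::nat) ^ (K * w n)"
proof -
  have "e < K * w n" using Kw[OF assms(1)] assms(2) one_le_power[of "2::nat" "lam n"] by linarith
  then show "e \<le> K * w n" "2 ^ e < (2::nat) ^ (K * w n)" by simp_all
qed

sublocale ram queries "\<lambda>x. w (qn x)" qn "\<lambda>x. index_of (qn x) (qA x)" qA
  "\<lambda>x. init_regs (w (qn x)) K [qn x, qi x, qj x]" "3 * K + 1" K
  by unfold_locales (use w_ge K_ge queryD init_regs_words in auto)

lemma big_input:
  assumes "q < 3"
  shows "big (\<lambda>x. [qn x, qi x, qj x] ! q)"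
proof (rule bigI)
  fix x assume x: "x \<in> queries"
  have "[qn x, qi x, qj x] ! q \<le> qn x" using queryD[OF x] assms by (auto simp: less_Suc_eq numeral_eq_Suc)
  also have "qn x < 2 ^ 2 ^ lam (qn x)" by (rule n_less_lam)
  also have "\<dots> < 2 ^ (K * w (qn x))" using queryD[OF x] by (intro power_bounds(2)) auto
  finally show "[qn x, qi x, qj x] ! q < 2 ^ (K * w (qn x))" .
next
  fix k assume k: "k < K"
  have "1 + q * K + k < 3 * K + 1"
  proof -
    have "Suc q * K \<le> 3 * K" using assms by (intro mult_le_mono1) simp
    then show ?thesis using k unfolding mult_Suc by linarith
  qed
  from cw_inp[OF this] show "cw (\<lambda>x. dg (w (qn x)) k ([qn x, qi x, qj x] ! q))"
    by (rule cw_cong[rotated]) (rule init_regs_dg, use assms k in simp_all)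
qed

lemma cw_word_size: "cw (\<lambda>x. w (qn x))"
  using cw_inp[of 0] by (simp add: init_regs_0)

lemma region_0_nth:
  assumes "1 \<le> n" "q < width n"
  shows "q < length (index_of n A) \<and> index_of n A ! q = (q = start n)"
  using assms unfolding index_of_def index_bits_def by (simp add: nth_append)

lemma start_less:
  assumes "1 \<le> n" shows "start n < w n" "start n < width n"
  using w_ge[OF assms] K_ge width_ge[OF assms] Suc_lam_le[of n] by (auto simp: start_def split: if_splits)

lemma big_width: "big (\<lambda>x. width (qn x))"
proof (rule big_field_width[OF cw_word_size, of "\<lambda>x. start (qn x)"])
  fix x assume "x \<in> queries"
  then have n: "1 \<le> qn x" using queryD by blast
  have "\<forall>q<start (qn x). \<not> index_of (qn x) (qA x) ! q"
  proof (intro allI impI)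
    fix q assume "q < start (qn x)"
    then show "\<not> index_of (qn x) (qA x) ! q"
      using region_0_nth[OF n, of q "qA x"] start_less(2)[OF n] by simp
  qed
  then show "start (qn x) < w (qn x) \<and> start (qn x) < length (index_of (qn x) (qA x)) \<and>
      index_of (qn x) (qA x) ! start (qn x) \<and> (\<forall>q<start (qn x). \<not> index_of (qn x) (qA x) ! q)"
    using region_0_nth[OF n, of "start (qn x)" "qA x"] start_less[OF n] by blast
  show "1 \<le> start (qn x) \<and> start (qn x) + 1 < w (qn x) \<and> width (qn x) = 2 ^ (start (qn x) + 1)
      \<or> start (qn x) = 0 \<and> width (qn x) = K * w (qn x)"
    by (auto simp: start_def width_def power_add)
qed

lemma index_of_less: "x \<in> queries \<Longrightarrow> length (index_of (qn x) (qA x)) + K * w (qn x) < 2 ^ (K * w (qn x))"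
proof -
  assume "x \<in> queries"
  then have n: "1 \<le> qn x" using queryD by blast
  show ?thesis
    by (rule length_index_of_less[OF n _ width_le[OF n]]) (use Kw[OF n] in linarith)
qed

lemma region_base_le:
  assumes "k < 15"
  shows "region_base (lens (width n) n A) k + lens (width n) n A ! k \<le> length (index_of n A)"
proof -
  have "k < length (index_bits (start n) (width n) n A)" using assms by (simp add: length_index_bits)
  note k = this
  from region_within[OF k] show ?thesis
    using nth_map[OF k, of length] unfolding index_of_def map_length_index_bits by simp
qed

lemma param_less:
  assumes n: "1 \<le> n" and k: "k < 19"
  shows "param (width n) n A k < 2 ^ width n"
proof (cases "k < 6")
  case True
  have "param (width n) n A k < 128 * 2 ^ lam n"
  proof -
    have "k \<in> {0,1,2,3,4,5}" using True by auto
    moreover have "mu n < 128 * 2 ^ lam n" using mu_le_exp[of n] less_exp[of "mu n"] by linarith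
    ultimately show ?thesis using Suc_lam_le[of n] by (auto simp: param_def power_add)
  qed
  also have "\<dots> \<le> width n" by (rule width_ge[OF n])
  also have "\<dots> < 2 ^ width n" by (rule less_exp)
  finally show ?thesis .
next
  case False
  have "region_base (lens (width n) n A) (k - 4) \<le> length (index_of n A)"
  proof -
    have "k - 4 < 15" using k by linarith
    from region_base_le[OF this, of n A] show ?thesis by linarith
  qed
  moreover have "length (index_of n A) + width n < 2 ^ width n"
    by (rule length_index_of_less[OF n width_ge[OF n]]) simp
  ultimately show ?thesis using False by (simp add: param_def)
qed

lemma big_param:
  assumes k: "k < 19"
  shows "big (\<lambda>x. param (width (qn x)) (qn x) (qA x) k)"
proof -
  have bd: "Suc k * width (qn x) + K * w (qn x) < 2 ^ (K * w (qn x))" if x: "x \<in> queries" for x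
  proof -
    have n: "1 \<le> qn x" using queryD[OF x] by blast
    have "Suc k * width (qn x) \<le> 20 * width (qn x)" using k by (intro mult_le_mono1) simp
    also have "\<dots> \<le> length (index_of (qn x) (qA x))"
      unfolding index_of_def length_concat_index_bits by simp
    finally show ?thesis using index_of_less[OF x] by linarith
  qed
  have a: "big (\<lambda>x. Suc k * width (qn x))"
  proof (rule big_mult_const[OF big_width])
    show "Suc k * width (qn x) < 2 ^ (K * w (qn x))" if "x \<in> queries" for x
      using bd[OF that] by (rule le_less_trans[OF le_add1])
  qed
  have "big (\<lambda>x. read_word (width (qn x)) (index_of (qn x) (qA x)) (Suc k * width (qn x)))"
    by (rule big_field[OF cw_word_size a big_width _ bd]) (use width_le queryD in blast)
  then show ?thesis
  proof (rule big_cong[rotated])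
    fix x assume "x \<in> queries"
    then have n: "1 \<le> qn x" using queryD by blast
    let ?F = "width (qn x)" let ?Rs = "index_bits (start (qn x)) ?F (qn x) (qA x)"
    have r: "?Rs ! 1 = table ?F 19 (param ?F (qn x) (qA x))" by (simp add: index_bits_def)
    have "k * ?F + ?F \<le> 19 * ?F"
      using mult_le_mono1[of "Suc k" 19 ?F] k by simp
    then have "k * ?F + ?F \<le> length (?Rs ! 1)" unfolding r length_table .
    moreover have "1 < length ?Rs" unfolding length_index_bits by simp
    ultimately have "read_word ?F (concat ?Rs) (region_base (map length ?Rs) 1 + k * ?F) = read_word ?F (?Rs ! 1) (k * ?F)"
      by (intro read_region)
    moreover have "region_base (map length ?Rs) 1 = ?F"
      unfolding map_length_index_bits by (simp add: region_base_def lens_def)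
    moreover have "read_word ?F (?Rs ! 1) (k * ?F) = param ?F (qn x) (qA x) k"
      unfolding r using k param_less[OF n k] by (simp add: read_table take_bit_nat_eq_self_iff)
    ultimately show "read_word ?F (index_of (qn x) (qA x)) (Suc k * ?F) = param ?F (qn x) (qA x) k"
      by (simp add: index_of_def)
  qed
qed

text \<open>Table \<open>k\<close> is region \<open>k + 2\<close>, and its start is header field
  \<open>k + 6\<close>. With the addressing settled here, a table only needs its cell width, an
  index bound and a value bound.\<close>

lemma stored_tab:
  assumes k: "k < 12" and s: "big (\<lambda>x. fst (tabs (qn x) (qA x) ! k))"
    and sb: "\<And>x. x \<in> queries \<Longrightarrow> 2 ^ fst (tabs (qn x) (qA x) ! k) \<le> 40 * (2::nat) ^ lam (qn x)"
    and I: "\<And>x i. x \<in> queries \<Longrightarrow> i \<in> I x \<Longrightarrow> i < fst (snd (tabs (qn x) (qA x) ! k))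
      \<and> f x i = snd (snd (tabs (qn x) (qA x) ! k)) i \<and> f x i < 2 ^ 2 ^ fst (tabs (qn x) (qA x) ! k)"
  shows "stored I f"
  unfolding stored_def
proof (intro exI conjI ballI)
  show "big (\<lambda>x. param (width (qn x)) (qn x) (qA x) (k + 6))" by (rule big_param) (use k in simp)
  show "big (\<lambda>x. fst (tabs (qn x) (qA x) ! k))" by (rule s)
  fix x assume x: "x \<in> queries"
  have n: "1 \<le> qn x" using queryD[OF x] by blast
  obtain e N g where t: "tabs (qn x) (qA x) ! k = (e, N, g)" by (cases "tabs (qn x) (qA x) ! k") auto
  let ?F = "width (qn x)" let ?Rs = "index_bits (start (qn x)) ?F (qn x) (qA x)"
  have p: "param ?F (qn x) (qA x) (k + 6) = region_base (map length ?Rs) (k + 2)"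
    unfolding map_length_index_bits by (simp add: param_def)
  have r: "?Rs ! (k + 2) = table (2 ^ e) N g" by (rule nth_index_bits[OF k t])
  have len: "region_base (map length ?Rs) (k + 2) + N * 2 ^ e \<le> length (index_of (qn x) (qA x))"
    using region_within[of "k + 2" ?Rs] k unfolding r length_table index_of_def length_index_bits by simp
  have e: "2 ^ e \<le> 40 * (2::nat) ^ lam (qn x)" using sb[OF x] t by simp
  show "2 ^ fst (tabs (qn x) (qA x) ! k) \<le> K * w (qn x)" using sb[OF x] Kw[OF n] by linarith
  then show "fst (tabs (qn x) (qA x) ! k) \<le> K * w (qn x)"
    using less_exp[of "fst (tabs (qn x) (qA x) ! k)"] by linarith
  show "param ?F (qn x) (qA x) (k + 6) \<le> length (index_of (qn x) (qA x))" using len p by simp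
  fix i assume i: "i \<in> I x"
  have iN: "i < N" and fi: "f x i = g i" "f x i < 2 ^ 2 ^ e" using I[OF x i] t by auto
  have "Suc i * 2 ^ e \<le> N * 2 ^ e" using iN by (intro mult_le_mono1) simp
  then have il: "i * 2 ^ e + 2 ^ e \<le> N * 2 ^ e" by simp
  show "param ?F (qn x) (qA x) (k + 6) + i * 2 ^ fst (tabs (qn x) (qA x) ! k) \<le> length (index_of (qn x) (qA x))"
    using len il p t by simp
  have "i * 2 ^ e + 2 ^ e \<le> length (?Rs ! (k + 2))" unfolding r length_table by (rule il)
  moreover have "k + 2 < length ?Rs" unfolding length_index_bits using k by simp
  ultimately have "read_word (2 ^ e) (concat ?Rs) (region_base (map length ?Rs) (k + 2) + i * 2 ^ e) = read_word (2 ^ e) (?Rs ! (k + 2)) (i * 2 ^ e)"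
    by (intro read_region)
  also have "\<dots> = f x i" unfolding r using iN fi by (simp add: read_table take_bit_nat_eq_self_iff)
  finally show "read_word (2 ^ fst (tabs (qn x) (qA x) ! k)) (index_of (qn x) (qA x))
      (param ?F (qn x) (qA x) (k + 6) + i * 2 ^ fst (tabs (qn x) (qA x) ! k)) = f x i"
    using t p by (simp add: index_of_def)
qed

end

lemma sparse_cells_bounds:
  assumes "i \<in> sparse_cells n p q ka"
  shows "i < (n div 2 ^ p + 1) * 2 ^ ka"
    and "sparse d p q (i div 2 ^ ka) (i mod 2 ^ ka) < 2 ^ q"
    and "sparse d p q (i div 2 ^ ka) (i mod 2 ^ ka) \<le> n"
proof -
  obtain u k where i: "i = u * 2 ^ ka + k" and k: "k < 2 ^ ka" and un: "(u + 2 ^ k) * 2 ^ p \<le> n + 1"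
    and cell: "u * 2 ^ p div 2 ^ q = ((u + 2 ^ k) * 2 ^ p - 1) div 2 ^ q"
    using assms unfolding sparse_cells_def by blast
  have dm: "i div 2 ^ ka = u" "i mod 2 ^ ka = k" using k by (simp_all add: i)
  have "(1::nat) * 1 \<le> 2 ^ k * 2 ^ p" by (intro mult_le_mono) auto
  then have lt: "u * 2 ^ p + 1 \<le> (u + 2 ^ k) * 2 ^ p" unfolding distrib_right by linarith
  then have "u * 2 ^ p \<le> n" using un by linarith
  from div_le_mono[OF this, of "2 ^ p"] have "u \<le> n div 2 ^ p" by simp
  then have "(u + 1) * 2 ^ ka \<le> (n div 2 ^ p + 1) * 2 ^ ka" by (intro mult_le_mono1) simp
  then show "i < (n div 2 ^ p + 1) * 2 ^ ka" using k unfolding i distrib_right by linarith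
  have "u * 2 ^ p \<le> (u + 2 ^ k) * 2 ^ p - 1" using lt by linarith
  from argmin_in[OF this, of d]
  have am: "argmin d (u * 2 ^ p) ((u + 2 ^ k) * 2 ^ p - 1) \<le> (u + 2 ^ k) * 2 ^ p - 1"
    by (simp only: atLeastAtMost_iff)
  show "sparse d p q (i div 2 ^ ka) (i mod 2 ^ ka) \<le> n"
    unfolding dm sparse_def using am un by linarith
  have "(u + 2 ^ k) * 2 ^ p - 1 < u * 2 ^ p div 2 ^ q * 2 ^ q + 2 ^ q"
    unfolding cell using dividend_less_div_times[of "2 ^ q" "(u + 2 ^ k) * 2 ^ p - 1"] by (simp add: add.commute)
  then show "sparse d p q (i div 2 ^ ka) (i mod 2 ^ ka) < 2 ^ q"
    unfolding dm sparse_def using am zero_less_power[of "2::nat" q] by linarith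
qed

section \<open>Contents and field widths of the twelve tables\<close>

context word_setting
begin

lemma stored_small:
  assumes k: "k < 12" and e: "\<And>n A. fst (tabs n A ! k) = mu n"
    and I: "\<And>x i. x \<in> queries \<Longrightarrow> i \<in> I x \<Longrightarrow> i < fst (snd (tabs (qn x) (qA x) ! k))
      \<and> f x i = snd (snd (tabs (qn x) (qA x) ! k)) i \<and> f x i < 2 ^ (20 * lam (qn x) + 20)"
  shows "stored I f"
proof (rule stored_tab[OF k])
  show "big (\<lambda>x. fst (tabs (qn x) (qA x) ! k))" unfolding e using big_param[of 3] by (simp add: param_def)
  show "2 ^ fst (tabs (qn x) (qA x) ! k) \<le> 40 * (2::nat) ^ lam (qn x)" for x unfolding e by (rule mu_le_exp)
  fix x i assume xi: "x \<in> queries" "i \<in> I x"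
  have "f x i < 2 ^ (20 * lam (qn x) + 20)" using I[OF xi] by blast
  also have "\<dots> \<le> 2 ^ 2 ^ mu (qn x)" using mu_ge[of "qn x"] by (rule power_increasing) simp
  finally show "i < fst (snd (tabs (qn x) (qA x) ! k))
      \<and> f x i = snd (snd (tabs (qn x) (qA x) ! k)) i \<and> f x i < 2 ^ 2 ^ fst (tabs (qn x) (qA x) ! k)"
    unfolding e using I[OF xi] by blast
qed

lemma stored_large:
  assumes k: "k < 12" and e: "\<And>n A. fst (tabs n A ! k) = lam n + 3"
    and I: "\<And>x i. x \<in> queries \<Longrightarrow> i \<in> I x \<Longrightarrow> i < fst (snd (tabs (qn x) (qA x) ! k))
      \<and> f x i = snd (snd (tabs (qn x) (qA x) ! k)) i \<and> f x i < 2 ^ (8 * 2 ^ lam (qn x))"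
  shows "stored I f"
proof (rule stored_tab[OF k])
  show "big (\<lambda>x. fst (tabs (qn x) (qA x) ! k))" unfolding e using big_param[of 5] by (simp add: param_def)
  show "2 ^ fst (tabs (qn x) (qA x) ! k) \<le> 40 * (2::nat) ^ lam (qn x)" for x unfolding e by (simp add: power_add)
  fix x i assume xi: "x \<in> queries" "i \<in> I x"
  have "(2::nat) ^ (lam (qn x) + 3) = 8 * 2 ^ lam (qn x)" by (simp add: power_add)
  then show "i < fst (snd (tabs (qn x) (qA x) ! k))
      \<and> f x i = snd (snd (tabs (qn x) (qA x) ! k)) i \<and> f x i < 2 ^ 2 ^ fst (tabs (qn x) (qA x) ! k)"
    unfolding e using I[OF xi] by simp
qed

lemma n_le_exp: "m \<le> n + 1 \<Longrightarrow> m < 2 ^ (8 * 2 ^ lam n)"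
proof -
  assume "m \<le> n + 1"
  then have "m \<le> 2 ^ 2 ^ lam n" using n_less_lam[of n] by linarith
  also have "\<dots> < (2::nat) ^ (8 * 2 ^ lam n)" by (intro power_strict_increasing) auto
  finally show ?thesis .
qed

lemma shifted_depth_less:
  assumes "t \<le> n"
  shows "shifted_depth (clip n) (code n A) (bexp n) (sexp n) t < 2 ^ (8 * 2 ^ lam n)"
proof -
  have l: "lam n + 1 \<le> 2 ^ lam n" by (rule Suc_lam_le)
  have e1: "(2::nat) ^ sexp n * clip n = 2 ^ (8 * lam n + 2)" by (simp flip: power_add)
  have e2: "(2::nat) ^ bexp n * clip n \<le> 2 ^ (8 * lam n + 2)"
    unfolding power_add[symmetric] by (rule power_increasing) auto
  have "shifted_depth (clip n) (code n A) (bexp n) (sexp n) t \<le> n + 1 + 2 ^ sexp n * clip n + 2 ^ bexp n * clip n"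
    using depth_code_bounds[OF assms, of A] unfolding shifted_depth_def by linarith
  also have "\<dots> \<le> 2 ^ 2 ^ lam n + 2 ^ (8 * lam n + 3)"
    using e1 e2 n_less_lam[of n] by (simp add: power_add)
  also have "\<dots> \<le> 2 ^ (8 * 2 ^ lam n - 1) + 2 ^ (8 * 2 ^ lam n - 2)"
    using l by (intro add_mono power_increasing) auto
  also have "\<dots> < 2 ^ (8 * 2 ^ lam n - 1) + 2 ^ (8 * 2 ^ lam n - 1)"
    using l by (intro add_strict_left_mono power_strict_increasing) auto
  also have "\<dots> = 2 ^ Suc (8 * 2 ^ lam n - 1)" by (simp only: power_Suc mult_2)
  also have "Suc (8 * 2 ^ lam n - 1) = 8 * 2 ^ lam n" using l by simp
  finally show ?thesis .
qed

lemma mult_tlen_less: "m \<le> n \<Longrightarrow> m * tlen n < 2 ^ (8 * 2 ^ lam n)"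
proof -
  assume m: "m \<le> n"
  have "10 * 2 ^ lam n \<le> (2::nat) ^ 4 * 2 ^ 2 ^ lam n"
    using less_exp[of "2 ^ lam n"] by (intro mult_le_mono) auto
  then have "tlen n \<le> 2 ^ (4 + 2 ^ lam n)" unfolding power_add using tlen_le[of n] by linarith
  then have "m * tlen n \<le> 2 ^ 2 ^ lam n * 2 ^ (4 + 2 ^ lam n)"
    using m n_less_lam[of n] by (intro mult_le_mono) auto
  also have "\<dots> = 2 ^ (4 + 2 * 2 ^ lam n)" by (simp flip: power_add)
  also have "\<dots> < 2 ^ (8 * 2 ^ lam n)" by (intro power_strict_increasing) (simp_all add: less_le_trans[of _ "6 * 1"] Suc_le_eq)
  finally show ?thesis .
qed

lemma small_less: "(v::nat) \<le> 2 ^ (8 * lam n + 4) \<Longrightarrow> v < 2 ^ (20 * lam n + 20)"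
  by (erule le_less_trans) (simp add: power_strict_increasing)

lemma nth_tabs:
  "tabs n A ! 0 = (lam n + 3, n div 2 ^ sexp n + 1, \<lambda>S. \<Sum>k<S * 2 ^ (sexp n - bexp n). blocklen n A k)"
  "tabs n A ! 1 = (mu n, n div 2 ^ bexp n + 1,
     \<lambda>l. \<Sum>k=l div 2 ^ (sexp n - bexp n) * 2 ^ (sexp n - bexp n)..<l. blocklen n A k)"
  "tabs n A ! 2 = (mu n, n div 2 ^ bexp n + 1, blocklen n A)"
  "tabs n A ! 3 = (lam n + 3, n div 2 ^ sexp n + 1, dirty_mark (clip n) (code n A) (sexp n))"
  "tabs n A ! 4 = (lam n + 3, n div 2 ^ sexp n + 1, super_height (code n A) (sexp n))"
  "tabs n A ! 5 = (mu n, n div 2 ^ bexp n + 1, block_height (clip n) (code n A) (bexp n) (sexp n))"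
  "tabs n A ! 6 = (mu n, 2 ^ (tlen n + 1) * 2 ^ bexp n,
     \<lambda>i. type_depth (clip n) (bexp n) (decode_type n (i div 2 ^ bexp n)) (i mod 2 ^ bexp n))"
  "tabs n A ! 7 = (mu n, 2 ^ (tlen n + 1) * 2 ^ bexp n * 2 ^ bexp n,
     \<lambda>i. argmin (depth ((!) (decode_type n (i div 2 ^ bexp n div 2 ^ bexp n)))) (i div 2 ^ bexp n mod 2 ^ bexp n) (i mod 2 ^ bexp n))"
  "tabs n A ! 8 = (lam n + 3, dirty_count (clip n) (code n A) (sexp n) n * 2 ^ sexp n, dirty_table (clip n) (code n A) (bexp n) (sexp n))"
  "tabs n A ! 9 = (mu n, n div 2 ^ sexp n + 2 ^ (sexp n - bexp n) + 1, floor_log)"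
  "tabs n A ! 10 = (mu n, (n div 2 ^ bexp n + 1) * 2 ^ mu n,
     \<lambda>i. sparse (depth (code n A)) (bexp n) (sexp n) (i div 2 ^ mu n) (i mod 2 ^ mu n))"
  "tabs n A ! 11 = (lam n + 3, (n div 2 ^ sexp n + 1) * 2 ^ (lam n + 1),
     \<lambda>i. sparse (depth (code n A)) (sexp n) (2 ^ (lam n + 2)) (i div 2 ^ (lam n + 1)) (i mod 2 ^ (lam n + 1)))"
  by (simp_all add: tabs_def Let_def numeral_eq_Suc del: power_Suc)

lemma stored_0: "stored (\<lambda>x. {..qn x div 2 ^ sexp (qn x)})
    (\<lambda>x S. \<Sum>k<S * 2 ^ (sexp (qn x) - bexp (qn x)). blocklen (qn x) (qA x) k)"
proof (rule stored_large[of 0], goal_cases)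
  case (3 x S)
  have "S * 2 ^ (sexp (qn x) - bexp (qn x)) \<le> S * 2 ^ sexp (qn x)" by (intro mult_le_mono2 power_increasing) auto
  also have "\<dots> \<le> qn x div 2 ^ sexp (qn x) * 2 ^ sexp (qn x)" using 3 by (intro mult_le_mono1) simp
  also have "\<dots> \<le> qn x" by (rule div_times_less_eq_dividend)
  finally have "S * 2 ^ (sexp (qn x) - bexp (qn x)) * tlen (qn x) < 2 ^ (8 * 2 ^ lam (qn x))" by (rule mult_tlen_less)
  moreover have "(\<Sum>k<S * 2 ^ (sexp (qn x) - bexp (qn x)). blocklen (qn x) (qA x) k) \<le> S * 2 ^ (sexp (qn x) - bexp (qn x)) * tlen (qn x)"
    using sum_mono[of "{..<S * 2 ^ (sexp (qn x) - bexp (qn x))}" "blocklen (qn x) (qA x)" "\<lambda>_. tlen (qn x)"]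
    by (simp add: blocklen_le)
  ultimately show ?case unfolding nth_tabs using 3 by (auto intro: le_less_trans)
qed (simp_all add: nth_tabs)

lemma stored_1: "stored (\<lambda>x. {..qn x div 2 ^ bexp (qn x)})
    (\<lambda>x l. \<Sum>k=l div 2 ^ (sexp (qn x) - bexp (qn x)) * 2 ^ (sexp (qn x) - bexp (qn x))..<l. blocklen (qn x) (qA x) k)"
proof (rule stored_small[of 1], goal_cases)
  case (3 x l)
  let ?m = "2 ^ (sexp (qn x) - bexp (qn x)) :: nat"
  have "(\<Sum>k=l div ?m * ?m..<l. blocklen (qn x) (qA x) k) \<le> (\<Sum>k=l div ?m * ?m..<l. tlen (qn x))"
    by (intro sum_mono blocklen_le)
  \<comment> \<open>Only blocks of the same superblock are counted, which keeps relative pointers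
    polynomial in \<open>2 ^ lam (qn x)\<close>.\<close>
  also have "\<dots> = (l mod ?m) * tlen (qn x)" by (simp add: minus_div_mult_eq_mod)
  also have "\<dots> \<le> 2 ^ sexp (qn x) * 2 ^ (4 * lam (qn x) + 2)"
  proof (intro mult_le_mono tlen_le_poly)
    have "l mod ?m < ?m" by simp
    also have "?m \<le> 2 ^ sexp (qn x)" by (intro power_increasing) auto
    finally show "l mod ?m \<le> 2 ^ sexp (qn x)" by simp
  qed
  also have "\<dots> \<le> 2 ^ (8 * lam (qn x) + 4)" unfolding power_add[symmetric] by (rule power_increasing) auto
  finally have "(\<Sum>k=l div ?m * ?m..<l. blocklen (qn x) (qA x) k) < 2 ^ (20 * lam (qn x) + 20)" by (rule small_less)
  then show ?case unfolding nth_tabs using 3 by (auto simp: less_Suc_eq_le)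
qed (simp, simp only: nth_tabs fst_conv)

lemma stored_2: "stored (\<lambda>x. {..qn x div 2 ^ bexp (qn x)}) (\<lambda>x l. blocklen (qn x) (qA x) l)"
proof (rule stored_small[of 2], goal_cases)
  case (3 x l)
  have "blocklen (qn x) (qA x) l \<le> 2 ^ (4 * lam (qn x) + 2)" using blocklen_le tlen_le_poly by (rule le_trans)
  also have "\<dots> \<le> 2 ^ (8 * lam (qn x) + 4)" by (rule power_increasing) auto
  finally have "blocklen (qn x) (qA x) l < 2 ^ (20 * lam (qn x) + 20)" by (rule small_less)
  then show ?case unfolding nth_tabs using 3 by (auto simp: less_Suc_eq_le)
qed (simp, simp only: nth_tabs fst_conv)

lemma stored_3: "stored (\<lambda>x. {..qn x div 2 ^ sexp (qn x)}) (\<lambda>x S. dirty_mark (clip (qn x)) (code (qn x) (qA x)) (sexp (qn x)) S)"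
proof (rule stored_large[of 3], goal_cases)
  case (3 x S)
  have "dirty_mark (clip (qn x)) (code (qn x) (qA x)) (sexp (qn x)) S \<le> S + 1"
    using dirty_rank_le[of "clip (qn x)" "code (qn x) (qA x)" "sexp (qn x)" S] by (simp add: dirty_mark_def)
  also have "\<dots> \<le> qn x + 1" using le_trans[OF 3(2)[unfolded atMost_iff] div_le_dividend] by simp
  finally have "dirty_mark (clip (qn x)) (code (qn x) (qA x)) (sexp (qn x)) S < 2 ^ (8 * 2 ^ lam (qn x))" by (rule n_le_exp)
  then show ?case unfolding nth_tabs using 3 by (auto simp: less_Suc_eq_le)
qed (simp, simp only: nth_tabs fst_conv)

lemma stored_4: "stored (\<lambda>x. {..qn x div 2 ^ sexp (qn x)}) (\<lambda>x S. super_height (code (qn x) (qA x)) (sexp (qn x)) S)"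
proof (rule stored_large[of 4], goal_cases)
  case (3 x S)
  have "S * 2 ^ sexp (qn x) \<le> qn x div 2 ^ sexp (qn x) * 2 ^ sexp (qn x)" using 3 by (intro mult_le_mono1) simp
  also have "\<dots> \<le> qn x" by (rule div_times_less_eq_dividend)
  finally have "S * 2 ^ sexp (qn x) \<le> Suc (qn x)" by simp
  from height_code_bounds[OF this, of "qA x"] have "super_height (code (qn x) (qA x)) (sexp (qn x)) S \<le> qn x + 1"
    unfolding super_height_def by linarith
  then have "super_height (code (qn x) (qA x)) (sexp (qn x)) S < 2 ^ (8 * 2 ^ lam (qn x))" by (rule n_le_exp)
  then show ?case unfolding nth_tabs using 3 by (auto simp: less_Suc_eq_le)
qed (simp, simp only: nth_tabs fst_conv)

lemma stored_5: "stored (\<lambda>x. {l. l \<le> qn x div 2 ^ bexp (qn x)})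
    (\<lambda>x l. block_height (clip (qn x)) (code (qn x) (qA x)) (bexp (qn x)) (sexp (qn x)) l)"
proof (rule stored_small[of 5], goal_cases)
  case (3 x l)
  have "block_height (clip (qn x)) (code (qn x) (qA x)) (bexp (qn x)) (sexp (qn x)) l
      \<le> 2 ^ sexp (qn x) + 2 ^ sexp (qn x) * clip (qn x)" by (rule block_height_le) simp
  also have "(2::nat) ^ sexp (qn x) * clip (qn x) = 2 ^ (8 * lam (qn x) + 2)" by (simp flip: power_add)
  also have "2 ^ sexp (qn x) + (2::nat) ^ (8 * lam (qn x) + 2) \<le> 2 ^ (8 * lam (qn x) + 2) + 2 ^ (8 * lam (qn x) + 2)"
    by (intro add_right_mono power_increasing) auto
  also have "\<dots> \<le> 2 ^ (8 * lam (qn x) + 4)" by (simp add: power_add)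
  finally have "block_height (clip (qn x)) (code (qn x) (qA x)) (bexp (qn x)) (sexp (qn x)) l < 2 ^ (20 * lam (qn x) + 20)"
    by (rule small_less)
  then show ?case unfolding nth_tabs using 3 by (auto simp: less_Suc_eq_le)
qed (simp, simp only: nth_tabs fst_conv)

lemma ident_bound:
  assumes "\<tau> \<in> types (clip n) (2 ^ bexp n)"
  shows "2 ^ tl_len n \<tau> + tl_enc n \<tau> + 1 \<le> 2 ^ (tlen n + 1)"
proof -
  have "2 ^ tl_len n \<tau> + tl_enc n \<tau> + 1 \<le> 2 ^ tl_len n \<tau> + 2 ^ tl_len n \<tau>" using tcode(1)[OF assms] by simp
  also have "\<dots> \<le> 2 ^ tlen n + 2 ^ tlen n" using tcode(1)[OF assms] by (intro add_mono power_increasing) auto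
  finally show ?thesis by simp
qed

lemma stored_6: "stored (\<lambda>x. {(2 ^ tl_len (qn x) \<tau> + tl_enc (qn x) \<tau>) * 2 ^ bexp (qn x) + t | \<tau> t.
      \<tau> \<in> types (clip (qn x)) (2 ^ bexp (qn x)) \<and> t < 2 ^ bexp (qn x)})
    (\<lambda>x i. type_depth (clip (qn x)) (bexp (qn x)) (decode_type (qn x) (i div 2 ^ bexp (qn x))) (i mod 2 ^ bexp (qn x)))"
proof (rule stored_small[of 6], goal_cases)
  case (3 x i)
  then obtain \<tau> t where i: "i = (2 ^ tl_len (qn x) \<tau> + tl_enc (qn x) \<tau>) * 2 ^ bexp (qn x) + t"
    and \<tau>: "\<tau> \<in> types (clip (qn x)) (2 ^ bexp (qn x))" and t: "t < 2 ^ bexp (qn x)" by blast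
  have "(2 ^ tl_len (qn x) \<tau> + tl_enc (qn x) \<tau> + 1) * 2 ^ bexp (qn x) \<le> 2 ^ (tlen (qn x) + 1) * 2 ^ bexp (qn x)"
    by (rule mult_le_mono1[OF ident_bound[OF \<tau>]])
  then have "i < 2 ^ (tlen (qn x) + 1) * 2 ^ bexp (qn x)" using t unfolding i distrib_right by linarith
  moreover have "type_depth (clip (qn x)) (bexp (qn x)) (decode_type (qn x) (i div 2 ^ bexp (qn x))) (i mod 2 ^ bexp (qn x)) < 2 ^ (20 * lam (qn x) + 20)"
  proof (rule small_less)
    have "i mod 2 ^ bexp (qn x) < 2 ^ bexp (qn x)" by simp
    moreover have "(2::nat) ^ bexp (qn x) \<le> 2 ^ (8 * lam (qn x) + 1)" by (intro power_increasing) auto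
    moreover have "(2::nat) ^ bexp (qn x) * clip (qn x) \<le> 2 ^ (8 * lam (qn x) + 2)"
      unfolding power_add[symmetric] by (intro power_increasing) auto
    moreover have "(2::nat) ^ (8 * lam (qn x) + 2) = 4 * 2 ^ (8 * lam (qn x))" "(2::nat) ^ (8 * lam (qn x) + 1) = 2 * 2 ^ (8 * lam (qn x))"
      "(2::nat) ^ (8 * lam (qn x) + 4) = 16 * 2 ^ (8 * lam (qn x))" "(1::nat) \<le> 2 ^ (8 * lam (qn x))" by (simp_all add: power_add)
    ultimately show "type_depth (clip (qn x)) (bexp (qn x)) (decode_type (qn x) (i div 2 ^ bexp (qn x))) (i mod 2 ^ bexp (qn x)) \<le> 2 ^ (8 * lam (qn x) + 4)"
      using type_depth_le[of "clip (qn x)" "bexp (qn x)" "decode_type (qn x) (i div 2 ^ bexp (qn x))" "i mod 2 ^ bexp (qn x)"] by linarith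
  qed
  ultimately show ?case by (simp only: nth_tabs fst_conv snd_conv simp_thms)
qed (simp, simp only: nth_tabs fst_conv)

lemma stored_7: "stored (\<lambda>x. {((2 ^ tl_len (qn x) \<tau> + tl_enc (qn x) \<tau>) * 2 ^ bexp (qn x) + t) * 2 ^ bexp (qn x) + u | \<tau> t u.
      \<tau> \<in> types (clip (qn x)) (2 ^ bexp (qn x)) \<and> t < 2 ^ bexp (qn x) \<and> u < 2 ^ bexp (qn x) \<and> t \<le> u})
    (\<lambda>x i. argmin (depth ((!) (decode_type (qn x) (i div 2 ^ bexp (qn x) div 2 ^ bexp (qn x)))))
      (i div 2 ^ bexp (qn x) mod 2 ^ bexp (qn x)) (i mod 2 ^ bexp (qn x)))"
proof (rule stored_small[of 7], goal_cases)
  case (3 x i)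
  then obtain \<tau> t u where i: "i = ((2 ^ tl_len (qn x) \<tau> + tl_enc (qn x) \<tau>) * 2 ^ bexp (qn x) + t) * 2 ^ bexp (qn x) + u"
    and \<tau>: "\<tau> \<in> types (clip (qn x)) (2 ^ bexp (qn x))" and t: "t < 2 ^ bexp (qn x)" "u < 2 ^ bexp (qn x)" "t \<le> u" by blast
  let ?v = "2 ^ tl_len (qn x) \<tau> + tl_enc (qn x) \<tau>" and ?b = "(2::nat) ^ bexp (qn x)"
  have "(?v + 1) * ?b \<le> 2 ^ (tlen (qn x) + 1) * ?b" by (rule mult_le_mono1[OF ident_bound[OF \<tau>]])
  then have "?v * ?b + t + 1 \<le> 2 ^ (tlen (qn x) + 1) * ?b" using t unfolding distrib_right by linarith
  then have "(?v * ?b + t + 1) * ?b \<le> 2 ^ (tlen (qn x) + 1) * ?b * ?b" by (rule mult_le_mono1)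
  then have lt: "i < 2 ^ (tlen (qn x) + 1) * ?b * ?b" using t(2) unfolding i distrib_right by linarith
  have "i mod ?b = u" "i div ?b = ?v * ?b + t" using t(2) by (simp_all add: i)
  moreover have "(?v * ?b + t) mod ?b = t" using t(1) by simp
  ultimately have "argmin (depth ((!) (decode_type (qn x) (i div ?b div ?b)))) (i div ?b mod ?b) (i mod ?b) \<le> u"
    using argmin_in[OF t(3), of "depth ((!) (decode_type (qn x) (i div ?b div ?b)))"] by simp
  also have "u \<le> 2 ^ (8 * lam (qn x) + 4)"
    using t(2) power_increasing[of "bexp (qn x)" "8 * lam (qn x) + 4" "2::nat"] by linarith
  finally have "argmin (depth ((!) (decode_type (qn x) (i div ?b div ?b)))) (i div ?b mod ?b) (i mod ?b) < 2 ^ (20 * lam (qn x) + 20)"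
    by (rule small_less)
  with lt show ?case by (simp only: nth_tabs fst_conv snd_conv simp_thms)
qed (simp, simp only: nth_tabs fst_conv)

lemma stored_8: "stored (\<lambda>x. {dirty_rank (clip (qn x)) (code (qn x) (qA x)) (sexp (qn x)) (t div 2 ^ sexp (qn x)) * 2 ^ sexp (qn x) + t mod 2 ^ sexp (qn x) | t.
      t \<le> qn x \<and> \<not> clean (clip (qn x)) (code (qn x) (qA x)) (sexp (qn x)) (t div 2 ^ sexp (qn x))})
    (\<lambda>x i. dirty_table (clip (qn x)) (code (qn x) (qA x)) (bexp (qn x)) (sexp (qn x)) i)"
proof (rule stored_large[of 8], goal_cases)
  case (3 x i)
  let ?C = "clip (qn x)" and ?a = "code (qn x) (qA x)" and ?s = "sexp (qn x)"
  obtain t where i: "i = dirty_rank ?C ?a ?s (t div 2 ^ ?s) * 2 ^ ?s + t mod 2 ^ ?s" and t: "t \<le> qn x" "\<not> clean ?C ?a ?s (t div 2 ^ ?s)"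
    using 3(2) by blast
  have "t div 2 ^ ?s < Suc (qn x div 2 ^ ?s)" using div_le_mono[OF t(1), of "2 ^ ?s"] by simp
  from dirty_rank_less[OF this t(2)] have "dirty_rank ?C ?a ?s (t div 2 ^ ?s) + 1 \<le> dirty_count ?C ?a ?s (qn x)"
    by (simp add: dirty_count_def)
  then have "(dirty_rank ?C ?a ?s (t div 2 ^ ?s) + 1) * 2 ^ ?s \<le> dirty_count ?C ?a ?s (qn x) * 2 ^ ?s" by (rule mult_le_mono1)
  moreover have "t mod 2 ^ ?s < 2 ^ ?s" by (rule mod_less_divisor) simp
  ultimately have lt: "i < dirty_count ?C ?a ?s (qn x) * 2 ^ ?s" unfolding i distrib_right by linarith
  have "dirty_table ?C ?a (bexp (qn x)) ?s i < 2 ^ (8 * 2 ^ lam (qn x))"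
    unfolding i dirty_table_eq[OF t(2)] by (rule shifted_depth_less[OF t(1)])
  with lt show ?case by (simp only: nth_tabs fst_conv snd_conv simp_thms)
qed (simp, simp only: nth_tabs fst_conv)

lemma stored_9: "stored (\<lambda>x. {..qn x div 2 ^ sexp (qn x) + 2 ^ (sexp (qn x) - bexp (qn x))}) (\<lambda>x m. floor_log m)"
proof (rule stored_small[of 9], goal_cases)
  case (3 x m)
  let ?n = "qn x"
  have "floor_log m < 2 ^ (20 * lam ?n + 20)"
  proof (cases "m = 0")
    case False
    have "2 ^ floor_log m \<le> m" using False by (intro floor_log_exp2_le) simp
    also have "m \<le> ?n + 2 ^ sexp ?n"
    proof -
      have "(2::nat) ^ (sexp ?n - bexp ?n) \<le> 2 ^ sexp ?n" by (intro power_increasing) auto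
      then show ?thesis using 3(2)[unfolded atMost_iff] div_le_dividend[of ?n "2 ^ sexp ?n"] by linarith
    qed
    also have "\<dots> \<le> 2 ^ (2 ^ lam ?n + sexp ?n) + 2 ^ (2 ^ lam ?n + sexp ?n)"
    proof (rule add_mono)
      have "(2::nat) ^ 2 ^ lam ?n \<le> 2 ^ (2 ^ lam ?n + sexp ?n)" by (intro power_increasing) auto
      then show "?n \<le> 2 ^ (2 ^ lam ?n + sexp ?n)" using n_less_lam[of ?n] by linarith
    qed (intro power_increasing; simp)
    also have "\<dots> = 2 ^ (2 ^ lam ?n + sexp ?n + 1)" by simp
    \<comment> \<open>Although \<open>m\<close> may be as large as \<open>n\<close>, its logarithm
      is linear in \<open>2 ^ lam ?n\<close> and so fits a short field.\<close>
    finally have "floor_log m \<le> 2 ^ lam ?n + sexp ?n + 1" by (rule power_le_imp_le_exp[rotated]) simp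
    also have "\<dots> \<le> 4 * 2 ^ lam ?n" using Suc_lam_le[of ?n] by simp
    also have "\<dots> = 2 ^ (lam ?n + 2)" by (simp add: power_add)
    also have "\<dots> < 2 ^ (20 * lam ?n + 20)" by (intro power_strict_increasing) auto
    finally show ?thesis .
  qed simp
  then show ?case unfolding nth_tabs using 3 by (auto simp: less_Suc_eq_le)
qed (simp, simp only: nth_tabs fst_conv)

lemma stored_10: "stored (\<lambda>x. sparse_cells (qn x) (bexp (qn x)) (sexp (qn x)) (mu (qn x)))
    (\<lambda>x i. sparse (depth (code (qn x) (qA x))) (bexp (qn x)) (sexp (qn x)) (i div 2 ^ mu (qn x)) (i mod 2 ^ mu (qn x)))"
proof (rule stored_small[of 10], goal_cases)
  case (3 x i)
  have "sparse (depth (code (qn x) (qA x))) (bexp (qn x)) (sexp (qn x)) (i div 2 ^ mu (qn x)) (i mod 2 ^ mu (qn x)) \<le> 2 ^ sexp (qn x)"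
    by (rule less_imp_le[OF sparse_cells_bounds(2)[OF 3(2)]])
  also have "\<dots> \<le> 2 ^ (8 * lam (qn x) + 4)" by (intro power_increasing) auto
  finally have "sparse (depth (code (qn x) (qA x))) (bexp (qn x)) (sexp (qn x)) (i div 2 ^ mu (qn x)) (i mod 2 ^ mu (qn x)) < 2 ^ (20 * lam (qn x) + 20)"
    by (rule small_less)
  with sparse_cells_bounds(1)[OF 3(2)] show ?case by (simp only: nth_tabs fst_conv snd_conv simp_thms)
qed (simp, simp only: nth_tabs fst_conv)

lemma stored_11: "stored (\<lambda>x. sparse_cells (qn x) (sexp (qn x)) (2 ^ (lam (qn x) + 2)) (lam (qn x) + 1))
    (\<lambda>x i. sparse (depth (code (qn x) (qA x))) (sexp (qn x)) (2 ^ (lam (qn x) + 2)) (i div 2 ^ (lam (qn x) + 1)) (i mod 2 ^ (lam (qn x) + 1)))"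
proof (rule stored_large[of 11], goal_cases)
  case (3 x i)
  have "sparse (depth (code (qn x) (qA x))) (sexp (qn x)) (2 ^ (lam (qn x) + 2)) (i div 2 ^ (lam (qn x) + 1)) (i mod 2 ^ (lam (qn x) + 1)) < 2 ^ (8 * 2 ^ lam (qn x))"
    by (rule n_le_exp, rule le_trans[OF sparse_cells_bounds(3)[OF 3(2)]]) simp
  with sparse_cells_bounds(1)[OF 3(2)] show ?case by (simp only: nth_tabs fst_conv snd_conv simp_thms)
qed (simp, simp only: nth_tabs fst_conv)

sublocale index queries "\<lambda>x. w (qn x)" qn "\<lambda>x. index_of (qn x) (qA x)" qA
  "\<lambda>x. init_regs (w (qn x)) K [qn x, qi x, qj x]" "3 * K + 1" K
  "\<lambda>x. code (qn x) (qA x)" "\<lambda>x. bexp (qn x)" "\<lambda>x. sexp (qn x)" "\<lambda>x. 2 ^ (lam (qn x) + 2)" "\<lambda>x. mu (qn x)"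
  "\<lambda>x. lam (qn x) + 1" "\<lambda>x. clip (qn x)" "\<lambda>x. tl_len (qn x)" "\<lambda>x. tl_enc (qn x)"
  "\<lambda>x. param (width (qn x)) (qn x) (qA x) 18"
proof (intro index.intro index_axioms.intro ram_axioms)
  show "cw (\<lambda>x. w (qn x))" by (rule cw_word_size)
  show "big qn" using big_input[of 0] by simp
  show "big (\<lambda>x. bexp (qn x))" using big_param[of 0] by (simp add: param_def)
  show "big (\<lambda>x. sexp (qn x))" using big_param[of 1] by (simp add: param_def)
  show "big (\<lambda>x. 2 ^ (lam (qn x) + 2))" using big_param[of 2] by (simp add: param_def)
  show "big (\<lambda>x. mu (qn x))" using big_param[of 3] by (simp add: param_def)
  show "big (\<lambda>x. lam (qn x) + 1)" using big_param[of 4] by (simp add: param_def)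
  show "big (\<lambda>x. param (width (qn x)) (qn x) (qA x) 18)" by (rule big_param) simp
  show "stored (\<lambda>x. {..qn x div 2 ^ sexp (qn x)})
       (\<lambda>x S. \<Sum>k<S * 2 ^ (sexp (qn x) - bexp (qn x)). tl_len (qn x) (block (clip (qn x)) (2 ^ bexp (qn x)) (code (qn x) (qA x)) k))"
    using stored_0 unfolding blocklen_def .
  show "stored (\<lambda>x. {..qn x div 2 ^ bexp (qn x)})
       (\<lambda>x l. \<Sum>k=l div 2 ^ (sexp (qn x) - bexp (qn x)) * 2 ^ (sexp (qn x) - bexp (qn x))..<l.
         tl_len (qn x) (block (clip (qn x)) (2 ^ bexp (qn x)) (code (qn x) (qA x)) k))"
    using stored_1 unfolding blocklen_def .
  show "stored (\<lambda>x. {..qn x div 2 ^ bexp (qn x)}) (\<lambda>x l. tl_len (qn x) (block (clip (qn x)) (2 ^ bexp (qn x)) (code (qn x) (qA x)) l))"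
    using stored_2 unfolding blocklen_def .
  note t = stored_6[unfolded decode_type_def] stored_7[unfolded decode_type_def]
  show "stored (\<lambda>x. {(2 ^ tl_len (qn x) \<tau> + tl_enc (qn x) \<tau>) * 2 ^ bexp (qn x) + t | \<tau> t. \<tau> \<in> types (clip (qn x)) (2 ^ bexp (qn x)) \<and> t < 2 ^ bexp (qn x)})
       (\<lambda>x i. type_depth (clip (qn x)) (bexp (qn x))
          (inv_into (types (clip (qn x)) (2 ^ bexp (qn x))) (\<lambda>\<tau>. 2 ^ tl_len (qn x) \<tau> + tl_enc (qn x) \<tau>) (i div 2 ^ bexp (qn x))) (i mod 2 ^ bexp (qn x)))"
    by (rule t(1))
  show "stored (\<lambda>x. {((2 ^ tl_len (qn x) \<tau> + tl_enc (qn x) \<tau>) * 2 ^ bexp (qn x) + t) * 2 ^ bexp (qn x) + u | \<tau> t u.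
         \<tau> \<in> types (clip (qn x)) (2 ^ bexp (qn x)) \<and> t < 2 ^ bexp (qn x) \<and> u < 2 ^ bexp (qn x) \<and> t \<le> u})
       (\<lambda>x i. argmin (depth ((!) (inv_into (types (clip (qn x)) (2 ^ bexp (qn x))) (\<lambda>\<tau>. 2 ^ tl_len (qn x) \<tau> + tl_enc (qn x) \<tau>)
          (i div 2 ^ bexp (qn x) div 2 ^ bexp (qn x))))) (i div 2 ^ bexp (qn x) mod 2 ^ bexp (qn x)) (i mod 2 ^ bexp (qn x)))"
    by (rule t(2))
  fix x assume x: "x \<in> queries"
  let ?n = "qn x" and ?A = "qA x"
  have n: "1 \<le> ?n" using queryD[OF x] by blast
  have l: "lam ?n + 1 \<le> 2 ^ lam ?n" by (rule Suc_lam_le)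
  show "length (index_of ?n ?A) + K * w ?n < 2 ^ (K * w ?n)" by (rule index_of_less[OF x])
  show "bexp ?n \<le> sexp ?n" by simp
  show "sexp ?n \<le> 2 ^ (lam ?n + 2)" using l unfolding power_add by simp
  show "2 ^ (lam ?n + 2) \<le> K * w ?n" by (rule power_bounds(1)[OF n]) (simp add: power_add)
  show "mu ?n \<le> K * w ?n"
    by (rule power_bounds(1)[OF n]) (use mu_le_exp[of ?n] less_exp[of "mu ?n"] in linarith)
  show "lam ?n + 1 \<le> K * w ?n" by (rule power_bounds(1)[OF n]) (use l in linarith)
  show "?n < 2 ^ 2 ^ (lam ?n + 2)"
    by (rule less_le_trans[OF n_less_lam]) (intro power_increasing, simp_all)
  \<comment> \<open>The size conditions below are reduced to this bound, which \<open>Kw\<close>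
    covers with its factor 200.\<close>
  have b100: "v < 2 ^ (K * w ?n)" if "v \<le> 2 ^ (100 * 2 ^ lam ?n)" for v :: nat
    by (rule le_less_trans[OF that power_bounds(2)[OF n]]) simp
  have n2: "?n + 2 \<le> 2 ^ (2 * 2 ^ lam ?n)"
  proof -
    have "?n + 2 \<le> 2 ^ 2 ^ lam ?n * 2" using n_less_lam[of ?n] n by linarith
    also have "\<dots> \<le> 2 ^ 2 ^ lam ?n * 2 ^ 2 ^ lam ?n" by (intro mult_le_mono2 self_le_power) auto
    finally show ?thesis by (simp add: mult_2 power_add)
  qed
  show "?n + 2 ^ sexp ?n < 2 ^ (K * w ?n)"
  proof (rule b100)
    have "?n + 2 ^ sexp ?n \<le> 2 ^ (3 * 2 ^ lam ?n) + 2 ^ (3 * 2 ^ lam ?n)"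
    proof (rule add_mono)
      have "(2::nat) ^ 2 ^ lam ?n \<le> 2 ^ (3 * 2 ^ lam ?n)" by (intro power_increasing) auto
      then show "?n \<le> 2 ^ (3 * 2 ^ lam ?n)" using n_less_lam[of ?n] by linarith
    qed (rule exp_bounds(2))
    also have "\<dots> = 2 ^ (3 * 2 ^ lam ?n + 1)" by simp
    also have "\<dots> \<le> 2 ^ (100 * 2 ^ lam ?n)" using l by (intro power_increasing) auto
    finally show "?n + 2 ^ sexp ?n \<le> 2 ^ (100 * 2 ^ lam ?n)" .
  qed
  show "(?n + 2) * 2 ^ mu ?n < 2 ^ (K * w ?n)"
  proof (rule b100)
    have "(?n + 2) * 2 ^ mu ?n \<le> 2 ^ (2 * 2 ^ lam ?n) * 2 ^ (6 + 2 ^ lam ?n)" by (rule mult_le_mono[OF n2 exp_bounds(3)])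
    also have "\<dots> \<le> 2 ^ (100 * 2 ^ lam ?n)" unfolding power_add[symmetric] using l by (intro power_increasing) auto
    finally show "(?n + 2) * 2 ^ mu ?n \<le> 2 ^ (100 * 2 ^ lam ?n)" .
  qed
  show "(?n + 2) * 2 ^ (lam ?n + 1) < 2 ^ (K * w ?n)"
  proof (rule b100)
    have "(?n + 2) * 2 ^ (lam ?n + 1) \<le> 2 ^ (2 * 2 ^ lam ?n) * 2 ^ 2 ^ lam ?n"
      using n2 l by (intro mult_le_mono power_increasing) auto
    also have "\<dots> \<le> 2 ^ (100 * 2 ^ lam ?n)" unfolding power_add[symmetric] using l by (intro power_increasing) auto
    finally show "(?n + 2) * 2 ^ (lam ?n + 1) \<le> 2 ^ (100 * 2 ^ lam ?n)" .
  qed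
  show "2 ^ bexp ?n + 2 < clip ?n" by (rule clip_gt)
  show "0 \<le> height (code ?n ?A) t" if "t \<le> Suc ?n" for t using height_code_bounds(1)[OF that] .
  show "inj_on (\<lambda>\<tau>. 2 ^ tl_len ?n \<tau> + tl_enc ?n \<tau>) (types (clip ?n) (2 ^ bexp ?n))" by (rule tcode(2))
  show "tl_len ?n \<tau> \<le> K * w ?n \<and> tl_enc ?n \<tau> < 2 ^ tl_len ?n \<tau> \<and>
      2 ^ tl_len ?n \<tau> * 2 * 2 ^ bexp ?n * 2 ^ bexp ?n < (2 ^ (K * w ?n) :: nat)"
    if "\<tau> \<in> types (clip ?n) (2 ^ bexp ?n)" for \<tau>
  proof (intro conjI)
    have tl: "tl_len ?n \<tau> \<le> 10 * 2 ^ lam ?n" using tcode(1)[OF that] tlen_le[of ?n] by linarith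
    show "tl_len ?n \<tau> \<le> K * w ?n" by (rule power_bounds(1)[OF n]) (use tl in linarith)
    show "tl_enc ?n \<tau> < 2 ^ tl_len ?n \<tau>" using tcode(1)[OF that] by blast
    show "2 ^ tl_len ?n \<tau> * 2 * 2 ^ bexp ?n * 2 ^ bexp ?n < (2 ^ (K * w ?n) :: nat)"
    proof (rule b100)
      have "(2::nat) ^ tl_len ?n \<tau> * 2 * 2 ^ bexp ?n * 2 ^ bexp ?n = 2 ^ (tl_len ?n \<tau> + 1 + bexp ?n + bexp ?n)"
        by (simp add: power_add)
      also have "\<dots> \<le> 2 ^ (100 * 2 ^ lam ?n)" using tl l by (intro power_increasing; linarith)
      finally show "(2::nat) ^ tl_len ?n \<tau> * 2 * 2 ^ bexp ?n * 2 ^ bexp ?n \<le> 2 ^ (100 * 2 ^ lam ?n)" .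
    qed
  qed
  show "shifted_depth (clip ?n) (code ?n ?A) (bexp ?n) (sexp ?n) t < 2 ^ (K * w ?n)" if "t \<le> ?n" for t
  proof (rule b100)
    have "(2::nat) ^ (8 * 2 ^ lam ?n) \<le> 2 ^ (100 * 2 ^ lam ?n)" by (intro power_increasing) auto
    then show "shifted_depth (clip ?n) (code ?n ?A) (bexp ?n) (sexp ?n) t \<le> 2 ^ (100 * 2 ^ lam ?n)"
      using shifted_depth_less[OF that, of ?A] by linarith
  qed
  show "sexp ?n - bexp ?n < 2 ^ mu ?n" using mu_ge[of ?n] by linarith
  show "?n + 1 < 2 ^ 2 ^ (lam ?n + 1)"
  proof -
    have "(2::nat) ^ 2 ^ lam ?n < 2 ^ 2 ^ (lam ?n + 1)" by (intro power_strict_increasing) auto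
    then show ?thesis using n_less_lam[of ?n] by linarith
  qed
  show "param (width ?n) ?n ?A 18 + (\<Sum>k<l. tl_len ?n (block (clip ?n) (2 ^ bexp ?n) (code ?n ?A) k)) \<le> length (index_of ?n ?A) \<and>
       read_word (tl_len ?n (block (clip ?n) (2 ^ bexp ?n) (code ?n ?A) l)) (index_of ?n ?A)
         (param (width ?n) ?n ?A 18 + (\<Sum>k<l. tl_len ?n (block (clip ?n) (2 ^ bexp ?n) (code ?n ?A) k)))
       = tl_enc ?n (block (clip ?n) (2 ^ bexp ?n) (code ?n ?A) l)" if ll: "l \<le> ?n div 2 ^ bexp ?n" for l
  proof -
    let ?Rs = "index_bits (start ?n) (width ?n) ?n ?A"
    have p: "param (width ?n) ?n ?A 18 = region_base (map length ?Rs) 14"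
      unfolding map_length_index_bits by (simp add: param_def)
    have k: "14 < length ?Rs" unfolding length_index_bits by simp
    have "(\<Sum>k<l. blocklen ?n ?A k) + blocklen ?n ?A l = (\<Sum>k<Suc l. blocklen ?n ?A k)" by simp
    also have "\<dots> \<le> (\<Sum>k\<le>?n div 2 ^ bexp ?n. blocklen ?n ?A k)" using ll by (intro sum_mono2) auto
    finally have sl: "(\<Sum>k<l. blocklen ?n ?A k) + blocklen ?n ?A l \<le> length (?Rs ! 14)"
      unfolding index_bits_stream length_blockstream .
    have "read_word (blocklen ?n ?A l) (concat ?Rs) (region_base (map length ?Rs) 14 + (\<Sum>k<l. blocklen ?n ?A k))
        = read_word (blocklen ?n ?A l) (blockstream ?n ?A) (\<Sum>k<l. blocklen ?n ?A k)"
      using read_region[OF k sl] unfolding index_bits_stream .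
    also have "\<dots> = take_bit (blocklen ?n ?A l) (tl_enc ?n (block (clip ?n) (2 ^ bexp ?n) (code ?n ?A) l))"
      unfolding blockstream_def using ll by (intro read_stream) simp
    also have "\<dots> = tl_enc ?n (block (clip ?n) (2 ^ bexp ?n) (code ?n ?A) l)"
      using tcode(1)[OF block_in_types[of "clip ?n" "2 ^ bexp ?n" "code ?n ?A" l]]
      by (simp add: take_bit_nat_eq_self_iff blocklen_def)
    finally have r: "read_word (blocklen ?n ?A l) (index_of ?n ?A) (param (width ?n) ?n ?A 18 + (\<Sum>k<l. blocklen ?n ?A k))
        = tl_enc ?n (block (clip ?n) (2 ^ bexp ?n) (code ?n ?A) l)"
      unfolding p index_of_def .
    have "region_base (map length ?Rs) 14 + length (?Rs ! 14) \<le> length (index_of ?n ?A)"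
      using region_within[OF k] unfolding index_of_def .
    then have "param (width ?n) ?n ?A 18 + (\<Sum>k<l. blocklen ?n ?A k) \<le> length (index_of ?n ?A)"
      using sl unfolding p by linarith
    with r show ?thesis unfolding blocklen_def by blast
  qed
qed (rule stored_3 stored_4 stored_5 stored_8 stored_9 stored_10 stored_11)+

lemma query_program:
  "\<exists>P T. \<forall>x\<in>queries. \<exists>t m s. exec (w (qn x)) (index_of (qn x) (qA x)) (qn x) (qA x) P
     (init_regs (w (qn x)) K [qn x, qi x, qj x]) t m s \<and> t \<le> T \<and> m \<le> 1 \<and> result_of (w (qn x)) K s = rmq (qA x) (qi x) (qj x)"
proof -
  let ?lt = "\<lambda>x. qi x < qj x"
  have i: "big (\<lambda>x. qi x)" using big_input[of 1] by simp
  have j: "big (\<lambda>x. qj x)" using big_input[of 2] by simp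
  have lt: "cb ?lt" by (rule cb_big_less[OF i j])
  \<comment> \<open>For \<open>i = j\<close> no position lies behind \<open>i\<close>. Taking
    \<open>i\<close> itself keeps the interval nonempty, and comparing this entry with itself then
    returns the candidate, which is \<open>i\<close>.\<close>
  define f where "f x = (if ?lt x then qi x + 1 else qi x)" for x :: "nat \<times> (nat \<Rightarrow> nat) \<times> nat \<times> nat"
  have f: "big f"
  proof -
    have "big (\<lambda>x. qi x + 1)"
    proof (rule big_add[OF i big_1])
      fix x assume x: "x \<in> queries"
      show "qi x + 1 < 2 ^ (K * w (qn x))" using n_bound[OF x] queryD[OF x] by linarith
    qed
    then show ?thesis unfolding f_def by (intro big_cond lt i)
  qed
  have fj: "f x \<le> qj x" if "x \<in> queries" for x using queryD[OF that] by (auto simp: f_def)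
  have jn: "qj x \<le> qn x" if "x \<in> queries" for x using queryD[OF that] by blast
  define c where "c x = argmin (depth (code (qn x) (qA x))) (f x) (qj x)" for x
  have c: "big c" unfolding c_def by (rule big_argmin[OF f j fj jn])
  have cn: "c x \<in> {1..qn x}" if "x \<in> queries" for x
    using argmin_in[OF fj[OF that], of "depth (code (qn x) (qA x))"] queryD[OF that] by (auto simp: c_def f_def split: if_splits)
  have ii: "number_at (w (qn x)) (init_regs (w (qn x)) K [qn x, qi x, qj x]) [K + 1..<K + 1 + K] = qi x" if "x \<in> queries" for x
  proof (rule number_at_dg)
    show "init_regs (w (qn x)) K [qn x, qi x, qj x] (K + 1 + k) = dg (w (qn x)) k (qi x)" if "k < K" for k
      using init_regs_dg[of 1 "[qn x, qi x, qj x]" k K "w (qn x)"] that by (simp add: add.commute)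
    show "qi x < 2 ^ (K * w (qn x))" using big_less_bound[OF i that] .
  qed
  have inn: "qi x \<in> {1..qn x}" if "x \<in> queries" for x using queryD[OF that] by simp
  have eq: "(if qA x (qi x) < qA x (c x) then qi x else c x) = rmq (qA x) (qi x) (qj x)" if x: "x \<in> queries" for x
  proof (cases "?lt x")
    case True
    have "inj_on (qA x) {1..qn x}" using queryD[OF x] bij_betw_imp_inj_on by blast
    moreover have "rightmost_argmin (depth (code (qn x) (qA x))) (Suc (qi x)) (qj x) (c x)"
      unfolding c_def using argmin[of "Suc (qi x)" "qj x"] True by (simp add: f_def)
    ultimately show ?thesis using rmq_by_depth[of "qA x" "qn x" "qi x" "qj x" "c x"] queryD[OF x] True by simp
  next
    case False
    then have e: "qi x = qj x" using queryD[OF x] by simp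
    then have "c x = qi x" using argmin_in[of "qi x" "qi x"] by (simp add: c_def f_def)
    moreover have "rmq (qA x) (qi x) (qj x) = qi x"
      using rmq_unique_minimum(1)[of "qA x" "qi x" "qi x"] e by simp
    ultimately show ?thesis by simp
  qed
  obtain P T where P: "\<forall>x\<in>queries. \<exists>t m s. exec (w (qn x)) (index_of (qn x) (qA x)) (qn x) (qA x) P
     (init_regs (w (qn x)) K [qn x, qi x, qj x]) t m s \<and> t \<le> T \<and> m \<le> 1 \<and>
     result_of (w (qn x)) K s = (if qA x (qi x) < qA x (c x) then qi x else c x)"
    using minimum_query[OF c cn ii inn] by auto
  show ?thesis
    by (rule exI[of _ P], rule exI[of _ T]) (use P eq in auto)
qed

end

section \<open>Size of the index\<close>

lemma real_div_le: "real (n div m) \<le> real n / real m"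
proof (cases "m = 0")
  case False
  have "real (n div m * m) \<le> real n" by (simp only: of_nat_le_iff div_times_less_eq_dividend)
  then show ?thesis using False by (simp add: le_divide_eq)
qed simp

lemma runs_le: "1 \<le> n \<Longrightarrow> runs n A \<le> n"
proof -
  assume "1 \<le> n"
  have "card {t. head n A t} \<le> card {1..n}" by (rule card_mono) (auto simp: head_def)
  then show ?thesis using card_heads[OF \<open>1 \<le> n\<close>] by simp
qed

text \<open>The two leading terms of the space bound arise here, from the costs of the blocks. Each
  block adds \<open>bexp n + 1\<close> bits of code overhead and a rounding bit, and the boundary
  blocks add \<open>2 * 2 ^ bexp n\<close>.\<close>

lemma length_blockstream_le:
  assumes n: "1 \<le> n"
  shows "real (length (blockstream n A)) \<le> 2 * real (runs n A) + real_of_int \<lceil>log 2 (real (n choose runs n A))\<rceil>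
    + (real n / 2 ^ bexp n + 1) * (real (lam n) + 3) + 2 * 2 ^ bexp n"
proof -
  let ?c = "\<lambda>l. cost (block (clip n) (2 ^ bexp n) (code n A) l)" and ?m = "n div 2 ^ bexp n"
  have "length (blockstream n A) \<le> (\<Sum>l\<le>?m. ?c l + (bexp n + 1))"
    unfolding length_blockstream blocklen_def using tcode(1)[OF block_in_types] by (intro sum_mono) blast
  also have "\<dots> = (\<Sum>l\<le>?m. ?c l) + (?m + 1) * (bexp n + 1)" unfolding sum.distrib by simp
  finally have 1: "real (length (blockstream n A)) \<le> real (\<Sum>l\<le>?m. ?c l) + real ((?m + 1) * (bexp n + 1))"
    by (simp only: of_nat_le_iff flip: of_nat_add)
  have "real (\<Sum>l\<le>?m. ?c l) \<le> real_of_int \<lceil>log 2 (real (n choose runs n A))\<rceil> + real (\<Sum>t\<le>n. code n A t)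
      + real (?m + 1) + 2 * real (2 ^ bexp n)"
  proof (rule sum_cost_le)
    show "t \<in> {1..n}" if "code n A t \<noteq> 0" for t using that by (auto simp: code_eq_0_iff head_def)
    show "card {t. code n A t \<noteq> 0} = runs n A" using card_heads[OF n, of A] by (simp add: code_eq_0_iff)
  qed (use n in auto)
  moreover have "real (\<Sum>t\<le>n. code n A t) \<le> 2 * real (runs n A)"
    using of_nat_mono[OF sum_code_le[OF n, of A], where ?'a = real] by (simp only: of_nat_mult of_nat_numeral)
  moreover have "real (?m + 1) + real ((?m + 1) * (bexp n + 1)) \<le> (real n / 2 ^ bexp n + 1) * (real (lam n) + 3)"
  proof -
    have "real (?m + 1) + real ((?m + 1) * (bexp n + 1)) = real (?m + 1) * real (bexp n + 2)"
      by (simp add: algebra_simps)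
    also have "\<dots> \<le> (real n / 2 ^ bexp n + 1) * (real (lam n) + 3)"
    proof (intro mult_mono)
      show "real (?m + 1) \<le> real n / 2 ^ bexp n + 1" using real_div_le[of n "2 ^ bexp n"] by simp
    qed auto
    finally show ?thesis .
  qed
  ultimately show ?thesis using 1 by simp
qed

text \<open>Overhead per position, as a real function of \<open>l = lam n\<close> to make its limit
  accessible to asymptotic analysis. Because of the rounding in \<open>lam n div 2\<close>, the
  block length is only bounded below by \<open>2 powr (l / 2 - 1 / 2)\<close>.\<close>

definition rate :: "real \<Rightarrow> real" where
  "rate l = (4 * (40 * l + 40) ^ 2 + l + 3) / 2 powr (l / 2 - 1 / 2) + (44 + (40 * l + 40)) / 2 powr l"

text \<open>Overhead that is not proportional to \<open>n\<close>. The dominant term bounds the two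
  tables over block types; its first factor bounds the number of identifiers.\<close>

definition const_part :: "real \<Rightarrow> real" where
  "const_part l = 20 * 128 * 2 powr l + 24 * 2 powr l + 3 * (40 * l + 40)
    + 2 powr (2 powr (l / 2) * (5 * l + 3) + 1) * (2 * (2 powr l) ^ 2 * (40 * l + 40))
    + ((2 powr l) ^ 3 + 1) * (40 * l + 40) + (40 * l + 40) ^ 2 + 16 * (2 powr l) ^ 2 + 2 * 2 powr l + (l + 3)"

lemma rate_tendsto: "(rate \<longlongrightarrow> 0) at_top"
  unfolding rate_def by real_asymp

text \<open>By \<open>exp_exp_lam_le\<close> the denominator is at most \<open>2 * n\<close>. The
  type tables are exponential in \<open>2 powr (l / 2) * (5 * l + 3)\<close>, which
  \<open>2 powr (l - 1)\<close> outgrows: here the shortness of the blocks pays off.\<close>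

lemma const_part_tendsto: "((\<lambda>l. const_part l / 2 powr (2 powr (l - 1))) \<longlongrightarrow> 0) at_top"
  unfolding const_part_def by real_asymp

lemma linear_tendsto: "((\<lambda>l::real. (l + 7) / 2 powr (2 powr (l - 1))) \<longlongrightarrow> 0) at_top"
  by real_asymp

lemma sum_tabs_le:
  assumes n: "1 \<le> n"
  shows "real (\<Sum>(s, N, f)\<leftarrow>tabs n A. N * 2 ^ s) + (real n / 2 ^ bexp n + 1) * (real (lam n) + 3) + 2 * 2 ^ bexp n
      + 20 * 128 * 2 powr real (lam n)
    \<le> real n * rate (real (lam n)) + const_part (real (lam n))"
proof -
  define l where "l = real (lam n)"
  define Z where "Z = (2::real) ^ lam n"
  define b where "b = (2::real) ^ bexp n"
  define s where "s = 2 powr (l / 2 - 1 / 2)"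
  define M where "M = 40 * l + 40"
  define U where "U = (2::real) ^ mu n"
  define D where "D = real (dirty_count (clip n) (code n A) (sexp n) n)"
  define E where "E = (2::real) ^ (tlen n + 1)"
  have l0: "0 \<le> l" by (simp add: l_def)
  have Z1: "1 \<le> Z" by (simp add: Z_def)
  have Zp: "2 powr l = Z" by (simp add: Z_def l_def powr_realpow)
  have b1: "1 \<le> b" by (simp add: b_def)
  have s0: "0 < s" by (simp add: s_def)
  have bp: "b = 2 powr real (bexp n)" by (simp add: b_def powr_realpow)
  have "real (lam n) \<le> 2 * real (bexp n) + 1" by linarith
  then have sb: "s \<le> b" unfolding s_def bp l_def by (intro powr_mono) auto
  have bl: "b \<le> 2 powr (l / 2)" unfolding bp l_def by (intro powr_mono) auto
  have bZ: "b \<le> Z" unfolding b_def Z_def by (intro power_increasing) auto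
  have M1: "1 \<le> M" using l0 by (simp add: M_def)
  have U0: "0 \<le> U" by (simp add: U_def)
  have "real (2 ^ mu n) \<le> real (40 * lam n + 40)" using mu_le[of n] by (simp only: of_nat_le_iff)
  then have UM: "U \<le> M" by (simp add: U_def M_def l_def)
  have Z3: "(2::real) ^ sexp n = Z ^ 3" by (simp add: Z_def power_mult mult.commute)
  have divb: "real (n div 2 ^ bexp n) \<le> real n / s"
  proof -
    have "real (n div 2 ^ bexp n) \<le> real n / b" using real_div_le[of n "2 ^ bexp n"] by (simp add: b_def)
    also have "\<dots> \<le> real n / s" using sb s0 by (intro divide_left_mono) auto
    finally show ?thesis .
  qed
  have divs: "real (n div 2 ^ sexp n) \<le> real n / Z ^ 3"
    using real_div_le[of n "2 ^ sexp n"] by (simp add: Z3)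
  have EZ: "E \<le> 2 powr (2 powr (l / 2) * (5 * l + 3) + 1)"
  proof -
    have "E = 2 powr (b * (5 * l + 3) + 1)" by (simp add: E_def b_def l_def powr_add powr_realpow flip: powr_realpow)
    also have "\<dots> \<le> 2 powr (2 powr (l / 2) * (5 * l + 3) + 1)"
      using bl l0 by (intro powr_mono add_right_mono mult_right_mono) auto
    finally show ?thesis .
  qed
  have E0: "0 \<le> E" by (simp add: E_def)
  \<comment> \<open>A superblock that is not clean stores \<open>Z ^ 3\<close> depths of
    \<open>8 * Z\<close> bits, while it uses up more than \<open>4 * Z ^ 5\<close> of the total of
    at most \<open>2 * n\<close> of all codes. The fifth power in \<open>clip\<close> thus gains a
    factor \<open>1 / Z\<close>.\<close>
  have D: "D * 2 ^ sexp n * 2 ^ (lam n + 3) \<le> real n * (4 / Z)"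
  proof -
    have "dirty_count (clip n) (code n A) (sexp n) n * clip n \<le> (\<Sum>t\<le>n. code n A t)"
      by (rule dirty_count_le) (auto simp: code_eq_0_iff head_def)
    also have "\<dots> \<le> 2 * n" using sum_code_le[OF n, of A] runs_le[OF n, of A] by linarith
    finally have "real (dirty_count (clip n) (code n A) (sexp n) n * clip n) \<le> real (2 * n)" by (simp only: of_nat_le_iff)
    then have "D * (4 * Z ^ 5) \<le> 2 * real n" by (simp add: D_def Z_def power_add power_mult mult.commute)
    then have "D * (4 * Z ^ 5) * (2 / Z) \<le> 2 * real n * (2 / Z)" using Z1 by (intro mult_right_mono) auto
    moreover have "D * (4 * Z ^ 5) * (2 / Z) = D * 2 ^ sexp n * 2 ^ (lam n + 3)"
      using Z1 unfolding Z3 by (simp add: Z_def[symmetric] power_add field_simps eval_nat_numeral)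
    ultimately show ?thesis by (simp add: mult.commute)
  qed
  define X where "X = D * 2 ^ sexp n * 2 ^ (lam n + 3)"
  note D = D[folded X_def]
  \<comment> \<open>Tables of equal shape are grouped: three per superblock, three per block, two
    over types, the explicit depths \<open>X\<close>, the logarithms, the lower and the upper sparse
    table.\<close>
  have sum: "real (\<Sum>(s, N, f)\<leftarrow>tabs n A. N * 2 ^ s) =
      3 * ((real (n div 2 ^ sexp n) + 1) * (8 * Z)) + 3 * ((real (n div 2 ^ bexp n) + 1) * U)
      + E * b * U + E * b * b * U + X
      + (real (n div 2 ^ sexp n) + 2 ^ (sexp n - bexp n) + 1) * U + (real (n div 2 ^ bexp n) + 1) * U * U
      + (real (n div 2 ^ sexp n) + 1) * (2 * Z) * (8 * Z)"
    by (simp add: tabs_def Let_def Z_def U_def E_def b_def X_def D_def power_add algebra_simps)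
  let ?q = "real n / s" and ?p = "real n / Z ^ 3"
  have q0: "0 \<le> ?q" and p0: "0 \<le> ?p" using s0 Z1 by auto
  have "(2::real) ^ (sexp n - bexp n) \<le> 2 ^ sexp n" by (intro power_increasing) auto
  then have si: "(2::real) ^ (sexp n - bexp n) \<le> Z ^ 3" unfolding Z3 .
  have "real (\<Sum>(s, N, f)\<leftarrow>tabs n A. N * 2 ^ s) \<le>
      3 * ((?p + 1) * (8 * Z)) + 3 * ((?q + 1) * M) + E * Z * M + E * Z * Z * M + real n * (4 / Z)
      + (?p + Z ^ 3 + 1) * M + (?q + 1) * M * M + (?p + 1) * (2 * Z) * (8 * Z)"
    unfolding sum using divb divs D UM U0 E0 bZ b1 Z1 M1 si p0 q0
    by (intro add_mono mult_mono mult_nonneg_nonneg add_nonneg_nonneg order_refl) auto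
  moreover have "(real n / 2 ^ bexp n + 1) * (real (lam n) + 3) \<le> (?q + 1) * (l + 3)"
    unfolding l_def[symmetric] b_def[symmetric] using sb s0 l0
    by (intro mult_right_mono add_right_mono divide_left_mono) auto
  moreover have "2 * (2::real) ^ bexp n \<le> 2 * Z" using bZ by (simp add: b_def)
  moreover have "E * Z * M + E * Z * Z * M \<le> 2 powr (2 powr (l / 2) * (5 * l + 3) + 1) * (2 * Z ^ 2 * M)"
  proof -
    have "E * Z * M + E * Z * Z * M = E * (Z * M + Z * Z * M)" by (simp add: algebra_simps)
    also have "Z * M + Z * Z * M \<le> 2 * Z ^ 2 * M"
      using Z1 M1 mult_right_mono[of 1 Z "Z * M"] by (simp add: power2_eq_square algebra_simps)
    then have "E * (Z * M + Z * Z * M) \<le> 2 powr (2 powr (l / 2) * (5 * l + 3) + 1) * (2 * Z ^ 2 * M)"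
      using EZ Z1 M1 by (intro mult_mono) auto
    finally show ?thesis .
  qed
  moreover have "3 * (?q * M) + ?q * M * M + ?q * (l + 3) \<le> real n * ((4 * M ^ 2 + l + 3) / s)"
  proof -
    have "3 * M + M * M \<le> 4 * M ^ 2" using mult_right_mono[of 1 M M] M1 by (simp add: power2_eq_square)
    then have "?q * (3 * M + M * M + (l + 3)) \<le> ?q * (4 * M ^ 2 + l + 3)" using q0 by (intro mult_left_mono) auto
    then show ?thesis by (simp add: algebra_simps add_divide_distrib)
  qed
  moreover have "3 * (?p * (8 * Z)) + real n * (4 / Z) + ?p * M + ?p * (2 * Z) * (8 * Z) \<le> real n * ((44 + M) / Z)"
  proof -
    have z1: "1 / Z ^ 3 * Z \<le> 1 / Z" and z2: "1 / Z ^ 3 \<le> 1 / Z" and z3: "1 / Z ^ 3 * Z * Z = 1 / Z"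
    proof -
      have "Z \<le> Z ^ 2" "Z \<le> Z ^ 3" using self_le_power[OF Z1] by auto
      then show "1 / Z ^ 3 * Z \<le> 1 / Z" "1 / Z ^ 3 \<le> 1 / Z" "1 / Z ^ 3 * Z * Z = 1 / Z"
        using Z1 by (simp_all add: field_simps eval_nat_numeral)
    qed
    have "24 * (1 / Z ^ 3 * Z) + 4 / Z + 1 / Z ^ 3 * M + 16 * (1 / Z ^ 3 * Z * Z) \<le> 24 * (1 / Z) + 4 / Z + 1 / Z * M + 16 * (1 / Z)"
      using z1 z2 M1 Z1 unfolding z3 by (intro add_mono mult_mono) auto
    also have "\<dots> = (44 + M) / Z" using Z1 by (simp add: field_simps)
    finally have "real n * (24 * (1 / Z ^ 3 * Z) + 4 / Z + 1 / Z ^ 3 * M + 16 * (1 / Z ^ 3 * Z * Z)) \<le> real n * ((44 + M) / Z)"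
      by (intro mult_left_mono) auto
    then show ?thesis by (simp add: algebra_simps)
  qed
  ultimately have "real (\<Sum>(s, N, f)\<leftarrow>tabs n A. N * 2 ^ s) + (real n / 2 ^ bexp n + 1) * (real (lam n) + 3) + 2 * 2 ^ bexp n
      \<le> real n * ((4 * M ^ 2 + l + 3) / s) + real n * ((44 + M) / Z) + 24 * Z + 3 * M
      + 2 powr (2 powr (l / 2) * (5 * l + 3) + 1) * (2 * Z ^ 2 * M) + (Z ^ 3 + 1) * M + M ^ 2 + 16 * Z ^ 2 + (l + 3) + 2 * Z"
    by (simp add: algebra_simps power2_eq_square)
  then show ?thesis
    unfolding rate_def const_part_def l_def[symmetric] Zp s_def[symmetric] M_def[symmetric]
    by (simp add: algebra_simps)
qed

section \<open>The overhead is sublinear\<close>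

lemma lam_at_top: "filterlim lam at_top sequentially"
  unfolding filterlim_at_top
proof
  fix k
  have "k \<le> lam n" if "2 ^ 2 ^ k \<le> n" for n
  proof (rule ccontr)
    assume "\<not> k \<le> lam n"
    then have "(2::nat) ^ 2 ^ lam n \<le> 2 ^ 2 ^ k" by (intro power_increasing) auto
    then show False using that n_less_lam[of n] by linarith
  qed
  then show "\<forall>\<^sub>F n in sequentially. k \<le> lam n" using eventually_ge_at_top[of "2 ^ 2 ^ k"] by (rule eventually_mono[rotated])
qed

text \<open>By minimality of \<open>lam n\<close> the left side is at most \<open>n\<close> unless
  \<open>lam n = 0\<close>; the factor 2 pays for that case.\<close>

lemma exp_exp_lam_le:
  assumes "1 \<le> n" shows "2 powr (2 powr (real (lam n) - 1)) \<le> 2 * real n"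
proof (cases "lam n")
  case 0
  have "2 powr (2 powr (- 1)) \<le> (2::real) powr 1" by (intro powr_mono) (auto simp: powr_minus)
  then show ?thesis using 0 assms by simp
next
  case (Suc k)
  have "2 powr (2 powr (real (lam n) - 1)) = real (2 ^ 2 ^ k)" using Suc by (simp add: powr_realpow flip: powr_realpow)
  also have "\<dots> \<le> real n" using lam_le[of n] Suc by (simp only: of_nat_le_iff) simp
  finally show ?thesis by simp
qed

definition overhead :: "nat \<Rightarrow> nat \<Rightarrow> real" where
  "overhead K n = real n * rate (real (lam n)) + const_part (real (lam n)) + 20 * (real K * (real (lam n) + 7))"

lemma overhead_smallo: "overhead K \<in> o(\<lambda>n. real n)"
proof (rule smalloI_tendsto)
  have lr: "filterlim (\<lambda>n. real (lam n)) at_top sequentially"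
    by (rule filterlim_compose[OF filterlim_real_sequentially lam_at_top])
  \<comment> \<open>The terms without a factor \<open>n\<close>, divided by the double exponential
    in place of \<open>n\<close>; the exchange costs a factor 2.\<close>
  define h where "h l = const_part l / 2 powr (2 powr (l - 1)) + 20 * real K * ((l + 7) / 2 powr (2 powr (l - 1)))" for l
  have "((\<lambda>l. h l) \<longlongrightarrow> 0 + 20 * real K * 0) at_top"
    unfolding h_def by (intro tendsto_intros const_part_tendsto linear_tendsto)
  then have h: "((\<lambda>n. 2 * h (real (lam n))) \<longlongrightarrow> 2 * 0) sequentially"
    by (intro tendsto_mult tendsto_const filterlim_compose[OF _ lr]) simp
  have r: "((\<lambda>n. rate (real (lam n))) \<longlongrightarrow> 0) sequentially"
    by (rule filterlim_compose[OF rate_tendsto lr])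
  have up: "((\<lambda>n. rate (real (lam n)) + 2 * h (real (lam n))) \<longlongrightarrow> 0) sequentially"
    using tendsto_add[OF r h] by simp
  have cp: "0 \<le> const_part (real k)" for k
    unfolding const_part_def by (intro add_nonneg_nonneg mult_nonneg_nonneg) auto
  have rp: "0 \<le> rate (real k)" for k
    unfolding rate_def by (intro add_nonneg_nonneg divide_nonneg_nonneg) auto
  have bound: "overhead K n / real n \<le> rate (real (lam n)) + 2 * h (real (lam n))" if n: "1 \<le> n" for n
  proof -
    let ?l = "real (lam n)" let ?X = "2 powr (2 powr (?l - 1))"
    let ?c = "const_part ?l + 20 * (real K * (?l + 7))"
    have X: "0 < ?X" by simp
    have c: "0 \<le> ?c" using cp[of "lam n"] by simp
    have "?X \<le> 2 * real n" by (rule exp_exp_lam_le[OF n])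
    then have "?c * ?X \<le> ?c * (2 * real n)" using c by (intro mult_left_mono)
    then have "?c / real n \<le> 2 * (?c / ?X)" using n X by (simp add: field_simps)
    also have "?c / ?X = h ?l" unfolding h_def by (simp add: field_simps)
    finally have "?c / real n \<le> 2 * h ?l" .
    moreover have "overhead K n / real n = rate ?l + ?c / real n"
      using n by (simp add: overhead_def add_divide_distrib)
    ultimately show ?thesis by simp
  qed
  show "((\<lambda>n. overhead K n / real n) \<longlongrightarrow> 0) sequentially"
  proof (rule tendsto_sandwich[OF _ _ tendsto_const up])
    show "\<forall>\<^sub>F n in sequentially. 0 \<le> overhead K n / real n"
      unfolding overhead_def using cp rp by (intro always_eventually allI divide_nonneg_nonneg add_nonneg_nonneg mult_nonneg_nonneg) auto
    show "\<forall>\<^sub>F n in sequentially. overhead K n / real n \<le> rate (real (lam n)) + 2 * h (real (lam n))"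
      using eventually_ge_at_top[of 1] by (rule eventually_mono) (rule bound)
  qed
  show "\<forall>\<^sub>F n in sequentially. real n \<noteq> 0" using eventually_ge_at_top[of 1] by (rule eventually_mono) auto
qed

lemma (in word_setting) length_index_of_le:
  assumes n: "1 \<le> n"
  shows "real (length (index_of n A)) \<le> 2 * real (runs n A) + real_of_int \<lceil>log 2 (real (n choose runs n A))\<rceil> + overhead K n"
proof -
  have "width n \<le> 128 * 2 ^ lam n + K * (lam n + 7)"
    by (auto simp: width_def power_add not_less intro: trans_le_add2 mult_le_mono2)
  then have "real (20 * width n) \<le> real (20 * (128 * 2 ^ lam n + K * (lam n + 7)))" by (simp only: of_nat_le_iff mult_le_mono2)
  also have "\<dots> = 20 * 128 * 2 powr real (lam n) + 20 * (real K * (real (lam n) + 7))"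
    by (simp add: powr_realpow)
  finally show ?thesis
    unfolding index_of_def length_concat_index_bits overhead_def
    using sum_tabs_le[OF n, of A] length_blockstream_le[OF n, of A] by simp
qed

text \<open>The program may depend on \<open>K\<close>, so \<open>K\<close> has to be uniform in
  \<open>n\<close>, whereas the asymptotic assumption speaks about large \<open>n\<close> only.
  There \<open>2 ^ lam n\<close> is at most twice lg n, which turns 200 into
  \<open>400 / c\<close>.\<close>

lemma exists_word_count:
  fixes w :: "nat \<Rightarrow> nat"
  assumes om: "(\<lambda>n. real (w n)) \<in> \<Omega>(\<lambda>n. log 2 (real n))" and w: "\<And>n. n \<ge> 1 \<Longrightarrow> w n \<ge> 1"
  shows "\<exists>K\<ge>1. \<forall>n\<ge>1. 200 * 2 ^ lam n \<le> K * w n"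
proof -
  obtain c where c: "c > 0" and "\<forall>\<^sub>F n in sequentially. norm (real (w n)) \<ge> c * norm (log 2 (real n))"
    using landau_omega.bigE[OF om] by auto
  then obtain n0 where n0: "\<And>n. n0 \<le> n \<Longrightarrow> c * norm (log 2 (real n)) \<le> norm (real (w n))"
    unfolding eventually_sequentially by blast
  define k where "k = nat \<lceil>400 / c\<rceil>"
  have k: "400 / c \<le> real k" unfolding k_def by (rule real_nat_ceiling_ge)
  \<comment> \<open>One summand for each case below: 200 for \<open>lam n = 0\<close>,
    \<open>k\<close> for large \<open>n\<close>, and the sum for the finitely many
    \<open>n < n0\<close>, where \<open>1 \<le> w n\<close> is enough.\<close>
  define K where "K = 200 + k + (\<Sum>n<n0. 200 * 2 ^ lam n)"
  have "200 * 2 ^ lam n \<le> K * w n" if n: "1 \<le> n" for n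
  proof (cases "n < n0")
    case True
    then have "200 * 2 ^ lam n \<le> (\<Sum>n<n0. (200::nat) * 2 ^ lam n)" by (intro member_le_sum) auto
    also have "\<dots> \<le> K * 1" by (simp add: K_def)
    also have "\<dots> \<le> K * w n" using w[OF n] by (intro mult_le_mono2)
    finally show ?thesis .
  next
    case False
    show ?thesis
    proof (cases "lam n")
      case 0
      have "200 * 1 \<le> K * w n" using w[OF n] by (intro mult_le_mono) (auto simp: K_def)
      then show ?thesis using 0 by simp
    next
      case (Suc m)
      have "2 ^ 2 ^ m \<le> n" using lam_le[of n] Suc by simp
      then have "real (2 ^ 2 ^ m) \<le> real n" by (simp only: of_nat_le_iff)
      then have "log 2 (2 ^ 2 ^ m) \<le> log 2 (real n)" using n by (subst log_le_cancel_iff) auto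
      then have lg: "2 ^ m \<le> log 2 (real n)" by simp
      have "0 \<le> log 2 (real n)" by (rule order_trans[OF _ lg]) simp
      have "200 * 2 ^ lam n = 400 * (2::real) ^ m" using Suc by simp
      also have "\<dots> \<le> 400 * log 2 (real n)" using lg by simp
      also have "\<dots> = 400 / c * (c * log 2 (real n))" using c by simp
      also have "\<dots> \<le> 400 / c * real (w n)" using n0[of n] False c \<open>0 \<le> log 2 (real n)\<close> by (intro mult_left_mono) auto
      also have "\<dots> \<le> real K * real (w n)" 
      proof (intro mult_right_mono)
        have "real k \<le> real K" unfolding K_def by (simp only: of_nat_le_iff)
        then show "400 / c \<le> real K" using k by linarith
      qed simp
      finally have "real (200 * 2 ^ lam n) \<le> real (K * w n)" by simp
      then show ?thesis by (simp only: of_nat_le_iff)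
    qed
  qed
  then show ?thesis by (intro exI[of _ K]) (auto simp: K_def)
qed

theorem theorem2:
  fixes w :: "nat \<Rightarrow> nat"
  assumes "(\<lambda>n. real (w n)) \<in> \<Omega>(\<lambda>n. log 2 (real n))"
    and "\<And>n. n \<ge> 1 \<Longrightarrow> w n \<ge> 1"
  shows "\<exists>(query :: prog) (K :: nat) (T :: nat) (e :: nat \<Rightarrow> real).
    e \<in> o(\<lambda>n. real n) \<and>
    (\<forall>n\<ge>1. \<forall>A :: nat \<Rightarrow> nat. bij_betw A {1..n} {1..n} \<longrightarrow>
      (\<exists>B :: bool list.
        real (length B) \<le> 2 * real (runs n A) + real_of_int \<lceil>log 2 (real (n choose runs n A))\<rceil> + e n \<and>
        (\<forall>i j. 1 \<le> i \<and> i \<le> j \<and> j \<le> n \<longrightarrow>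
          (\<exists>t m s. exec (w n) B n A query (init_regs (w n) K [n, i, j]) t m s \<and>
            t \<le> T \<and> m \<le> 1 \<and> result_of (w n) K s = rmq A i j))))"
proof -
  obtain K where K: "1 \<le> K" "\<And>n. 1 \<le> n \<Longrightarrow> 200 * 2 ^ lam n \<le> K * w n"
    using exists_word_count[OF assms] by blast
  interpret word_setting w K by unfold_locales (use assms(2) K in auto)
  obtain P T where P: "\<forall>x\<in>queries. \<exists>t m s. exec (w (qn x)) (index_of (qn x) (qA x)) (qn x) (qA x) P
     (init_regs (w (qn x)) K [qn x, qi x, qj x]) t m s \<and> t \<le> T \<and> m \<le> 1 \<and> result_of (w (qn x)) K s = rmq (qA x) (qi x) (qj x)"
    using query_program by blast
  have run: "\<exists>t m s. exec (w n) (index_of n A) n A P (init_regs (w n) K [n, i, j]) t m s \<and>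
            t \<le> T \<and> m \<le> 1 \<and> result_of (w n) K s = rmq A i j"
    if "n \<ge> 1" "bij_betw A {1..n} {1..n}" "1 \<le> i \<and> i \<le> j \<and> j \<le> n" for n A i j
    using P[rule_format, of "(n, A, i, j)"] that by (simp add: queries_def)
  show ?thesis
  proof (rule exI[of _ P], rule exI[of _ K], rule exI[of _ T], rule exI[of _ "overhead K"], intro conjI allI impI)
    fix n :: nat and A :: "nat \<Rightarrow> nat" assume n: "1 \<le> n" and A: "bij_betw A {1..n} {1..n}"
    show "\<exists>B :: bool list.
        real (length B) \<le> 2 * real (runs n A) + real_of_int \<lceil>log 2 (real (n choose runs n A))\<rceil> + overhead K n \<and>
        (\<forall>i j. 1 \<le> i \<and> i \<le> j \<and> j \<le> n \<longrightarrow>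
          (\<exists>t m s. exec (w n) B n A P (init_regs (w n) K [n, i, j]) t m s \<and>
            t \<le> T \<and> m \<le> 1 \<and> result_of (w n) K s = rmq A i j))"
      by (rule exI[of _ "index_of n A"], intro conjI allI impI length_index_of_le[OF n]) (rule run[OF n A])
  qed (rule overhead_smallo)
qed

end
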